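(* Let $X=X(A,P,\Sigma)\subseteq Z$ be the rational variety with torus action of complexity one, embedded in its ambient toric variety $Z$, defined by $(A,P,\Sigma)$ with $\Sigma$ complete. Let $\kappa=(u,i_0,i_1,C)$ be a horizontal Demazure $P$-root, with $C=(c_0,\dots,c_r)$. For $s\in\mathbb K$ set $$\alpha(s,\nu,\iota):=\beta_\iota\binom{l_{i_1c_{i_1}}}{\nu}s^\nu,\qquad \iota\in\{0,\dots,r\}\setminus\{i_0,i_1\},\quad \nu=1,\dots,l_{i_1c_{i_1}},$$ where $\beta$ is the unique vector in the row space of $A$ with $\beta_{i_0}=0$ and $\beta_{i_1}=1$. Consider the automorphisms $$\varphi_u(s):=\prod_{\iota\ne i_0,i_1}\ \prod_{\nu=1}^{l_{i_1c_{i_1}}}\lambda_{u_{\nu,\iota}}(\alpha(s,\nu,\iota))\ \in\ \mathrm{Aut}(Z).$$ Then the automorphism $\lambda_\kappa(s)$ of $X$ is the restriction of an automorphism of $Z$: $$\lambda_\kappa(s)=\lambda_u(s)\circ\varphi_u(s)|_X.$$ More explicitly, the comorphism $\bar\lambda_\kappa(s)^*=\exp(s\delta_\kappa)$ satisfies $\bar\lambda_\kappa(s)^*(S_k)=S_k$, and $\bar\lambda_\kappa(s)^*(T_{ij})=T_{ij}$ whenever $i=i_0$ or $j\ne c_i$, and in the remaining cases $$\bar\lambda_\kappa(s)^*(T_{i_1c_{i_1}})=T_{i_1c_{i_1}}+s\,\delta_u(T_{i_1c_{i_1}}),$$ $$\bar\lambda_\kappa(s)^*(T_{\iota c_\iota})=T_{\iota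 c_\iota}+\sum_{\nu=1}^{l_{i_1c_{i_1}}}\alpha(s,\nu,\iota)\,\delta_{u_{\nu,\iota}}(T_{\iota c_\iota}),\qquad \iota\ne i_0,i_1.$$
   Context: $\mathbb K$ is an algebraically closed field of characteristic zero. Construction of $X(A,P,\Sigma)$. Fix $r\ge1$, $n_0,\dots,n_r\ge1$, $n=n_0+\dots+n_r$, $m\ge0$ and $0<s'<n+m-r$. $A=[a_0,\dots,a_r]$ is a $2\times(r+1)$-matrix over $\mathbb K$ with pairwise linearly independent columns. $P$ is an integral $(r+s')\times(n+m)$-matrix with block structure $\begin{bmatrix}L&0\\ d&d'\end{bmatrix}$, where $$L=\begin{bmatrix}-l_0&l_1&\dots&0\\ \vdots&\vdots&\ddots&\vdots\\ -l_0&0&\dots&l_r\end{bmatrix},\qquad l_i=(l_{i1},\dots,l_{in_i})\in\mathbb Z_{\ge1}^{n_i},$$ whose columns $v_{ij}$ ($0\le i\le r$, $1\le j\le n_i$) and $v_k$ ($1\le k\le m$) are pairwise different primitive vectors generating $\mathbb Q^{r+s'}$ as a cone. In $\mathbb K[T_{ij},S_k]$ put $T_i^{l_i}=T_{i1}^{l_{i1}}\cdots T_{in_i}^{l_{in_i}}$ and, for $I=(i_1,i_2,i_3)$ with $0\le i_1<i_2<i_3\le r$, $$g_I=\det\begin{bmatrix}T_{i_1}^{l_{i_1}}&T_{i_2}^{l_{i_2}}&T_{i_3}^{l_{i_3}}\\ a_{i_1}&a_{i_2}&a_{i_3}\end{bmatrix}.$$ $\mathbb K[T_{ij},S_k]$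 is graded by $K=\mathbb Z^{n+m}/\mathrm{im}(P^* )$, the variables having as degrees the classes of the corresponding canonical basis vectors; $R(A,P)=\mathbb K[T_{ij},S_k]/\langle g_I\rangle$. Let $\Sigma$ be a fan in $N=\mathbb Z^{r+s'}$ whose rays are generated precisely by the columns of $P$; $M$ is the dual lattice. Let $Z$ be the toric variety of $\Sigma$ with Cox quotient $p\colon\hat Z\to Z$ by $H=\mathrm{Spec}\,\mathbb K[K]$, where $\hat Z\subseteq\bar Z=\mathbb K^{n+m}$ is open and toric. With $\bar X=V(g_I;\,I)\subseteq\bar Z$ and $\hat X=\bar X\cap\hat Z$, put $X=X(A,P,\Sigma)=p(\hat X)\subseteq Z$, with the action of the subtorus of the acting torus of $Z$ given by $\mathbb Z^{s'}\subseteq\mathbb Z^{r+s'}$; its Cox ring is $R(A,P)$. Demazure roots of $\Sigma$. A Demazure root at a primitive generator $v$ (a column of $P$) is $u\in M$ with $\langle u,v\rangle=-1$ and $\langle u,v'\rangle\ge0$ for all other columns $v'$. It defines a locally nilpotent derivation $\delta_u$ on $\mathbb K[T_{ij},S_k]$: if $T_v$ is the variable corresponding to $v$, then $\delta_u(T_v)=T_v\prod T_{ij}^{\langle u,v_{ij}\rangle}\prod S_k^{\langle u,v_k\rangle}$ and $\delta_u$ vanishes on all other variables. The $\mathbb K$-action on $\bar Z$ with comorphisms $\exp(s\delta_u)$ descends (for $\Sigma$ complete) to the root group $\lambda_u\colon\mathbb K\to\mathrm{Aut}(Z)$. Horizontal Demazure $P$-roots. A horizontal Demazure $P$-root is $\kappa=(u,i_0,i_1,C)$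 with $u\in M$, $0\le i_0\ne i_1\le r$, $C=(c_0,\dots,c_r)$, $1\le c_i\le n_i$, such that: $l_{ic_i}=1$ for all $i\ne i_0,i_1$; $\langle u,v_{ic_i}\rangle=0$ for $i\ne i_0,i_1$ and $\langle u,v_{i_1c_{i_1}}\rangle=-1$; $\langle u,v_{ij}\rangle\ge l_{ij}$ for $i\ne i_0,i_1$, $j\ne c_i$; $\langle u,v_{ij}\rangle\ge0$ for $i\in\{i_0,i_1\}$, $j\ne c_i$; $\langle u,v_{i_0c_{i_0}}\rangle\ge0$; $\langle u,v_k\rangle\ge0$ for all $k$. Then $u$ is also a Demazure root at $v_{i_1c_{i_1}}$. Put $h^u=\prod T_{ij}^{\langle u,v_{ij}\rangle}\prod S_k^{\langle u,v_k\rangle}$ and $h^\zeta=T_{i_1c_{i_1}}^{-1}\prod_{i\ne i_0,i_1}\prod_{j\ne c_i}T_{ij}^{l_{ij}}$. With $\beta$ as in the claim, $\kappa$ defines a locally nilpotent derivation $\delta_\kappa$ on $\mathbb K[T_{ij},S_k]$ by $$\delta_\kappa(T_{ic_i})=\beta_i\frac{h^u}{h^\zeta}\prod_{k\ne i,i_0}\frac{\partial T_k^{l_k}}{\partial T_{kc_k}},\qquad \delta_\kappa(T_{ij})=0\ (j\ne c_i),\qquad\delta_\kappa(S_k)=0,$$ which preserves the grading and the ideal $\langle g_I\rangle$ and hence induces a locally nilpotent derivation on $R(A,P)$. The $\mathbb K$-action $\bar\lambda_\kappa$ with comorphisms $\exp(s\delta_\kappa)$ on $\bar X$ descends to the root group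 $\lambda_\kappa\colon\mathbb K\to\mathrm{Aut}(X)$. The forms $u_{\nu,\iota}$. Let $e_0'=0$ and let $e_1',\dots,e_r'\in M$ be the first $r$ canonical basis vectors. For $\nu=1,\dots,l_{i_1c_{i_1}}$ and $\iota\ne i_0,i_1$ put $u_{\nu,\iota}:=\nu u+e_{i_1}'-e_\iota'\in M$. Each $u_{\nu,\iota}$ is a Demazure root at $v_{\iota c_\iota}$, and the automorphisms $\lambda_{u_{\nu,\iota}}(\cdot)$ commute pairwise, so the product $\varphi_u(s)$ does not depend on the order of factors. *)

theory Defs
  imports "HOL-Analysis.Analysis" "HOL-Computational_Algebra.Computational_Algebra"
    "HOL-Library.Poly_Mapping"
begin

section \<open>Polynomials in the variables T_ij, S_k\<close>

datatype var = Tv nat nat | Sv nat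

type_synonym 'k mpoly = "(var \<Rightarrow>\<^sub>0 nat) \<Rightarrow>\<^sub>0 'k"

definition Const :: "'k \<Rightarrow> 'k::field mpoly" where
  "Const a = Poly_Mapping.single 0 a"

definition Var :: "var \<Rightarrow> 'k::field mpoly" where
  "Var w = Poly_Mapping.single (Poly_Mapping.single w 1) 1"

definition mp_eval :: "(var \<Rightarrow> 'k) \<Rightarrow> 'k::field mpoly \<Rightarrow> 'k" where
  "mp_eval x f = (\<Sum>a\<in>Poly_Mapping.keys f. Poly_Mapping.lookup f a * (\<Prod>w\<in>Poly_Mapping.keys a. x w ^ Poly_Mapping.lookup a w))"

definition mp_deriv :: "var \<Rightarrow> 'k::field mpoly \<Rightarrow> 'k mpoly" where
  "mp_deriv w f = (\<Sum>a\<in>Poly_Mapping.keys f.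
     Poly_Mapping.single (a - Poly_Mapping.single w 1) (of_nat (Poly_Mapping.lookup a w) * Poly_Mapping.lookup f a))"

text \<open>The \<open>\<K>\<close>-linear derivation with prescribed values \<open>d w\<close> on the variables \<open>w \<in> V\<close>.\<close>

definition derivation_of :: "var set \<Rightarrow> (var \<Rightarrow> 'k::field mpoly) \<Rightarrow> 'k mpoly \<Rightarrow> 'k mpoly" where
  "derivation_of V d f = (\<Sum>w\<in>V. d w * mp_deriv w f)"

text \<open>\<open>exp (s \<delta>)\<close>. For locally nilpotent \<open>\<delta>\<close> the set of indices is finite.\<close>

definition exp_lnd :: "'k \<Rightarrow> ('k mpoly \<Rightarrow> 'k mpoly) \<Rightarrow> 'k::field_char_0 mpoly \<Rightarrow> 'k mpoly" where
  "exp_lnd s \<delta> f = (\<Sum>k | (\<delta> ^^ k) f \<noteq> 0. Const (s ^ k / fact k) * (\<delta> ^^ k) f)"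


section \<open>The defining data A, P\<close>

text \<open>
  \<open>Amat D t i\<close> (\<open>t \<in> {0,1}\<close>, \<open>i \<le> r\<close>) is the entry of \<open>A\<close> in row \<open>t\<close> and column \<open>a\<^sub>i\<close>;
  \<open>Pmat D q w\<close> (\<open>1 \<le> q \<le> r + s'\<close>) is the entry of \<open>P\<close> in row \<open>q\<close> and the column belonging to
  the variable \<open>w\<close>; \<open>lexp D i j\<close> is \<open>l\<^sub>i\<^sub>j\<close>.
\<close>

record 'k AP_data =
  rr :: nat
  nn :: "nat \<Rightarrow> nat"
  mm :: nat
  ss :: nat
  Amat :: "nat \<Rightarrow> nat \<Rightarrow> 'k"
  Pmat :: "nat \<Rightarrow> var \<Rightarrow> int"
  lexp :: "nat \<Rightarrow> nat \<Rightarrow> nat"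

definition dimN :: "'k AP_data \<Rightarrow> nat" where
  "dimN D = rr D + ss D"

definition vars :: "'k AP_data \<Rightarrow> var set" where
  "vars D = {Tv i j | i j. i \<le> rr D \<and> 1 \<le> j \<and> j \<le> nn D i} \<union> {Sv k | k. 1 \<le> k \<and> k \<le> mm D}"

text \<open>Vectors are functions on \<open>nat\<close> vanishing outside \<open>{1..d}\<close>; this serves for
  \<open>N = M = \<int>\<^sup>d\<close> as well as for \<open>\<rat>\<^sup>d\<close>.\<close>

definition lattice :: "nat \<Rightarrow> (nat \<Rightarrow> int) set" where
  "lattice d = {v. \<forall>q. q \<notin> {1..d} \<longrightarrow> v q = 0}"

definition ratspace :: "nat \<Rightarrow> (nat \<Rightarrow> rat) set" where
  "ratspace d = {v. \<forall>q. q \<notin> {1..d} \<longrightarrow> v q = 0}"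

definition pair :: "nat \<Rightarrow> (nat \<Rightarrow> 'a::comm_ring_1) \<Rightarrow> (nat \<Rightarrow> 'a) \<Rightarrow> 'a" where
  "pair d u v = (\<Sum>q = 1..d. u q * v q)"

definition rvec :: "(nat \<Rightarrow> int) \<Rightarrow> nat \<Rightarrow> rat" where
  "rvec v = (\<lambda>q. of_int (v q))"

definition col :: "'k AP_data \<Rightarrow> var \<Rightarrow> nat \<Rightarrow> int" where
  "col D w = (\<lambda>q. if q \<in> {1..dimN D} then Pmat D q w else 0)"

definition cone_gen :: "(nat \<Rightarrow> rat) set \<Rightarrow> (nat \<Rightarrow> rat) set" where
  "cone_gen G = {\<lambda>q. \<Sum>v\<in>G. c v * v q | c. \<forall>v\<in>G. 0 \<le> c v}"

definition primitive :: "nat \<Rightarrow> (nat \<Rightarrow> int) \<Rightarrow> bool" where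
  "primitive d v \<longleftrightarrow> v \<in> lattice d \<and> Gcd (v ` {1..d}) = 1"

definition AP_valid :: "'k::field AP_data \<Rightarrow> bool" where
  "AP_valid D \<longleftrightarrow>
     1 \<le> rr D \<and> (\<forall>i\<le>rr D. 1 \<le> nn D i) \<and>
     0 < ss D \<and> ss D < (\<Sum>i\<le>rr D. nn D i) + mm D - rr D \<and>
     (\<forall>i\<le>rr D. \<forall>i'\<le>rr D. i \<noteq> i' \<longrightarrow>
        (\<forall>b b'. (\<forall>t\<in>{0,1}. b * Amat D t i + b' * Amat D t i' = 0) \<longrightarrow> b = 0 \<and> b' = 0)) \<and>
     (\<forall>i\<le>rr D. \<forall>j\<in>{1..nn D i}. 1 \<le> lexp D i j) \<and>
     (\<forall>q\<in>{1..rr D}. \<forall>i\<le>rr D. \<forall>j\<in>{1..nn D i}. Pmat D q (Tv i j) =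
        (if i = 0 then - int (lexp D 0 j) else if i = q then int (lexp D i j) else 0)) \<and>
     (\<forall>q\<in>{1..rr D}. \<forall>k\<in>{1..mm D}. Pmat D q (Sv k) = 0) \<and>
     inj_on (col D) (vars D) \<and>
     (\<forall>w\<in>vars D. primitive (dimN D) (col D w)) \<and>
     cone_gen ((\<lambda>w. rvec (col D w)) ` vars D) = ratspace (dimN D)"


section \<open>Fans\<close>

definition rational_cone :: "nat \<Rightarrow> (nat \<Rightarrow> rat) set \<Rightarrow> bool" where
  "rational_cone d \<sigma> \<longleftrightarrow> (\<exists>G. finite G \<and> G \<subseteq> ratspace d \<and> \<sigma> = cone_gen G)"

definition pointed :: "(nat \<Rightarrow> rat) set \<Rightarrow> bool" where
  "pointed \<sigma> \<longleftrightarrow> (\<forall>x\<in>\<sigma>. (\<lambda>q. - x q) \<in> \<sigma> \<longrightarrow> x = (\<lambda>q. 0))"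

definition is_face :: "nat \<Rightarrow> (nat \<Rightarrow> rat) set \<Rightarrow> (nat \<Rightarrow> rat) set \<Rightarrow> bool" where
  "is_face d \<tau> \<sigma> \<longleftrightarrow>
     (\<exists>u\<in>ratspace d. (\<forall>x\<in>\<sigma>. 0 \<le> pair d u x) \<and> \<tau> = {x\<in>\<sigma>. pair d u x = 0})"

definition fan :: "nat \<Rightarrow> (nat \<Rightarrow> rat) set set \<Rightarrow> bool" where
  "fan d \<Sigma> \<longleftrightarrow> finite \<Sigma> \<and> \<Sigma> \<noteq> {} \<and>
     (\<forall>\<sigma>\<in>\<Sigma>. rational_cone d \<sigma> \<and> pointed \<sigma>) \<and>
     (\<forall>\<sigma>\<in>\<Sigma>. \<forall>\<tau>. is_face d \<tau> \<sigma> \<longrightarrow> \<tau> \<in> \<Sigma>) \<and>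
     (\<forall>\<sigma>\<in>\<Sigma>. \<forall>\<sigma>'\<in>\<Sigma>. is_face d (\<sigma> \<inter> \<sigma>') \<sigma> \<and> is_face d (\<sigma> \<inter> \<sigma>') \<sigma>')"

definition complete_fan :: "nat \<Rightarrow> (nat \<Rightarrow> rat) set set \<Rightarrow> bool" where
  "complete_fan d \<Sigma> \<longleftrightarrow> fan d \<Sigma> \<and> \<Union>\<Sigma> = ratspace d"

definition rays :: "nat \<Rightarrow> (nat \<Rightarrow> rat) set set \<Rightarrow> (nat \<Rightarrow> rat) set set" where
  "rays d \<Sigma> = {\<rho>\<in>\<Sigma>. \<exists>v\<in>ratspace d. v \<noteq> (\<lambda>q. 0) \<and> \<rho> = cone_gen {v}}"


section \<open>Varieties as spaces with regular functions\<close>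

text \<open>
  A variety is given by charts \<open>(U, R)\<close>: an affine open subset \<open>U\<close> with its coordinate ring \<open>R\<close>
  of functions on \<open>U\<close>. The principal open subsets \<open>{h \<noteq> 0}\<close> of the charts form a
  basis of the Zariski topology, and regular functions are locally fractions of elements
  of the rings \<open>R\<close>.
\<close>

type_synonym ('p, 'k) atlas = "('p set \<times> ('p \<Rightarrow> 'k) set) set"

definition points :: "('p, 'k) atlas \<Rightarrow> 'p set" where
  "points \<A> = \<Union>(fst ` \<A>)"

definition zariski_open :: "('p, 'k::field) atlas \<Rightarrow> 'p set \<Rightarrow> bool" where
  "zariski_open \<A> W \<longleftrightarrow> W \<subseteq> points \<A> \<and>
     (\<forall>z\<in>W. \<exists>(U, R)\<in>\<A>. z \<in> U \<and> (\<exists>h\<in>R. h z \<noteq> 0 \<and> {y\<in>U. h y \<noteq> 0} \<subseteq> W))"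

definition regular_on :: "('p, 'k::field) atlas \<Rightarrow> 'p set \<Rightarrow> ('p \<Rightarrow> 'k) \<Rightarrow> bool" where
  "regular_on \<A> W f \<longleftrightarrow>
     (\<forall>z\<in>W. \<exists>(U, R)\<in>\<A>. z \<in> U \<and>
        (\<exists>g\<in>R. \<exists>h\<in>R. h z \<noteq> 0 \<and> (\<forall>y\<in>W \<inter> U. h y \<noteq> 0 \<longrightarrow> f y = g y / h y)))"

definition morphism ::
    "('p, 'k::field) atlas \<Rightarrow> ('q, 'k) atlas \<Rightarrow> ('p \<Rightarrow> 'q) \<Rightarrow> bool" where
  "morphism \<A> \<B> \<phi> \<longleftrightarrow> \<phi> \<in> points \<A> \<rightarrow> points \<B> \<and>
     (\<forall>W. zariski_open \<B> W \<longrightarrow>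
        zariski_open \<A> (\<phi> -` W \<inter> points \<A>) \<and>
        (\<forall>f. regular_on \<B> W f \<longrightarrow> regular_on \<A> (\<phi> -` W \<inter> points \<A>) (f \<circ> \<phi>)))"

definition automorphism :: "('p, 'k::field) atlas \<Rightarrow> ('p \<Rightarrow> 'p) \<Rightarrow> bool" where
  "automorphism \<A> \<phi> \<longleftrightarrow> bij_betw \<phi> (points \<A>) (points \<A>) \<and>
     morphism \<A> \<A> \<phi> \<and> morphism \<A> \<A> (inv_into (points \<A>) \<phi>)"


section \<open>The toric variety Z of a fan\<close>

text \<open>
  The points of the affine chart \<open>Spec \<K>[\<sigma>\<^sup>\<or> \<inter> M]\<close> are the semigroup homomorphisms from
  \<open>\<sigma>\<^sup>\<or> \<inter> M\<close> to the multiplicative monoid \<open>\<K>\<close>. Every point of \<open>Z\<close> lies in a unique torus orbit,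
  that is, there is a unique smallest chart \<open>\<tau> \<in> \<Sigma>\<close> containing it, and there it is a
  homomorphism whose support is \<open>\<tau>\<^sup>\<bottom> \<inter> M\<close>. A point is encoded as this pair \<open>(\<tau>, \<gamma>)\<close>, with
  \<open>\<gamma>\<close> extended by zero; it lies in the chart of \<open>\<sigma>\<close> if and only if \<open>\<tau> \<subseteq> \<sigma>\<close>, where it is the
  restriction of \<open>\<gamma>\<close> to \<open>\<sigma>\<^sup>\<or> \<inter> M \<subseteq> \<tau>\<^sup>\<or> \<inter> M\<close>.
\<close>

type_synonym 'k tpoint = "(nat \<Rightarrow> rat) set \<times> ((nat \<Rightarrow> int) \<Rightarrow> 'k)"

definition dual_monoid :: "nat \<Rightarrow> (nat \<Rightarrow> rat) set \<Rightarrow> (nat \<Rightarrow> int) set" where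
  "dual_monoid d \<sigma> = {u\<in>lattice d. \<forall>x\<in>\<sigma>. 0 \<le> pair d (rvec u) x}"

definition perp :: "nat \<Rightarrow> (nat \<Rightarrow> rat) set \<Rightarrow> (nat \<Rightarrow> int) set" where
  "perp d \<sigma> = {u\<in>lattice d. \<forall>x\<in>\<sigma>. pair d (rvec u) x = 0}"

definition toric_points :: "nat \<Rightarrow> (nat \<Rightarrow> rat) set set \<Rightarrow> 'k::field tpoint set" where
  "toric_points d \<Sigma> = {(\<tau>, \<gamma>). \<tau> \<in> \<Sigma> \<and> \<gamma> (\<lambda>q. 0) = 1 \<and>
     (\<forall>u\<in>dual_monoid d \<tau>. \<forall>u'\<in>dual_monoid d \<tau>. \<gamma> (\<lambda>q. u q + u' q) = \<gamma> u * \<gamma> u') \<and>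
     (\<forall>u. \<gamma> u \<noteq> 0 \<longleftrightarrow> u \<in> perp d \<tau>)}"

definition toric_chart :: "nat \<Rightarrow> (nat \<Rightarrow> rat) set set \<Rightarrow> (nat \<Rightarrow> rat) set \<Rightarrow> 'k::field tpoint set" where
  "toric_chart d \<Sigma> \<sigma> = {(\<tau>, \<gamma>)\<in>toric_points d \<Sigma>. \<tau> \<subseteq> \<sigma>}"

definition char_sum :: "((nat \<Rightarrow> int) \<Rightarrow>\<^sub>0 'k) \<Rightarrow> 'k::field tpoint \<Rightarrow> 'k" where
  "char_sum f z = (\<Sum>u\<in>Poly_Mapping.keys f. Poly_Mapping.lookup f u * snd z u)"

definition toric_coord_ring :: "nat \<Rightarrow> (nat \<Rightarrow> rat) set \<Rightarrow> ('k::field tpoint \<Rightarrow> 'k) set" where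
  "toric_coord_ring d \<sigma> = {char_sum f | f. Poly_Mapping.keys f \<subseteq> dual_monoid d \<sigma>}"

definition toric_variety :: "nat \<Rightarrow> (nat \<Rightarrow> rat) set set \<Rightarrow> ('k::field tpoint, 'k) atlas" where
  "toric_variety d \<Sigma> = {(toric_chart d \<Sigma> \<sigma>, toric_coord_ring d \<sigma>) | \<sigma>. \<sigma> \<in> \<Sigma>}"


section \<open>Cox quotient and the variety X\<close>

definition Zbar :: "'k::field AP_data \<Rightarrow> (var \<Rightarrow> 'k) set" where
  "Zbar D = {x. \<forall>w. w \<notin> vars D \<longrightarrow> x w = 0}"

text \<open>The fan of \<open>Zhat\<close> consists of the faces of the positive orthant which \<open>P\<close> maps into a
  cone of \<open>\<Sigma>\<close>; the points of the corresponding orbits are described by their vanishing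
  coordinates.\<close>

definition Zhat :: "'k::field AP_data \<Rightarrow> (nat \<Rightarrow> rat) set set \<Rightarrow> (var \<Rightarrow> 'k) set" where
  "Zhat D \<Sigma> = {x\<in>Zbar D. \<exists>\<sigma>\<in>\<Sigma>. \<forall>w\<in>vars D. x w = 0 \<longrightarrow> rvec (col D w) \<in> \<sigma>}"

text \<open>The toric morphism \<open>p\<close> given by \<open>P\<close>, with comorphisms \<open>\<chi>\<^sup>u \<mapsto> T ^ P\<^sup>*(u)\<close>.\<close>

definition orbit_cone ::
    "'k::field AP_data \<Rightarrow> (nat \<Rightarrow> rat) set set \<Rightarrow> (var \<Rightarrow> 'k) \<Rightarrow> (nat \<Rightarrow> rat) set" where
  "orbit_cone D \<Sigma> x = \<Inter>{\<sigma>\<in>\<Sigma>. \<forall>w\<in>vars D. x w = 0 \<longrightarrow> rvec (col D w) \<in> \<sigma>}"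

definition cox_quotient ::
    "'k::field AP_data \<Rightarrow> (nat \<Rightarrow> rat) set set \<Rightarrow> (var \<Rightarrow> 'k) \<Rightarrow> 'k tpoint" where
  "cox_quotient D \<Sigma> x = (orbit_cone D \<Sigma> x,
     \<lambda>u. if u \<in> dual_monoid (dimN D) (orbit_cone D \<Sigma> x)
         then \<Prod>w\<in>vars D. x w powi pair (dimN D) u (col D w) else 0)"

definition Tmonom :: "'k::field AP_data \<Rightarrow> nat \<Rightarrow> 'k mpoly" where
  "Tmonom D i = (\<Prod>j = 1..nn D i. Var (Tv i j) ^ lexp D i j)"

definition g_poly :: "'k::field AP_data \<Rightarrow> nat \<Rightarrow> nat \<Rightarrow> nat \<Rightarrow> 'k mpoly" where
  "g_poly D i1 i2 i3 = det (vector
     [vector [Tmonom D i1, Tmonom D i2, Tmonom D i3],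
      vector [Const (Amat D 0 i1), Const (Amat D 0 i2), Const (Amat D 0 i3)],
      vector [Const (Amat D 1 i1), Const (Amat D 1 i2), Const (Amat D 1 i3)]]
     :: 'k mpoly ^ 3 ^ 3)"

definition Xbar :: "'k::field AP_data \<Rightarrow> (var \<Rightarrow> 'k) set" where
  "Xbar D = {x\<in>Zbar D. \<forall>i1 i2 i3. i1 < i2 \<and> i2 < i3 \<and> i3 \<le> rr D \<longrightarrow>
     mp_eval x (g_poly D i1 i2 i3) = 0}"

definition Xhat :: "'k::field AP_data \<Rightarrow> (nat \<Rightarrow> rat) set set \<Rightarrow> (var \<Rightarrow> 'k) set" where
  "Xhat D \<Sigma> = Xbar D \<inter> Zhat D \<Sigma>"

definition Z_var :: "'k::field AP_data \<Rightarrow> (nat \<Rightarrow> rat) set set \<Rightarrow> ('k tpoint, 'k) atlas" where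
  "Z_var D \<Sigma> = toric_variety (dimN D) \<Sigma>"

definition X_points :: "'k::field AP_data \<Rightarrow> (nat \<Rightarrow> rat) set set \<Rightarrow> 'k tpoint set" where
  "X_points D \<Sigma> = cox_quotient D \<Sigma> ` Xhat D \<Sigma>"

text \<open>\<open>X\<close> with its structure as a closed subvariety of \<open>Z\<close>.\<close>

definition X_var :: "'k::field AP_data \<Rightarrow> (nat \<Rightarrow> rat) set set \<Rightarrow> ('k tpoint, 'k) atlas" where
  "X_var D \<Sigma> = (\<lambda>(U, R). (U \<inter> X_points D \<Sigma>, R)) ` Z_var D \<Sigma>"


section \<open>Root groups\<close>

text \<open>The selfmap of \<open>Zbar\<close> with comorphism \<open>exp (s \<delta>)\<close>; being an algebra
  homomorphism, the latter is determined by the images of the variables.\<close>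

definition flow ::
    "'k AP_data \<Rightarrow> ('k mpoly \<Rightarrow> 'k mpoly) \<Rightarrow> 'k::field_char_0 \<Rightarrow> (var \<Rightarrow> 'k) \<Rightarrow> var \<Rightarrow> 'k" where
  "flow D \<delta> s x = (\<lambda>w. if w \<in> vars D then mp_eval x (exp_lnd s \<delta> (Var w)) else 0)"

text \<open>The map on \<open>p ` W\<close> to which \<open>f\<close> descends; it is meaningful only if \<open>f\<close> preserves \<open>W\<close> and
  \<open>p (f x)\<close> depends only on \<open>p x\<close>.\<close>

definition descend :: "'a set \<Rightarrow> ('a \<Rightarrow> 'b) \<Rightarrow> ('a \<Rightarrow> 'a) \<Rightarrow> 'b \<Rightarrow> 'b" where
  "descend W p f z = (THE y. \<forall>x\<in>W. p x = z \<longrightarrow> f x \<in> W \<and> p (f x) = y)"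

text \<open>Monomial with exponent vector \<open>e\<close>. It is only used for \<open>e\<close> with values \<open>\<ge> 0\<close>, so that
  no information is lost in the conversion by \<open>nat\<close>.\<close>

definition monomial :: "'k::field AP_data \<Rightarrow> (var \<Rightarrow> int) \<Rightarrow> 'k mpoly" where
  "monomial D e = (\<Prod>w\<in>vars D. Var w ^ nat (e w))"

text \<open>\<open>\<delta>\<^sub>u\<close> for a Demazure root \<open>u\<close> at the column of the variable \<open>v\<close>; there
  \<open>\<langle>u, v\<rangle> = -1\<close>, so the extra factor \<open>T\<^sub>v\<close> makes the exponent of \<open>T\<^sub>v\<close> zero.\<close>

definition delta_u :: "'k::field AP_data \<Rightarrow> var \<Rightarrow> (nat \<Rightarrow> int) \<Rightarrow> 'k mpoly \<Rightarrow> 'k mpoly" where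
  "delta_u D v u = derivation_of (vars D) (\<lambda>w. if w = v
     then monomial D (\<lambda>w'. (if w' = v then 1 else 0) + pair (dimN D) u (col D w'))
     else 0)"

definition lambda_u ::
    "'k::field_char_0 AP_data \<Rightarrow> (nat \<Rightarrow> rat) set set \<Rightarrow> var \<Rightarrow> (nat \<Rightarrow> int) \<Rightarrow> 'k \<Rightarrow> 'k tpoint \<Rightarrow> 'k tpoint"
  where
  "lambda_u D \<Sigma> v u s = descend (Zhat D \<Sigma>) (cox_quotient D \<Sigma>) (flow D (delta_u D v u) s)"

definition horizontal_P_root ::
    "'k AP_data \<Rightarrow> (nat \<Rightarrow> int) \<Rightarrow> nat \<Rightarrow> nat \<Rightarrow> (nat \<Rightarrow> nat) \<Rightarrow> bool" where
  "horizontal_P_root D u i0 i1 c \<longleftrightarrow>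
     (let pr = (\<lambda>w. pair (dimN D) u (col D w)) in
      u \<in> lattice (dimN D) \<and> i0 \<le> rr D \<and> i1 \<le> rr D \<and> i0 \<noteq> i1 \<and>
      (\<forall>i\<le>rr D. c i \<in> {1..nn D i}) \<and>
      (\<forall>i\<in>{0..rr D} - {i0, i1}. lexp D i (c i) = 1) \<and>
      (\<forall>i\<in>{0..rr D} - {i0, i1}. pr (Tv i (c i)) = 0) \<and>
      pr (Tv i1 (c i1)) = -1 \<and>
      (\<forall>i\<in>{0..rr D} - {i0, i1}. \<forall>j\<in>{1..nn D i} - {c i}. pr (Tv i j) \<ge> int (lexp D i j)) \<and>
      (\<forall>i\<in>{i0, i1}. \<forall>j\<in>{1..nn D i} - {c i}. pr (Tv i j) \<ge> 0) \<and>
      pr (Tv i0 (c i0)) \<ge> 0 \<and>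
      (\<forall>k\<in>{1..mm D}. pr (Sv k) \<ge> 0))"

text \<open>Exponent vector of the Laurent monomial \<open>h\<^sup>\<zeta>\<close>.\<close>

fun zeta :: "'k AP_data \<Rightarrow> nat \<Rightarrow> nat \<Rightarrow> (nat \<Rightarrow> nat) \<Rightarrow> var \<Rightarrow> int" where
  "zeta D i0 i1 c (Tv i j) =
     (if i = i1 \<and> j = c i1 then -1
      else if i \<noteq> i0 \<and> i \<noteq> i1 \<and> j \<noteq> c i then int (lexp D i j) else 0)"
| "zeta D i0 i1 c (Sv k) = 0"

text \<open>\<open>h\<^sup>u / h\<^sup>\<zeta>\<close>, which for a horizontal Demazure P-root is an honest monomial.\<close>

definition h_quot :: "'k::field AP_data \<Rightarrow> (nat \<Rightarrow> int) \<Rightarrow> nat \<Rightarrow> nat \<Rightarrow> (nat \<Rightarrow> nat) \<Rightarrow> 'k mpoly" where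
  "h_quot D u i0 i1 c = monomial D (\<lambda>w. pair (dimN D) u (col D w) - zeta D i0 i1 c w)"

fun delta_kappa_var :: "'k::field AP_data \<Rightarrow> (nat \<Rightarrow> 'k) \<Rightarrow>
    (nat \<Rightarrow> int) \<Rightarrow> nat \<Rightarrow> nat \<Rightarrow> (nat \<Rightarrow> nat) \<Rightarrow> var \<Rightarrow> 'k mpoly" where
  "delta_kappa_var D \<beta> u i0 i1 c (Tv i j) =
     (if j = c i
      then Const (\<beta> i) * h_quot D u i0 i1 c *
           (\<Prod>k\<in>{0..rr D} - {i, i0}. mp_deriv (Tv k (c k)) (Tmonom D k))
      else 0)"
| "delta_kappa_var D \<beta> u i0 i1 c (Sv k) = 0"

definition delta_kappa :: "'k::field AP_data \<Rightarrow> (nat \<Rightarrow> 'k) \<Rightarrow>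
    (nat \<Rightarrow> int) \<Rightarrow> nat \<Rightarrow> nat \<Rightarrow> (nat \<Rightarrow> nat) \<Rightarrow> 'k mpoly \<Rightarrow> 'k mpoly" where
  "delta_kappa D \<beta> u i0 i1 c = derivation_of (vars D) (delta_kappa_var D \<beta> u i0 i1 c)"

definition lambda_kappa ::
    "'k::field_char_0 AP_data \<Rightarrow> (nat \<Rightarrow> rat) set set \<Rightarrow> (nat \<Rightarrow> 'k) \<Rightarrow>
     (nat \<Rightarrow> int) \<Rightarrow> nat \<Rightarrow> nat \<Rightarrow> (nat \<Rightarrow> nat) \<Rightarrow> 'k \<Rightarrow> 'k tpoint \<Rightarrow> 'k tpoint" where
  "lambda_kappa D \<Sigma> \<beta> u i0 i1 c s =
     descend (Xhat D \<Sigma>) (cox_quotient D \<Sigma>) (flow D (delta_kappa D \<beta> u i0 i1 c) s)"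

definition e' :: "nat \<Rightarrow> nat \<Rightarrow> int" where
  "e' i q = (if 1 \<le> i \<and> q = i then 1 else 0)"

definition u_form :: "(nat \<Rightarrow> int) \<Rightarrow> nat \<Rightarrow> nat \<Rightarrow> nat \<Rightarrow> nat \<Rightarrow> int" where
  "u_form u i1 \<nu> \<iota> = (\<lambda>q. int \<nu> * u q + e' i1 q - e' \<iota> q)"

definition in_row_space :: "'k::field AP_data \<Rightarrow> (nat \<Rightarrow> 'k) \<Rightarrow> bool" where
  "in_row_space D \<beta> \<longleftrightarrow>
     (\<exists>b b'. \<forall>i\<le>rr D. \<beta> i = b * Amat D 0 i + b' * Amat D 1 i)"

definition alpha :: "'k::field AP_data \<Rightarrow> (nat \<Rightarrow> 'k) \<Rightarrow> nat \<Rightarrow> (nat \<Rightarrow> nat) \<Rightarrow> 'k \<Rightarrow> nat \<Rightarrow> nat \<Rightarrow> 'k" where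
  "alpha D \<beta> i1 c s \<nu> \<iota> = \<beta> \<iota> * of_nat (lexp D i1 (c i1) choose \<nu>) * s ^ \<nu>"

text \<open>The product \<open>\<phi>\<^sub>u(s)\<close>, its factors being indexed and ordered by a list of pairs
  \<open>(\<nu>, \<iota>)\<close>.\<close>

definition phi_u ::
    "'k::field_char_0 AP_data \<Rightarrow> (nat \<Rightarrow> rat) set set \<Rightarrow> (nat \<Rightarrow> 'k) \<Rightarrow>
     (nat \<Rightarrow> int) \<Rightarrow> nat \<Rightarrow> (nat \<Rightarrow> nat) \<Rightarrow> (nat \<times> nat) list \<Rightarrow> 'k \<Rightarrow> 'k tpoint \<Rightarrow> 'k tpoint" where
  "phi_u D \<Sigma> \<beta> u i1 c ps s = foldr (\<lambda>(\<nu>, \<iota>) F.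
     lambda_u D \<Sigma> (Tv \<iota> (c \<iota>)) (u_form u i1 \<nu> \<iota>) (alpha D \<beta> i1 c s \<nu> \<iota>) \<circ> F) ps id"

end

theory Submission
  imports Defs
begin

text \<open>
  On \<open>Zbar\<close> the flow of \<open>\<delta>\<^sub>\<kappa>\<close> is computed explicitly: the variable \<open>T\<close> with index \<open>(i1, c i1)\<close> is sent to
  \<open>T + s q\<close> with a monomial \<open>q\<close> in the kernel, and the variables with index \<open>(\<iota>, c \<iota>)\<close> are shifted by
  binomial sums in \<open>T\<close> and \<open>q\<close> whose terms are the flows of the Demazure roots \<open>u_form u i1 \<nu> \<iota>\<close>. The flow
  moves the vector of the monomials \<open>T\<^sub>i\<close> along \<open>\<beta>\<close>, so it preserves \<open>Xbar\<close>.

  What remains is to descend the flow of a Demazure root \<open>u\<close> at \<open>v\<close> to \<open>Z\<close>. On the chart of a cone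
  containing \<open>v\<close> it maps the character \<open>\<chi>\<^sup>w\<close> to a sum of terms \<open>s\<^sup>k \<chi>\<^bsup>w + k u\<^esup>\<close>; on other charts it multiplies
  \<open>\<chi>\<^sup>w\<close> by a power of \<open>1 + s \<chi>\<^sup>u\<close>. By completeness, a point outside all charts of the first kind has
  \<open>\<chi>\<^sup>u = 0\<close>, so that the second description applies near it. Since the values of characters separate
  the points of a chart, these formulas also show that the flow is well defined on the quotient, which
  in the non-simplicial case is not a set of orbits.
\<close>

section \<open>Cones over the rational numbers\<close>

text \<open>The fan axioms allow arbitrary finite generators and give faces by rational functionals,
  while computing with characters needs the columns of \<open>P\<close>. So every cone must first be
  shown to be generated by the columns it contains. This uses that extremal rays of pointed cones
  are faces, hence a separation theorem over the rationals, where elimination replaces compactness.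

  \<open>descend\<close> says nothing about a point without preimage, so root maps can be studied on
  all of \<open>Z\<close> only once the Cox quotient is known to be surjective. Algebraic closedness
  enters there, through roots in the field.

  The binomial sums arise as follows. Let \<open>T\<close> be the variable of index
  \<open>(i1, c i1)\<close>, \<open>l\<close> its exponent, \<open>q\<close> its image under
  \<delta>_u, and cof_i the monomial T_i without its variable of index \<open>(i, c i)\<close>. The
  root conditions make m = q cof_i1 / cof_\<iota> a monomial, and the variable of index
  \<open>(\<iota>, c \<iota>)\<close> moves by \<beta>_\<iota> m ((T + s q)^l - T^l) / q. In its
  \<nu>-th term, T^(l-\<nu>) q^(\<nu>-1) m is the monomial of
  \<open>u_form u i1 \<nu> \<iota>\<close>. Since m cof_\<iota> = q cof_i1, each T_i moves by
  \<beta>_i times one common quantity.\<close>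

lemma pair_add_left: "pair d (\<lambda>q. u q + u' q) x = pair d u x + pair d u' x"
  by (simp add: pair_def sum.distrib algebra_simps)

lemma pair_add_right: "pair d u (\<lambda>q. x q + y q) = pair d u x + pair d u y"
  by (simp add: pair_def sum.distrib algebra_simps)

lemma pair_scale_left: "pair d (\<lambda>q. t * u q) x = t * pair d u x"
  by (simp add: pair_def sum_distrib_left algebra_simps)

lemma pair_scale_right: "pair d u (\<lambda>q. t * x q) = t * pair d u x"
  by (simp add: pair_def sum_distrib_left algebra_simps)

lemma pair_diff_left: "pair d (\<lambda>q. u q - u' q) x = pair d u x - pair d u' x"
  by (simp add: pair_def sum_subtractf algebra_simps)

lemma pair_zero_left [simp]: "pair d (\<lambda>q. 0) x = 0"
  by (simp add: pair_def)

lemma pair_zero_right [simp]: "pair d u (\<lambda>q. 0) = 0"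
  by (simp add: pair_def)

lemma pair_sum_right: "pair d u (\<lambda>q. \<Sum>v\<in>G. f v q) = (\<Sum>v\<in>G. pair d u (f v))"
  unfolding pair_def sum_distrib_left by (rule sum.swap)

lemma pair_sum_left: "pair d (\<lambda>q. \<Sum>v\<in>G. f v q) x = (\<Sum>v\<in>G. pair d (f v) x)"
  unfolding pair_def sum_distrib_right by (rule sum.swap)

lemma pair_combination: "pair d u (\<lambda>q. \<Sum>v\<in>G. c v * v q) = (\<Sum>v\<in>G. c v * pair d u v)"
  by (simp add: pair_sum_right pair_scale_right)

lemma pair_rvec: "pair d (rvec u) (rvec v) = of_int (pair d u v)"
  by (simp add: pair_def rvec_def)

lemma rvec_in_ratspace: "rvec v \<in> ratspace d \<longleftrightarrow> v \<in> lattice d"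
  by (auto simp: rvec_def ratspace_def lattice_def)

section \<open>Finitely generated cones\<close>

lemma cone_genI:
  assumes "\<And>v. v \<in> G \<Longrightarrow> 0 \<le> c v" "x = (\<lambda>q. \<Sum>v\<in>G. c v * v q)"
  shows "x \<in> cone_gen G"
  using assms unfolding cone_gen_def by blast

lemma cone_genE:
  assumes "x \<in> cone_gen G"
  obtains c where "\<forall>v\<in>G. 0 \<le> c v" "x = (\<lambda>q. \<Sum>v\<in>G. c v * v q)"
  using assms unfolding cone_gen_def by blast

lemma cone_gen_pair_nonneg:
  assumes "x \<in> cone_gen G" "\<And>g. g \<in> G \<Longrightarrow> 0 \<le> pair d f g"
  shows "0 \<le> pair d f x"
  using assms(1)
proof (rule cone_genE)
  fix c assume c: "\<forall>v\<in>G. (0::rat) \<le> c v" "x = (\<lambda>q. \<Sum>v\<in>G. c v * v q)"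
  show ?thesis unfolding c(2) pair_combination
    using c(1) assms(2) by (intro sum_nonneg mult_nonneg_nonneg) auto
qed

lemma gen_in_cone_gen:
  assumes "finite G" "g \<in> G" shows "g \<in> cone_gen G"
proof (rule cone_genI[where c = "\<lambda>v. if v = g then 1 else 0"])
  show "g = (\<lambda>q. \<Sum>v\<in>G. (if v = g then 1 else 0) * v q)"
  proof
    fix q
    have "(\<Sum>v\<in>G. (if v = g then 1 else 0) * v q) = (\<Sum>v\<in>G. if v = g then g q else 0)"
      by (rule sum.cong) auto
    then show "g q = (\<Sum>v\<in>G. (if v = g then 1 else 0) * v q)" using assms by simp
  qed
qed auto

lemma zero_in_cone_gen: "(\<lambda>q. 0) \<in> cone_gen G"
  by (rule cone_genI[where c = "\<lambda>v. 0"]) auto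

lemma cone_gen_add:
  assumes "x \<in> cone_gen G" "y \<in> cone_gen G" shows "(\<lambda>q. x q + y q) \<in> cone_gen G"
proof -
  obtain c where c: "\<forall>v\<in>G. 0 \<le> c v" "x = (\<lambda>q. \<Sum>v\<in>G. c v * v q)"
    using assms(1) by (rule cone_genE)
  obtain b where b: "\<forall>v\<in>G. 0 \<le> b v" "y = (\<lambda>q. \<Sum>v\<in>G. b v * v q)"
    using assms(2) by (rule cone_genE)
  show ?thesis
    by (rule cone_genI[where c = "\<lambda>v. c v + b v"])
      (use b(1) c(1) in \<open>simp_all add: c(2) b(2) sum.distrib distrib_right\<close>)
qed

lemma cone_gen_scale:
  assumes "x \<in> cone_gen G" "0 \<le> t" shows "(\<lambda>q. t * x q) \<in> cone_gen G"
proof -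
  obtain c where c: "\<forall>v\<in>G. 0 \<le> c v" "x = (\<lambda>q. \<Sum>v\<in>G. c v * v q)"
    using assms(1) by (rule cone_genE)
  show ?thesis
    by (rule cone_genI[where c = "\<lambda>v. t * c v"])
      (use assms c(1) in \<open>simp_all add: c(2) sum_distrib_left mult.assoc\<close>)
qed

lemma cone_gen_sum:
  assumes "\<And>i. i \<in> I \<Longrightarrow> x i \<in> cone_gen G"
  shows "(\<lambda>q. \<Sum>i\<in>I. x i q) \<in> cone_gen G"
  using assms
proof (induction I rule: infinite_finite_induct)
  case (insert i I)
  then show ?case using cone_gen_add[of "x i" G "\<lambda>q. \<Sum>i\<in>I. x i q"] by simp
qed (auto simp: zero_in_cone_gen)

lemma cone_gen_mono:
  assumes "finite H" "\<And>g. g \<in> G \<Longrightarrow> g \<in> cone_gen H" shows "cone_gen G \<subseteq> cone_gen H"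
proof
  fix x assume "x \<in> cone_gen G"
  then obtain c where c: "\<forall>v\<in>G. 0 \<le> c v" "x = (\<lambda>q. \<Sum>v\<in>G. c v * v q)"
    by (rule cone_genE)
  show "x \<in> cone_gen H" unfolding c(2)
    by (intro cone_gen_sum cone_gen_scale) (use c assms in auto)
qed

text \<open>Isolates the coefficient \<open>t\<close> of one generator; it is the variable
  eliminated in \<open>cone_gen_halfspaces\<close>, and the one compared with the coefficient of
  \<open>g\<close> in \<open>extremal_ray_functional\<close>.\<close>

lemma cone_gen_insert:
  assumes "finite G" "g \<notin> G"
  shows "x \<in> cone_gen (insert g G) \<longleftrightarrow> (\<exists>t\<ge>0. (\<lambda>q. x q - t * g q) \<in> cone_gen G)"
proof
  assume "x \<in> cone_gen (insert g G)"
  then obtain c where c: "\<forall>v\<in>insert g G. 0 \<le> c v" "x = (\<lambda>q. \<Sum>v\<in>insert g G. c v * v q)"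
    by (rule cone_genE)
  have "(\<lambda>q. x q - c g * g q) \<in> cone_gen G"
    by (rule cone_genI[where c = c]) (use c assms in \<open>auto simp: fun_eq_iff\<close>)
  then show "\<exists>t\<ge>0. (\<lambda>q. x q - t * g q) \<in> cone_gen G" using c by auto
next
  assume "\<exists>t\<ge>0. (\<lambda>q. x q - t * g q) \<in> cone_gen G"
  then obtain t where t: "t \<ge> 0" "(\<lambda>q. x q - t * g q) \<in> cone_gen G" by blast
  have fin: "finite (insert g G)" using assms by simp
  have "cone_gen G \<subseteq> cone_gen (insert g G)"
    by (rule cone_gen_mono) (use fin in \<open>auto intro: gen_in_cone_gen\<close>)
  then have "(\<lambda>q. (x q - t * g q) + t * g q) \<in> cone_gen (insert g G)"
    using t cone_gen_add[OF _ cone_gen_scale[OF gen_in_cone_gen[OF fin, of g] t(1)]] by blast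
  then show "x \<in> cone_gen (insert g G)" by simp
qed

text \<open>Fourier--Motzkin elimination of the coefficient of the new generator.\<close>

lemma cone_gen_halfspaces:
  assumes "finite G" "G \<subseteq> ratspace d"
  shows "\<exists>F. finite F \<and> F \<subseteq> ratspace d \<and> cone_gen G = {x\<in>ratspace d. \<forall>f\<in>F. 0 \<le> pair d f x}"
  using assms
proof (induction G rule: finite_induct)
  case empty
  \<comment> \<open>Without generators the cone is the origin, which the coordinate functionals and
    their negatives cut out.\<close>
  let ?e = "\<lambda>(t::rat) p q. if q = p then t else 0"
  let ?F = "(\<lambda>(t, p). ?e t p) ` ({1, -1} \<times> {1..d})"
  have pr: "pair d (?e t p) x = t * x p" if "p \<in> {1..d}" for t p x
    using that by (simp add: pair_def if_distrib[of "\<lambda>t. t * _"] cong: if_cong)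
  have "cone_gen {} = {x\<in>ratspace d. \<forall>f\<in>?F. 0 \<le> pair d f x}" (is "_ = ?R")
  proof
    show "cone_gen {} \<subseteq> ?R" by (auto simp: cone_gen_def ratspace_def)
    show "?R \<subseteq> cone_gen {}"
    proof
      fix x assume x: "x \<in> ?R"
      have "x p = 0" for p
      proof (cases "p \<in> {1..d}")
        case True
        then have "?e 1 p \<in> ?F" "?e (-1) p \<in> ?F" by force+
        then have "0 \<le> pair d (?e 1 p) x" "0 \<le> pair d (?e (-1) p) x" using x by blast+
        then show ?thesis using pr[OF True] by simp
      qed (use x in \<open>auto simp: ratspace_def\<close>)
      then show "x \<in> cone_gen {}" by (simp add: cone_gen_def fun_eq_iff)
    qed
  qed
  moreover have "finite ?F" "?F \<subseteq> ratspace d" by (auto simp: ratspace_def)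
  ultimately show ?case by blast
next
  case (insert g G)
  then obtain F where F: "finite F" "F \<subseteq> ratspace d"
    "cone_gen G = {x\<in>ratspace d. \<forall>f\<in>F. 0 \<le> pair d f x}" by auto
  have g: "g \<in> ratspace d" using insert by auto
  define P where "P = {f\<in>F. 0 < pair d f g}"
  define N where "N = {f\<in>F. pair d f g < 0}"
  define W where "W = {f\<in>F. pair d f g = 0}"
  \<comment> \<open>For \<open>p\<close> positive and \<open>n\<close> negative on \<open>g\<close>
    this is a positive combination of the two that vanishes on \<open>g\<close>, so it does not see
    \<open>t\<close>.\<close>
  define m where "m = (\<lambda>(p, n) q. pair d p g * n q - pair d n g * p q)"
  have mx: "pair d (m (p, n)) x = pair d p g * pair d n x - pair d n g * pair d p x" for p n x
    by (simp add: m_def pair_diff_left pair_scale_left)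
  define F' where "F' = P \<union> W \<union> m ` (P \<times> N)"
  have fin: "finite P" "finite N" "finite W" using F by (auto simp: P_def N_def W_def)
  have "m (p, n) \<in> ratspace d" if "p \<in> F" "n \<in> F" for p n
    using subsetD[OF F(2) that(1)] subsetD[OF F(2) that(2)] by (auto simp: m_def ratspace_def)
  then have "F' \<subseteq> ratspace d" using F(2) by (auto simp: F'_def P_def N_def W_def)
  moreover have "finite F'" using fin by (simp add: F'_def)
  moreover have "cone_gen (insert g G) = {x\<in>ratspace d. \<forall>f\<in>F'. 0 \<le> pair d f x}" (is "_ = ?R")
  proof (rule set_eqI)
    fix x
    have "x \<in> cone_gen (insert g G) \<longleftrightarrow>
      (\<exists>t\<ge>0. (\<lambda>q. x q - t * g q) \<in> ratspace d \<and> (\<forall>f\<in>F. 0 \<le> pair d f x - t * pair d f g))"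
      using insert(1,2) by (simp add: cone_gen_insert F(3) pair_def sum_subtractf sum_distrib_left algebra_simps)
    also have "\<dots> \<longleftrightarrow> x \<in> ratspace d \<and> (\<exists>t\<ge>0. \<forall>f\<in>F. 0 \<le> pair d f x - t * pair d f g)"
    proof -
      have "(\<lambda>q. x q - t * g q) \<in> ratspace d \<longleftrightarrow> x \<in> ratspace d" for t
        using g by (auto simp: ratspace_def)
      then show ?thesis by auto
    qed
    also have "(\<exists>t\<ge>0. \<forall>f\<in>F. 0 \<le> pair d f x - t * pair d f g) \<longleftrightarrow> (\<forall>f\<in>F'. 0 \<le> pair d f x)"
    proof
      assume "\<exists>t\<ge>0. \<forall>f\<in>F. 0 \<le> pair d f x - t * pair d f g"
      then obtain t where t: "t \<ge> 0" "\<And>f. f \<in> F \<Longrightarrow> t * pair d f g \<le> pair d f x" by auto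
      have 1: "0 \<le> pair d f x" if "f \<in> P \<union> W" for f
      proof -
        have "0 \<le> t * pair d f g" using that t(1) by (auto simp: P_def W_def)
        then show ?thesis using t(2)[of f] that by (auto simp: P_def W_def)
      qed
      have 2: "0 \<le> pair d (m (p, n)) x" if "p \<in> P" "n \<in> N" for p n
      proof -
        have "pair d p g * (t * pair d n g) \<le> pair d p g * pair d n x"
          using that t(2)[of n] by (intro mult_left_mono) (auto simp: P_def N_def)
        moreover have "pair d n g * pair d p x \<le> pair d n g * (t * pair d p g)"
          using that t(2)[of p] by (intro mult_left_mono_neg) (auto simp: P_def N_def)
        ultimately show ?thesis unfolding mx by (simp add: algebra_simps)
      qed
      show "\<forall>f\<in>F'. 0 \<le> pair d f x" using 1 2 by (auto simp: F'_def)
    next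
      assume R: "\<forall>f\<in>F'. 0 \<le> pair d f x"
      \<comment> \<open>Functionals negative on \<open>g\<close> bound \<open>t\<close> from below
        by these quotients. The least admissible \<open>t\<close>, counting the bound 0, is tried;
        the functionals in \<open>P\<close> then hold because of the combinations
        \<open>m\<close>.\<close>
      define S where "S = insert 0 ((\<lambda>n. pair d n x / pair d n g) ` N)"
      have finS: "finite S" "S \<noteq> {}" using fin by (auto simp: S_def)
      define t where "t = Max S"
      have t0: "0 \<le> t" unfolding t_def by (rule Max_ge) (use finS in \<open>auto simp: S_def\<close>)
      have tS: "t \<in> S" unfolding t_def using finS by (rule Max_in)
      have "0 \<le> pair d f x - t * pair d f g" if f: "f \<in> F" for f
      proof (cases "pair d f g" "0::rat" rule: linorder_cases)
        case less
        then have "pair d f x / pair d f g \<le> t" unfolding t_def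
          by (intro Max_ge) (use finS f in \<open>auto simp: S_def N_def\<close>)
        then show ?thesis using less by (simp add: divide_le_eq algebra_simps)
      next
        case equal
        then show ?thesis using R f by (auto simp: F'_def W_def)
      next
        case greater
        then have fP: "f \<in> P" using f by (auto simp: P_def)
        show ?thesis
        proof (cases "t = 0")
          case True
          then show ?thesis using R fP by (auto simp: F'_def)
        next
          case False
          then obtain n where n: "n \<in> N" "t = pair d n x / pair d n g" using tS by (auto simp: S_def)
          have "0 \<le> pair d (m (f, n)) x" using R fP n by (auto simp: F'_def)
          then have "pair d n g * pair d f x \<le> pair d f g * pair d n x" unfolding mx by simp
          moreover have neg: "pair d n g < 0" using n by (auto simp: N_def)
          ultimately have "pair d f g * pair d n x / pair d n g \<le> pair d f x"
            by (simp add: divide_le_eq mult.commute)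
          then show ?thesis using n by (simp add: mult.commute)
        qed
      qed
      then show "\<exists>t\<ge>0. \<forall>f\<in>F. 0 \<le> pair d f x - t * pair d f g" using t0 by blast
    qed
    finally show "x \<in> cone_gen (insert g G) \<longleftrightarrow> x \<in> ?R" by simp
  qed
  ultimately show ?case by blast
qed

text \<open>Closedness along a sequence converging to \<open>x\<close>: if one of the finitely many
  half-space functionals were negative at \<open>x\<close>, it would stay negative at x + v/(k+1)
  for all large k.\<close>

lemma cone_gen_closed:
  assumes "finite G" "G \<subseteq> ratspace d" "x \<in> ratspace d"
    and "infinite {k::nat. (\<lambda>q. x q + v q / of_nat (Suc k)) \<in> cone_gen G}"
  shows "x \<in> cone_gen G"
proof -
  obtain F where F: "finite F" "cone_gen G = {x\<in>ratspace d. \<forall>f\<in>F. 0 \<le> pair d f x}"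
    using cone_gen_halfspaces[OF assms(1,2)] by (elim exE conjE)
  have "0 \<le> pair d f x" if f: "f \<in> F" for f
  proof (rule ccontr)
    assume neg: "\<not> 0 \<le> pair d f x"
    obtain n where n: "pair d f v / - pair d f x < of_nat n"
      using reals_Archimedean2[of "pair d f v / - pair d f x"] by (rule exE)
    obtain k where k: "k > n" "(\<lambda>q. x q + v q / of_nat (Suc k)) \<in> cone_gen G"
      using assms(4) unfolding infinite_nat_iff_unbounded by blast
    have "0 \<le> pair d f (\<lambda>q. x q + inverse (of_nat (Suc k)) * v q)"
      using k(2) f F(2) by (simp add: divide_inverse mult.commute)
    then have *: "0 \<le> pair d f x + pair d f v / of_nat (Suc k)"
      by (simp only: pair_add_right pair_scale_right) (simp add: divide_inverse mult.commute)
    have "pair d f v < of_nat n * (- pair d f x)"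
      using n neg pos_divide_less_eq[of "- pair d f x" "pair d f v" "of_nat n"] by linarith
    also have "\<dots> \<le> of_nat (Suc k) * (- pair d f x)"
      using k(1) neg by (intro mult_right_mono) auto
    finally have "pair d f v / of_nat (Suc k) < - pair d f x"
      by (simp add: divide_less_eq mult.commute)
    then show False using * by simp
  qed
  then show ?thesis using F(2) assms(3) by blast
qed

section \<open>Separation and extremal rays\<close>

lemma farkas:
  assumes "finite G" "G \<subseteq> ratspace d" "x \<in> ratspace d" "x \<notin> cone_gen G"
  obtains f where "f \<in> ratspace d" "\<And>g. g \<in> G \<Longrightarrow> 0 \<le> pair d f g" "pair d f x < 0"
proof -
  obtain F where F: "F \<subseteq> ratspace d" "cone_gen G = {x\<in>ratspace d. \<forall>f\<in>F. 0 \<le> pair d f x}"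
    using cone_gen_halfspaces[OF assms(1,2)] by (elim exE conjE)
  obtain f where f: "f \<in> F" "pair d f x < 0" using F(2) assms(3,4) by auto
  show ?thesis
    by (rule that[of f]) (use F f gen_in_cone_gen[OF assms(1)] in auto)
qed

lemma minimal_generators:
  assumes "finite G" "G \<subseteq> ratspace d"
  obtains H where "finite H" "H \<subseteq> ratspace d" "cone_gen H = cone_gen G"
    "\<forall>g\<in>H. g \<notin> cone_gen (H - {g})"
proof -
  let ?P = "\<lambda>H. finite H \<and> H \<subseteq> ratspace d \<and> cone_gen H = cone_gen G"
  have "?P G" using assms by blast
  from ex_has_least_nat[of ?P, OF this, of card]
  obtain H where H: "finite H" "H \<subseteq> ratspace d" "cone_gen H = cone_gen G"
    and least: "\<forall>H'. ?P H' \<longrightarrow> card H \<le> card H'" by (elim exE conjE)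
  have "g \<notin> cone_gen (H - {g})" if g: "g \<in> H" for g
  proof
    assume *: "g \<in> cone_gen (H - {g})"
    have "cone_gen H \<subseteq> cone_gen (H - {g})"
    proof (rule cone_gen_mono)
      show "h \<in> cone_gen (H - {g})" if "h \<in> H" for h
        using * that H(1) gen_in_cone_gen[of "H - {g}" h] by (cases "h = g") auto
    qed (use H in auto)
    moreover have "cone_gen (H - {g}) \<subseteq> cone_gen H"
      by (rule cone_gen_mono) (use H gen_in_cone_gen in auto)
    ultimately have "card H \<le> card (H - {g})" using least H by auto
    then show False using g H(1) by (metis card_Diff1_less not_le)
  qed
  then show ?thesis using that[OF H] by blast
qed

text \<open>Farkas for \<open>- h\<close> and the generators \<open>H\<close> together with
  \<open>- g\<close>: a functional nonnegative on both \<open>g\<close> and \<open>- g\<close>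
  vanishes on \<open>g\<close>. If \<open>- h\<close> lay in that cone, comparing coefficients of
  \<open>g\<close> would either express \<open>g\<close> by the other generators, against
  minimality, or put \<open>- h\<close> into the cone of \<open>H\<close>, against
  pointedness.\<close>

lemma extremal_ray_functional:
  assumes H: "finite H" "H \<subseteq> ratspace d" "pointed (cone_gen H)"
    and minimal: "\<forall>g\<in>H. g \<notin> cone_gen (H - {g})"
    and gh: "g \<in> H" "h \<in> H" "h \<noteq> g"
  shows "\<exists>f\<in>ratspace d. (\<forall>k\<in>H. 0 \<le> pair d f k) \<and> pair d f g = 0 \<and> 0 < pair d f h"
proof -
  let ?ng = "\<lambda>q. (-1) * g q" and ?nh = "\<lambda>q. (-1) * h q"
  have ptd: "x = (\<lambda>q. 0)" if "x \<in> cone_gen H" "(\<lambda>q. - x q) \<in> cone_gen H" for x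
    using H(3) that unfolding pointed_def by blast
  have nz: "k \<noteq> (\<lambda>q. 0)" if "k \<in> H" for k
    using minimal that zero_in_cone_gen by blast
  have memH: "k \<in> cone_gen H" if "k \<in> H" for k
    using gen_in_cone_gen H(1) that by blast
  have sub: "cone_gen (H - {g}) \<subseteq> cone_gen H"
    by (rule cone_gen_mono) (use H memH in auto)
  have ngH: "?ng \<notin> H" using ptd[OF memH[OF gh(1)]] memH nz gh(1) by fastforce
  have "?nh \<notin> cone_gen (insert ?ng H)"
  proof
    assume "?nh \<in> cone_gen (insert ?ng H)"
    then obtain t where t: "t \<ge> 0" "(\<lambda>q. - h q + t * g q) \<in> cone_gen H"
      unfolding cone_gen_insert[OF H(1) ngH] by auto
    obtain a where a: "\<forall>v\<in>H. 0 \<le> a v" "(\<lambda>q. - h q + t * g q) = (\<lambda>q. \<Sum>v\<in>H. a v * v q)"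
      using t(2) by (rule cone_genE)
    define z where "z = (\<lambda>q. \<Sum>v\<in>H - {g}. a v * v q)"
    have z: "z \<in> cone_gen (H - {g})" by (rule cone_genI[where c = a]) (use a(1) z_def in auto)
    have eq: "- h q + t * g q = a g * g q + z q" for q
      using fun_cong[OF a(2), of q] sum.remove[OF H(1) gh(1), of "\<lambda>v. a v * v q"]
      by (simp add: z_def)
    have hz: "(\<lambda>q. h q + z q) \<in> cone_gen (H - {g})"
      by (intro cone_gen_add z gen_in_cone_gen) (use H gh in auto)
    show False
    proof (cases "t > a g")
      case True
      have "g = (\<lambda>q. inverse (t - a g) * (h q + z q))"
      proof
        fix q
        have "(t - a g) * g q = h q + z q" using eq[of q] by (simp add: algebra_simps)
        then show "g q = inverse (t - a g) * (h q + z q)" using True by (simp add: field_simps)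
      qed
      moreover have "(\<lambda>q. inverse (t - a g) * (h q + z q)) \<in> cone_gen (H - {g})"
        using cone_gen_scale[OF hz, of "inverse (t - a g)"] True by simp
      ultimately have "g \<in> cone_gen (H - {g})" by simp
      then show False using minimal gh(1) by blast
    next
      case False
      have "(\<lambda>q. z q + (a g - t) * g q) \<in> cone_gen H"
        by (intro cone_gen_add cone_gen_scale) (use z sub memH gh False in auto)
      moreover have "(\<lambda>q. z q + (a g - t) * g q) = (\<lambda>q. - h q)"
      proof
        show "z q + (a g - t) * g q = - h q" for q using eq[of q] by (simp add: algebra_simps)
      qed
      ultimately have "(\<lambda>q. - h q) \<in> cone_gen H" by simp
      then show False using ptd[OF memH[OF gh(2)]] nz[OF gh(2)] by blast
    qed
  qed
  then obtain f where f: "f \<in> ratspace d" "\<And>k. k \<in> insert ?ng H \<Longrightarrow> 0 \<le> pair d f k" "pair d f ?nh < 0"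
    by (rule farkas[rotated 3]) (use H gh in \<open>auto simp: ratspace_def\<close>)
  have "0 \<le> pair d f ?ng" using f(2) by blast
  then have "pair d f g \<le> 0" by (simp only: pair_scale_right)
  moreover have "pair d f h > 0" using f(3) by (simp only: pair_scale_right)
  ultimately show ?thesis using f gh by (meson insertCI order_antisym)
qed

text \<open>For an irredundant generating set, the functionals of
  \<open>extremal_ray_functional\<close> for all h different from g are added up. The sum vanishes
  on g and is positive on every other generator, so it cuts out exactly the ray of g.\<close>

lemma pointed_cone_extremal_rays:
  assumes G: "finite G" "G \<subseteq> ratspace d" and ptd: "pointed (cone_gen G)"
  obtains H where "finite H" "H \<subseteq> ratspace d" "cone_gen H = cone_gen G"
    "\<forall>g\<in>H. g \<noteq> (\<lambda>q. 0) \<and> is_face d (cone_gen {g}) (cone_gen G)"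
proof -
  obtain H where H: "finite H" "H \<subseteq> ratspace d" "cone_gen H = cone_gen G"
    and minimal: "\<forall>g\<in>H. g \<notin> cone_gen (H - {g})"
    using G by (rule minimal_generators)
  have face: "is_face d (cone_gen {g}) (cone_gen G)" if g: "g \<in> H" for g
  proof -
    have *: "\<forall>h\<in>H - {g}. \<exists>f. f\<in>ratspace d \<and> (\<forall>k\<in>H. 0 \<le> pair d f k) \<and> pair d f g = 0 \<and> 0 < pair d f h"
      using extremal_ray_functional[OF H(1,2) _ minimal g] ptd H(3) by auto
    obtain f where f: "\<forall>h\<in>H - {g}. f h \<in> ratspace d \<and> (\<forall>k\<in>H. 0 \<le> pair d (f h) k) \<and>
        pair d (f h) g = 0 \<and> 0 < pair d (f h) h"
      using bchoice[OF *] by (elim exE)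
    define F where "F = (\<lambda>q. \<Sum>h\<in>H - {g}. f h q)"
    have Fp: "pair d F x = (\<Sum>h\<in>H - {g}. pair d (f h) x)" for x
      unfolding F_def by (rule pair_sum_left)
    have "F \<in> ratspace d" using f by (auto simp: F_def ratspace_def intro!: sum.neutral)
    have Fg: "pair d F g = 0" unfolding Fp using f by (intro sum.neutral) auto
    have Fh: "0 < pair d F h" if "h \<in> H - {g}" for h
      unfolding Fp using f that H(1) by (intro sum_pos2[of _ h]) auto
    have F0: "0 \<le> pair d F h" if "h \<in> H" for h
      using Fh[of h] Fg that by (cases "h = g") auto
    have "cone_gen {g} = {x \<in> cone_gen H. pair d F x = 0}"
    proof
      have "cone_gen {g} \<subseteq> cone_gen H"
        by (rule cone_gen_mono) (use H g gen_in_cone_gen in auto)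
      moreover have "pair d F x = 0" if x: "x \<in> cone_gen {g}" for x
      proof -
        obtain t where "x = (\<lambda>q. t * g q)" using x by (auto simp: cone_gen_def)
        then show ?thesis using Fg by (simp add: pair_scale_right)
      qed
      ultimately show "cone_gen {g} \<subseteq> {x \<in> cone_gen H. pair d F x = 0}" by auto
      show "{x \<in> cone_gen H. pair d F x = 0} \<subseteq> cone_gen {g}"
      proof
        fix x assume "x \<in> {x \<in> cone_gen H. pair d F x = 0}"
        then have x: "x \<in> cone_gen H" "pair d F x = 0" by auto
        obtain b where b: "\<forall>v\<in>H. 0 \<le> b v" "x = (\<lambda>q. \<Sum>v\<in>H. b v * v q)"
          using x(1) by (rule cone_genE)
        have "(\<Sum>v\<in>H. b v * pair d F v) = 0" using x(2) unfolding b(2) pair_combination .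
        then have z: "\<forall>v\<in>H. b v * pair d F v = 0"
          by (subst (asm) sum_nonneg_eq_0_iff) (use H(1) b(1) F0 in auto)
        have "x q = b g * g q" for q
        proof -
          have "x q = b g * g q + (\<Sum>v\<in>H - {g}. b v * v q)"
            unfolding b(2) using H(1) g by (rule sum.remove)
          also have "(\<Sum>v\<in>H - {g}. b v * v q) = 0"
            using z Fh by (intro sum.neutral) fastforce
          finally show ?thesis by simp
        qed
        then show "x \<in> cone_gen {g}" by (intro cone_genI[where c = b]) (use b(1) g in auto)
      qed
    qed
    moreover have "\<forall>x\<in>cone_gen H. 0 \<le> pair d F x"
      using cone_gen_pair_nonneg F0 by blast
    ultimately show ?thesis
      unfolding is_face_def H(3)[symmetric] by (intro bexI[OF _ \<open>F \<in> ratspace d\<close>] conjI)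
  qed
  have "g \<noteq> (\<lambda>q. 0)" if "g \<in> H" for g
    using minimal that zero_in_cone_gen by metis
  then show ?thesis using face by (intro that[OF H] ballI conjI)
qed

section \<open>Clearing denominators\<close>

lemma common_denominator:
  assumes "finite Q"
  shows "\<exists>N::int. 0 < N \<and> (\<forall>q\<in>Q. \<exists>m::int. of_int N * (f q :: rat) = of_int m)"
  using assms
proof (induction Q rule: finite_induct)
  case empty
  then show ?case by (intro exI[of _ 1]) auto
next
  case (insert p Q)
  then obtain N where N: "0 < N" "\<forall>q\<in>Q. \<exists>m::int. of_int N * f q = of_int m" by auto
  obtain a b where ab: "quotient_of (f p) = (a, b)" by force
  have b: "0 < b" "f p = of_int a / of_int b"
    using quotient_of_denom_pos[OF ab] quotient_of_div[OF ab] by auto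
  have "\<exists>m::int. of_int (N * b) * f q = of_int m" if "q \<in> insert p Q" for q
  proof (cases "q = p")
    case True
    then show ?thesis using b by (intro exI[of _ "N * a"]) simp
  next
    case False
    then have "q \<in> Q" using that by simp
    from bspec[OF N(2) this] obtain m :: int where "of_int N * f q = of_int m" by (elim exE)
    then show ?thesis by (intro exI[of _ "m * b"]) (simp add: algebra_simps)
  qed
  then show ?case using N b by (intro exI[of _ "N * b"]) auto
qed

text \<open>Faces are defined by rational functionals, characters by lattice vectors. A positive
  multiple cuts out the same face, so the two notions can be exchanged.\<close>

lemma lattice_multiple:
  assumes "f \<in> ratspace d"
  obtains N u where "0 < (N::rat)" "u \<in> lattice d" "rvec u = (\<lambda>q. N * f q)"
proof -
  obtain N :: int where N: "0 < N" "\<forall>q\<in>{1..d}. \<exists>m::int. of_int N * f q = of_int m"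
    using common_denominator[of "{1..d}" f] by auto
  then obtain m where m: "\<forall>q\<in>{1..d}. of_int N * f q = of_int (m q)"
    using bchoice[of "{1..d}" "\<lambda>q m. of_int N * f q = (of_int m :: rat)"] by auto
  show ?thesis
    by (rule that[of "of_int N" "\<lambda>q. if q \<in> {1..d} then m q else 0"])
      (use N m assms in \<open>auto simp: lattice_def ratspace_def rvec_def\<close>)
qed

section \<open>Complete fans\<close>

definition zeros :: "'k::field AP_data \<Rightarrow> (var \<Rightarrow> 'k) \<Rightarrow> var set" where
  "zeros D x = {w\<in>vars D. x w = 0}"

lemma finite_vars: "finite (vars D)"
proof -
  have "vars D \<subseteq> (\<Union>i\<in>{..rr D}. Tv i ` {1..nn D i}) \<union> Sv ` {1..mm D}"
    by (auto simp: vars_def)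
  then show ?thesis by (rule finite_subset) auto
qed

locale complete_AP =
  fixes D :: "'k::{alg_closed_field, field_char_0} AP_data" and \<Sigma> :: "(nat \<Rightarrow> rat) set set"
  assumes valid: "AP_valid D"
    and complete: "complete_fan (dimN D) \<Sigma>"
    and rays: "rays (dimN D) \<Sigma> = (\<lambda>w. cone_gen {rvec (col D w)}) ` vars D"
begin

abbreviation d :: nat where "d \<equiv> dimN D"

abbreviation pr :: "(nat \<Rightarrow> int) \<Rightarrow> var \<Rightarrow> int" where "pr u w \<equiv> pair d u (col D w)"

abbreviation rcol :: "var \<Rightarrow> nat \<Rightarrow> rat" where "rcol w \<equiv> rvec (col D w)"

abbreviation Zh :: "(var \<Rightarrow> 'k) set" where "Zh \<equiv> Zhat D \<Sigma>"

abbreviation ZV :: "('k tpoint, 'k) atlas" where "ZV \<equiv> Z_var D \<Sigma>"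

abbreviation tpoints :: "'k tpoint set" where "tpoints \<equiv> toric_points d \<Sigma>"

abbreviation dual :: "(nat \<Rightarrow> rat) set \<Rightarrow> (nat \<Rightarrow> int) set" where "dual \<equiv> dual_monoid d"

abbreviation oc :: "(var \<Rightarrow> 'k) \<Rightarrow> (nat \<Rightarrow> rat) set" where "oc \<equiv> orbit_cone D \<Sigma>"

abbreviation cox :: "(var \<Rightarrow> 'k) \<Rightarrow> 'k tpoint" where "cox \<equiv> cox_quotient D \<Sigma>"

abbreviation tchart :: "(nat \<Rightarrow> rat) set \<Rightarrow> 'k tpoint set" where "tchart \<equiv> toric_chart d \<Sigma>"

text \<open>Cones of the fan are handled through this finite set of variables, which determines the
  cone by \<open>cone_eq\<close> and can be compared directly with the vanishing coordinates of a
  point.\<close>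

definition V :: "(nat \<Rightarrow> rat) set \<Rightarrow> var set" where
  "V \<sigma> = {w\<in>vars D. rcol w \<in> \<sigma>}"

lemma V_subset_vars: "V \<sigma> \<subseteq> vars D"
  by (auto simp: V_def)

lemma finite_V: "finite (V \<sigma>)"
  using V_subset_vars finite_vars by (rule finite_subset)

lemma fan: "fan d \<Sigma>" and support: "\<Union>\<Sigma> = ratspace d"
  using complete by (auto simp: complete_fan_def)

lemma finite_fan: "finite \<Sigma>"
  using fan by (auto simp: fan_def)

lemma fan_face: "\<sigma> \<in> \<Sigma> \<Longrightarrow> is_face d \<tau> \<sigma> \<Longrightarrow> \<tau> \<in> \<Sigma>"
  using fan by (auto simp: fan_def)

lemma fan_Int_face: "\<sigma> \<in> \<Sigma> \<Longrightarrow> \<sigma>' \<in> \<Sigma> \<Longrightarrow> is_face d (\<sigma> \<inter> \<sigma>') \<sigma>"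
  using fan by (auto simp: fan_def)

lemma fan_Int: "\<sigma> \<in> \<Sigma> \<Longrightarrow> \<sigma>' \<in> \<Sigma> \<Longrightarrow> \<sigma> \<inter> \<sigma>' \<in> \<Sigma>"
  using fan_face fan_Int_face by blast

lemma fan_Inter:
  assumes "A \<noteq> {}" "A \<subseteq> \<Sigma>" shows "\<Inter>A \<in> \<Sigma>"
proof -
  have "finite A" using assms(2) finite_fan by (rule finite_subset)
  then show ?thesis using assms
    by (induction A rule: finite_ne_induct) (auto intro: fan_Int)
qed

section \<open>Columns of \<open>P\<close> as generators of the cones\<close>

lemma col_lattice: "w \<in> vars D \<Longrightarrow> col D w \<in> lattice d"
  using valid by (auto simp: AP_valid_def primitive_def)

lemma col_ratspace: "w \<in> vars D \<Longrightarrow> rcol w \<in> ratspace d"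
  by (simp add: rvec_in_ratspace col_lattice)

text \<open>An extremal ray of the cone is a face, hence belongs to the fan, hence is spanned by a
  column by the hypothesis on the rays.\<close>

lemma cone_eq:
  assumes \<sigma>: "\<sigma> \<in> \<Sigma>"
  shows "\<sigma> = cone_gen (rcol ` V \<sigma>)"
proof -
  have "rational_cone d \<sigma>" "pointed \<sigma>" using fan \<sigma> by (auto simp: fan_def)
  then obtain G where G: "finite G" "G \<subseteq> ratspace d" "\<sigma> = cone_gen G"
    unfolding rational_cone_def by (elim exE conjE)
  then have "pointed (cone_gen G)" using \<open>pointed \<sigma>\<close> by simp
  then obtain H where H: "finite H" "H \<subseteq> ratspace d" "cone_gen H = cone_gen G"
    "\<forall>g\<in>H. g \<noteq> (\<lambda>q. 0) \<and> is_face d (cone_gen {g}) (cone_gen G)"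
    by (rule pointed_cone_extremal_rays[OF G(1,2)])
  let ?VV = "rcol ` V \<sigma>"
  have fin: "finite ?VV" using finite_V by simp
  have "g \<in> cone_gen ?VV" if g: "g \<in> H" for g
  proof -
    have "cone_gen {g} \<in> \<Sigma>" using fan_face[OF \<sigma>] H(4) g G(3) by simp
    then have "cone_gen {g} \<in> rays d \<Sigma>" using H(2,4) g by (auto simp: rays_def)
    then obtain w where w: "w \<in> vars D" "cone_gen {g} = cone_gen {rcol w}"
      unfolding rays by (elim imageE)
    have "rcol w \<in> cone_gen {g}" unfolding w(2) by (rule gen_in_cone_gen) auto
    moreover have "cone_gen {g} \<subseteq> \<sigma>" unfolding G(3) H(3)[symmetric]
      by (rule cone_gen_mono) (use H(1) g gen_in_cone_gen in auto)
    ultimately have "w \<in> V \<sigma>" using w(1) by (auto simp: V_def)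
    then have "cone_gen {rcol w} \<subseteq> cone_gen ?VV"
      by (intro cone_gen_mono) (use fin gen_in_cone_gen in auto)
    moreover have "g \<in> cone_gen {g}" by (rule gen_in_cone_gen) auto
    ultimately show ?thesis using w(2) by auto
  qed
  then have "cone_gen H \<subseteq> cone_gen ?VV" using fin by (intro cone_gen_mono)
  moreover have "cone_gen ?VV \<subseteq> cone_gen G"
  proof -
    have "cone_gen ?VV \<subseteq> cone_gen H"
      by (rule cone_gen_mono) (use H(1,3) G(3) V_def in auto)
    then show ?thesis using H(3) by simp
  qed
  ultimately show ?thesis using G(3) H(3) by blast
qed

lemma cone_pair_nonneg:
  assumes "\<sigma> \<in> \<Sigma>" "x \<in> \<sigma>" "\<And>w. w \<in> V \<sigma> \<Longrightarrow> 0 \<le> pair d f (rcol w)"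
  shows "0 \<le> pair d f x"
proof -
  have "x \<in> cone_gen (rcol ` V \<sigma>)" using assms(2) cone_eq[OF assms(1)] by simp
  then show ?thesis by (rule cone_gen_pair_nonneg) (use assms(3) in auto)
qed

lemma cone_subset_iff:
  assumes "\<sigma> \<in> \<Sigma>" "\<sigma>' \<in> \<Sigma>"
  shows "\<sigma> \<subseteq> \<sigma>' \<longleftrightarrow> V \<sigma> \<subseteq> V \<sigma>'"
proof
  assume *: "V \<sigma> \<subseteq> V \<sigma>'"
  have "cone_gen (rcol ` V \<sigma>) \<subseteq> cone_gen (rcol ` V \<sigma>')"
    by (rule cone_gen_mono) (use * finite_V gen_in_cone_gen in auto)
  then show "\<sigma> \<subseteq> \<sigma>'" using cone_eq assms by blast
qed (auto simp: V_def)

lemma dual_iff: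
  assumes "\<sigma> \<in> \<Sigma>"
  shows "u \<in> dual \<sigma> \<longleftrightarrow> u \<in> lattice d \<and> (\<forall>w\<in>V \<sigma>. 0 \<le> pr u w)"
proof -
  have "(\<forall>x\<in>\<sigma>. 0 \<le> pair d (rvec u) x) \<longleftrightarrow> (\<forall>w\<in>V \<sigma>. 0 \<le> pr u w)"
  proof
    assume "\<forall>x\<in>\<sigma>. 0 \<le> pair d (rvec u) x"
    then have "\<forall>w\<in>V \<sigma>. 0 \<le> pair d (rvec u) (rcol w)" by (auto simp: V_def)
    then show "\<forall>w\<in>V \<sigma>. 0 \<le> pr u w" by (simp add: pair_rvec)
  qed (use cone_pair_nonneg[OF assms] in \<open>auto simp: pair_rvec\<close>)
  then show ?thesis by (auto simp: dual_monoid_def)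
qed

lemma perp_iff:
  assumes "\<sigma> \<in> \<Sigma>"
  shows "u \<in> perp d \<sigma> \<longleftrightarrow> u \<in> lattice d \<and> (\<forall>w\<in>V \<sigma>. pr u w = 0)"
proof -
  have "(\<forall>x\<in>\<sigma>. pair d (rvec u) x = 0) \<longleftrightarrow> (\<forall>w\<in>V \<sigma>. pr u w = 0)"
  proof
    assume "\<forall>x\<in>\<sigma>. pair d (rvec u) x = 0"
    then have "\<forall>w\<in>V \<sigma>. pair d (rvec u) (rcol w) = 0" by (auto simp: V_def)
    then show "\<forall>w\<in>V \<sigma>. pr u w = 0" by (simp add: pair_rvec)
  next
    assume R: "\<forall>w\<in>V \<sigma>. pr u w = 0"
    show "\<forall>x\<in>\<sigma>. pair d (rvec u) x = 0"
    proof
      fix x assume x: "x \<in> \<sigma>"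
      have "0 \<le> pair d (rvec u) x"
        by (rule cone_pair_nonneg[OF assms x]) (use R in \<open>simp add: pair_rvec\<close>)
      moreover have "0 \<le> pair d (\<lambda>q. (-1) * rvec u q) x"
        by (rule cone_pair_nonneg[OF assms x], unfold pair_scale_left pair_rvec) (use R in simp)
      ultimately show "pair d (rvec u) x = 0" unfolding pair_scale_left by simp
    qed
  qed
  then show ?thesis by (auto simp: perp_def)
qed

lemma face_of_dual:
  assumes "\<sigma> \<in> \<Sigma>" "u \<in> dual \<sigma>"
  obtains \<tau> where "\<tau> \<in> \<Sigma>" "\<tau> \<subseteq> \<sigma>" "V \<tau> = {w\<in>V \<sigma>. pr u w = 0}"
proof -
  let ?\<tau> = "{x\<in>\<sigma>. pair d (rvec u) x = 0}"
  have "is_face d ?\<tau> \<sigma>" unfolding is_face_def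
    by (intro bexI[of _ "rvec u"])
      (use assms(2) in \<open>auto simp: dual_monoid_def rvec_in_ratspace\<close>)
  then have "?\<tau> \<in> \<Sigma>" by (rule fan_face[OF assms(1)])
  then show ?thesis by (rule that) (auto simp: V_def pair_rvec)
qed

text \<open>The character of this \<open>u\<close> is nonzero exactly on the overlap of the two
  charts, see \<open>chart_map_id\<close>.\<close>

lemma Int_cut_out:
  assumes "\<sigma> \<in> \<Sigma>" "\<sigma>' \<in> \<Sigma>"
  obtains u where "u \<in> dual \<sigma>" "V (\<sigma> \<inter> \<sigma>') = {w\<in>V \<sigma>. pr u w = 0}"
proof -
  obtain f where f: "f \<in> ratspace d" "\<forall>x\<in>\<sigma>. 0 \<le> pair d f x"
    "\<sigma> \<inter> \<sigma>' = {x\<in>\<sigma>. pair d f x = 0}"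
    using fan_Int_face[OF assms] unfolding is_face_def by blast
  obtain N u where N: "0 < (N::rat)" "u \<in> lattice d" "rvec u = (\<lambda>q. N * f q)"
    using f(1) by (rule lattice_multiple)
  have pu: "pair d (rvec u) x = N * pair d f x" for x
    by (simp add: N(3) pair_scale_left)
  have "rcol w \<in> \<sigma> \<inter> \<sigma>' \<longleftrightarrow> rcol w \<in> \<sigma> \<and> pr u w = 0" for w
  proof -
    have "pair d f (rcol w) = 0 \<longleftrightarrow> N * pair d f (rcol w) = 0" using N(1) by simp
    also have "\<dots> \<longleftrightarrow> pr u w = 0" unfolding pu[symmetric] pair_rvec by simp
    finally show ?thesis unfolding f(3) by simp
  qed
  moreover have "u \<in> dual \<sigma>"
    using N(1,2) f(2) by (auto simp: dual_monoid_def pu)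
  ultimately show ?thesis by (intro that[of u]) (auto simp: V_def)
qed

section \<open>Arithmetic of the dual monoids\<close>

lemma lattice_add: "u \<in> lattice n \<Longrightarrow> u' \<in> lattice n \<Longrightarrow> (\<lambda>q. u q + u' q) \<in> lattice n"
  by (auto simp: lattice_def)

lemma lattice_scale: "u \<in> lattice n \<Longrightarrow> (\<lambda>q. t * u q) \<in> lattice n"
  by (auto simp: lattice_def)

lemma dual_add:
  "\<sigma> \<in> \<Sigma> \<Longrightarrow> u \<in> dual \<sigma> \<Longrightarrow> u' \<in> dual \<sigma> \<Longrightarrow> (\<lambda>q. u q + u' q) \<in> dual \<sigma>"
  by (auto simp: dual_iff lattice_add pair_add_left)

lemma dual_scale:
  "\<sigma> \<in> \<Sigma> \<Longrightarrow> u \<in> dual \<sigma> \<Longrightarrow> 0 \<le> t \<Longrightarrow> (\<lambda>q. t * u q) \<in> dual \<sigma>"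
  by (auto simp: dual_iff lattice_scale pair_scale_left)

lemma dual_zero: "(\<lambda>q. 0) \<in> dual \<sigma>"
  by (auto simp: dual_monoid_def lattice_def rvec_def)

lemma dual_antimono: "\<tau> \<subseteq> \<sigma> \<Longrightarrow> dual \<sigma> \<subseteq> dual \<tau>"
  by (auto simp: dual_monoid_def)

lemma perp_subset_dual: "perp d \<sigma> \<subseteq> dual \<sigma>"
  by (auto simp: dual_monoid_def perp_def)

text \<open>The chart of a face is the localisation of the chart of the cone at one character
  \<open>u0\<close>: a large multiple of \<open>u0\<close> makes any \<open>u\<close> nonnegative on
  the generators where \<open>u0\<close> is positive, and on the others \<open>u\<close> already
  is.\<close>

lemma dual_shift:
  assumes "\<sigma> \<in> \<Sigma>" "\<tau> \<in> \<Sigma>" "u0 \<in> dual \<sigma>" "V \<tau> = {w\<in>V \<sigma>. pr u0 w = 0}"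
    "u \<in> dual \<tau>"
  obtains k :: nat where "(\<lambda>q. u q + int k * u0 q) \<in> dual \<sigma>"
proof -
  \<comment> \<open>A crude uniform bound: it dominates the absolute value of \<open>u\<close> at
    each generator.\<close>
  define k where "k = (\<Sum>w\<in>V \<sigma>. nat \<bar>pr u w\<bar>)"
  have "0 \<le> pr u w + int k * pr u0 w" if w: "w \<in> V \<sigma>" for w
  proof (cases "pr u0 w = 0")
    case True
    then show ?thesis using assms(2,4,5) w by (auto simp: dual_iff)
  next
    case False
    have "0 \<le> pr u0 w" using assms(1,3) w by (auto simp: dual_iff)
    then have "1 \<le> pr u0 w" using False by simp
    have "nat \<bar>pr u w\<bar> \<le> k" unfolding k_def using finite_V w by (intro member_le_sum) auto
    then have "\<bar>pr u w\<bar> * 1 \<le> int k * pr u0 w"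
      using \<open>1 \<le> pr u0 w\<close> by (intro mult_mono) auto
    then show ?thesis by linarith
  qed
  then have "(\<lambda>q. u q + int k * u0 q) \<in> dual \<sigma>"
    using assms(1,3,5) unfolding dual_iff[OF assms(1)] dual_iff[OF assms(2)]
    by (auto simp: pair_add_left pair_scale_left lattice_add lattice_scale)
  then show ?thesis by (rule that)
qed

section \<open>Demazure roots of a complete fan\<close>

definition demazure_root :: "var \<Rightarrow> (nat \<Rightarrow> int) \<Rightarrow> bool" where
  "demazure_root v u \<longleftrightarrow> u \<in> lattice d \<and> v \<in> vars D \<and> pr u v = -1 \<and> (\<forall>w\<in>vars D - {v}. 0 \<le> pr u w)"

text \<open>Near a point \<open>x\<close> in the relative interior of \<open>\<tau>\<close>, the points \<open>x + \<epsilon> v\<close> lie in a cone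
  on which \<open>u\<close> takes a negative value, so this cone has \<open>v\<close> as a generator; it contains \<open>x\<close>
  since it is closed.\<close>

lemma demazure_root_cone:
  assumes u: "demazure_root v u" and \<tau>: "\<tau> \<in> \<Sigma>" "v \<notin> V \<tau>" "\<forall>w\<in>V \<tau>. pr u w = 0"
  obtains \<sigma> where "\<sigma> \<in> \<Sigma>" "\<tau> \<subseteq> \<sigma>" "v \<in> V \<sigma>"
proof -
  define x where "x = (\<lambda>q. \<Sum>w\<in>V \<tau>. rcol w q)"
  define y where "y k = (\<lambda>q. x q + rcol v q / of_nat (Suc k))" for k :: nat
  have px: "pair d f x = (\<Sum>w\<in>V \<tau>. pair d f (rcol w))" for f
    unfolding x_def by (rule pair_sum_right)
  have v: "v \<in> vars D" using u by (simp add: demazure_root_def)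
  have xr: "x \<in> ratspace d"
    using col_ratspace V_subset_vars by (fastforce simp: x_def ratspace_def intro!: sum.neutral)
  then have yr: "y k \<in> ratspace d" for k
    using col_ratspace[OF v] by (auto simp: y_def ratspace_def)
  have x\<tau>: "x \<in> \<tau>"
  proof -
    have "x \<in> cone_gen (rcol ` V \<tau>)" unfolding x_def
      by (intro cone_gen_sum gen_in_cone_gen) (auto simp: finite_V)
    then show ?thesis using cone_eq[OF \<tau>(1)] by simp
  qed
  \<comment> \<open>Pigeonhole: finitely many cones cover the whole sequence, so one of them
    contains infinitely many members, as \<open>cone_gen_closed\<close> requires.\<close>
  have "\<exists>\<sigma>\<in>\<Sigma>. infinite {k. y k \<in> \<sigma>}"
  proof (rule ccontr)
    assume "\<not> (\<exists>\<sigma>\<in>\<Sigma>. infinite {k. y k \<in> \<sigma>})"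
    then have "finite (\<Union>\<sigma>\<in>\<Sigma>. {k. y k \<in> \<sigma>})" using finite_fan by auto
    moreover have "(\<Union>\<sigma>\<in>\<Sigma>. {k. y k \<in> \<sigma>}) = UNIV" using yr support by auto
    ultimately show False by simp
  qed
  then obtain \<sigma> where \<sigma>: "\<sigma> \<in> \<Sigma>" "infinite {k. y k \<in> \<sigma>}" by blast
  have "x \<in> \<sigma>"
  proof -
    let ?G = "rcol ` V \<sigma>"
    have G: "finite ?G" "?G \<subseteq> ratspace d" using finite_V col_ratspace V_subset_vars by auto
    have "infinite {k. (\<lambda>q. x q + rcol v q / of_nat (Suc k)) \<in> cone_gen ?G}"
      using \<sigma>(2) unfolding y_def cone_eq[OF \<sigma>(1), symmetric] .
    from cone_gen_closed[OF G xr this] show ?thesis using cone_eq[OF \<sigma>(1)] by simp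
  qed
  have "v \<in> V \<sigma>"
  proof (rule ccontr)
    assume "v \<notin> V \<sigma>"
    then have nonneg: "0 \<le> pr u w" if "w \<in> V \<sigma>" for w
      using u that V_subset_vars by (auto simp: demazure_root_def)
    obtain k where k: "y k \<in> \<sigma>" using \<sigma>(2) by (metis (no_types, lifting) empty_Collect_eq infinite_imp_nonempty)
    have "0 \<le> pair d (rvec u) (y k)"
      by (rule cone_pair_nonneg[OF \<sigma>(1) k]) (simp add: pair_rvec nonneg)
    moreover have "y k = (\<lambda>q. x q + inverse (of_nat (Suc k)) * rcol v q)"
      by (simp add: y_def divide_inverse mult.commute)
    ultimately have "0 \<le> pair d (rvec u) x + inverse (of_nat (Suc k)) * of_int (pr u v)"
      by (simp only: pair_add_right pair_scale_right pair_rvec)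
    moreover have "pair d (rvec u) x = 0" unfolding px using \<tau>(3) by (simp add: pair_rvec)
    moreover have "pr u v = -1" using u by (simp add: demazure_root_def)
    ultimately have "0 \<le> - inverse (of_nat (Suc k) :: rat)" by simp
    moreover have "0 < inverse (of_nat (Suc k) :: rat)" by simp
    ultimately show False by linarith
  qed
  moreover have "\<tau> \<subseteq> \<sigma>"
  proof -
    obtain f where f: "\<forall>x\<in>\<tau>. 0 \<le> pair d f x" "\<tau> \<inter> \<sigma> = {x\<in>\<tau>. pair d f x = 0}"
      using fan_Int_face[OF \<tau>(1) \<sigma>(1)] unfolding is_face_def by blast
    \<comment> \<open>\<open>x\<close> is the sum of all generators of the cone, so a nonnegative
      functional that vanishes at \<open>x\<close> vanishes on each of them.\<close>
    have "pair d f x = 0" using f(2) x\<tau> \<open>x \<in> \<sigma>\<close> by blast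
    then have "\<forall>w\<in>V \<tau>. pair d f (rcol w) = 0" unfolding px
      by (subst (asm) sum_nonneg_eq_0_iff) (use finite_V f(1) in \<open>auto simp: V_def\<close>)
    then have "V \<tau> \<subseteq> V \<sigma>" using f(2) by (auto simp: V_def)
    then show ?thesis using cone_subset_iff \<tau>(1) \<sigma>(1) by blast
  qed
  ultimately show ?thesis using \<sigma>(1) by (intro that)
qed

text \<open>The columns generate the whole space as a cone, so \<open>- u\<close> is a nonnegative
  combination of columns; pairing it with \<open>u\<close> shows that the sum of squares of the
  entries is at most 0.\<close>

lemma lattice_eq_zero:
  assumes "u \<in> lattice d" "\<forall>w\<in>vars D. pr u w = 0"
  shows "u = (\<lambda>q. 0)"
proof -
  let ?G = "rcol ` vars D"
  have span: "cone_gen ?G = ratspace d" using valid by (auto simp: AP_valid_def)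
  have ur: "rvec u \<in> ratspace d" using assms(1) by (simp add: rvec_in_ratspace)
  then have "(\<lambda>q. (-1) * rvec u q) \<in> cone_gen ?G" unfolding span by (auto simp: ratspace_def)
  then have "0 \<le> pair d (rvec u) (\<lambda>q. (-1) * rvec u q)"
    by (rule cone_gen_pair_nonneg) (use assms(2) in \<open>auto simp: pair_rvec\<close>)
  then have "pair d u u \<le> 0" unfolding pair_scale_right pair_rvec by simp
  then have "(\<Sum>q = 1..d. u q * u q) = 0"
    using sum_nonneg[of "{1..d}" "\<lambda>q. u q * u q"] unfolding pair_def by force
  then have "\<forall>q\<in>{1..d}. u q = 0" by (subst (asm) sum_nonneg_eq_0_iff) auto
  then have "u q = 0" for q using assms(1) by (cases "q \<in> {1..d}") (auto simp: lattice_def)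
  then show ?thesis by blast
qed

section \<open>Orbit cones of points of \<open>Zhat\<close>\<close>

lemma zeros_V: "zeros D x \<subseteq> V \<sigma> \<longleftrightarrow> (\<forall>w\<in>vars D. x w = 0 \<longrightarrow> rcol w \<in> \<sigma>)"
  by (auto simp: zeros_def V_def)

lemma Zhat_iff: "x \<in> Zh \<longleftrightarrow> x \<in> Zbar D \<and> (\<exists>\<sigma>\<in>\<Sigma>. zeros D x \<subseteq> V \<sigma>)"
  by (simp add: Zhat_def zeros_V)

lemma orbit_cone_eq: "oc x = \<Inter>{\<sigma>\<in>\<Sigma>. zeros D x \<subseteq> V \<sigma>}"
  by (simp add: orbit_cone_def zeros_V)

lemma orbit_cone_in_fan: "x \<in> Zh \<Longrightarrow> oc x \<in> \<Sigma>"
  unfolding orbit_cone_eq by (rule fan_Inter) (auto simp: Zhat_iff)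

lemma zeros_subset_orbit_cone: "zeros D x \<subseteq> V (oc x)"
  by (auto simp: orbit_cone_eq V_def zeros_def)

lemma orbit_cone_subset_iff:
  assumes "\<sigma> \<in> \<Sigma>" "x \<in> Zh"
  shows "oc x \<subseteq> \<sigma> \<longleftrightarrow> zeros D x \<subseteq> V \<sigma>"
proof
  assume "oc x \<subseteq> \<sigma>"
  then have "V (oc x) \<subseteq> V \<sigma>" by (auto simp: V_def)
  then show "zeros D x \<subseteq> V \<sigma>" using zeros_subset_orbit_cone by blast
qed (use assms in \<open>auto simp: orbit_cone_eq\<close>)

end

section \<open>Points of toric varieties\<close>

lemma prod_powi: "prod f A powi k = (\<Prod>w\<in>A. (f w :: 'k::field) powi k)"
  by (induction A rule: infinite_finite_induct) (auto simp: power_int_mult_distrib)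

lemma hom_powi:
  fixes \<gamma> :: "(nat \<Rightarrow> int) \<Rightarrow> 'k::field"
  assumes add: "\<And>u u'. u \<in> Q \<Longrightarrow> u' \<in> Q \<Longrightarrow> \<gamma> (\<lambda>q. u q + u' q) = \<gamma> u * \<gamma> u'"
    and scale: "\<And>u k. u \<in> Q \<Longrightarrow> (\<lambda>q. k * u q) \<in> Q"
    and nz: "\<And>u. u \<in> Q \<Longrightarrow> \<gamma> u \<noteq> 0"
    and u: "u \<in> Q"
  shows "\<gamma> (\<lambda>q. k * u q) = \<gamma> u powi k"
proof -
  have 0: "\<gamma> (\<lambda>q. 0) = 1"
    using add[OF scale[OF u, of 0] scale[OF u, of 0]] nz[OF scale[OF u, of 0]] by simp
  have nat: "\<gamma> (\<lambda>q. int n * u q) = \<gamma> u ^ n" for n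
  proof (induction n)
    case (Suc n)
    have "\<gamma> (\<lambda>q. int n * u q + u q) = \<gamma> (\<lambda>q. int n * u q) * \<gamma> u"
      using add scale u by blast
    moreover have "(\<lambda>q. int (Suc n) * u q) = (\<lambda>q. int n * u q + u q)"
      by (simp add: distrib_right add.commute)
    ultimately show ?case using Suc by simp
  qed (simp add: 0)
  show ?thesis
  proof (cases "0 \<le> k")
    case True
    then show ?thesis using nat[of "nat k"] by (simp add: power_int_def)
  next
    case False
    have "\<gamma> (\<lambda>q. k * u q + int (nat (- k)) * u q) = \<gamma> (\<lambda>q. k * u q) * \<gamma> (\<lambda>q. int (nat (- k)) * u q)"
      using add scale u by blast
    then have "1 = \<gamma> (\<lambda>q. k * u q) * \<gamma> u ^ nat (- k)" using False 0 unfolding nat by simp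
    then show ?thesis using False nz[OF u] by (simp add: power_int_def field_simps)
  qed
qed

text \<open>Multiplicative groups of algebraically closed fields are divisible, so characters of
  subgroups extend; the generators of the ambient lattice are treated one at a time.\<close>

lemma character_extension:
  fixes \<gamma> :: "(nat \<Rightarrow> int) \<Rightarrow> 'k::alg_closed_field"
  assumes "finite E"
    and "\<And>u u'. u \<in> Q \<Longrightarrow> u' \<in> Q \<Longrightarrow> (\<lambda>q. u q + u' q) \<in> Q"
    and "\<And>u u'. u \<in> Q \<Longrightarrow> u' \<in> Q \<Longrightarrow> \<gamma> (\<lambda>q. u q + u' q) = \<gamma> u * \<gamma> u'"
    and "\<And>u k. u \<in> Q \<Longrightarrow> (\<lambda>q. k * u q) \<in> Q"
    and "\<And>u. u \<in> Q \<Longrightarrow> \<gamma> u \<noteq> 0"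
    and "\<And>u. u \<in> Q \<Longrightarrow> \<forall>w\<in>E. pair n u (v w) = 0 \<Longrightarrow> \<gamma> u = 1"
  shows "\<exists>t. (\<forall>w. t w \<noteq> 0) \<and> (\<forall>u\<in>Q. \<gamma> u = (\<Prod>w\<in>E. t w powi pair n u (v w)))"
  using assms
proof (induction E arbitrary: Q rule: finite_induct)
  case empty
  then show ?case by (intro exI[of _ "\<lambda>w. 1"]) auto
next
  case (insert e E)
  \<comment> \<open>On this subgroup the factor of \<open>e\<close> is trivial, so the induction
    hypothesis determines the remaining factors; only the value at \<open>e\<close> is left to
    choose.\<close>
  define Q0 where "Q0 = {u\<in>Q. pair n u (v e) = 0}"
  have "\<exists>t. (\<forall>w. t w \<noteq> 0) \<and> (\<forall>u\<in>Q0. \<gamma> u = (\<Prod>w\<in>E. t w powi pair n u (v w)))"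
    by (rule insert.IH)
      (use insert.prems in \<open>auto simp: Q0_def pair_add_left pair_scale_left\<close>)
  then obtain t where t: "\<And>w. t w \<noteq> 0"
    and t0: "\<And>u. u \<in> Q0 \<Longrightarrow> \<gamma> u = (\<Prod>w\<in>E. t w powi pair n u (v w))" by auto
  have upd: "(\<Prod>w\<in>insert e E. (t(e := r)) w powi pair n u (v w)) =
      r powi pair n u (v e) * (\<Prod>w\<in>E. t w powi pair n u (v w))" for r u
  proof -
    have "(\<Prod>w\<in>E. (t(e := r)) w powi pair n u (v w)) = (\<Prod>w\<in>E. t w powi pair n u (v w))"
      using insert.hyps by (intro prod.cong) auto
    then show ?thesis using insert.hyps by simp
  qed
  show ?case
  proof (cases "Q0 = Q")
    case True
    have "\<gamma> u = (\<Prod>w\<in>insert e E. (t(e := 1)) w powi pair n u (v w))" if "u \<in> Q" for u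
      unfolding upd using t0 True that by (auto simp: Q0_def)
    then show ?thesis using t by (intro exI[of _ "t(e := 1)"]) auto
  next
    case False
    then obtain u1 where u1: "u1 \<in> Q" "pair n u1 (v e) \<noteq> 0" by (auto simp: Q0_def)
    \<comment> \<open>The pairings of \<open>Q\<close> with \<open>v e\<close> form a nonzero
      subgroup of the integers. Its positive generator is obtained as the least positive
      value.\<close>
    let ?R = "\<lambda>m::nat. 0 < m \<and> (\<exists>u\<in>Q. pair n u (v e) = int m)"
    define u1' where "u1' = (\<lambda>q. sgn (pair n u1 (v e)) * u1 q)"
    have "u1' \<in> Q" unfolding u1'_def by (rule insert.prems(3)[OF u1(1)])
    moreover have "pair n u1' (v e) = \<bar>pair n u1 (v e)\<bar>"
      unfolding u1'_def pair_scale_left by (simp add: abs_sgn mult.commute)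
    ultimately have "?R (nat \<bar>pair n u1 (v e)\<bar>)"
      using u1(2) by (intro conjI bexI[of _ u1']) auto
    then have least: "?R (Least ?R)" by (rule LeastI)
    define m where "m = (LEAST m. ?R m)"
    obtain u2 where u2: "u2 \<in> Q" "pair n u2 (v e) = int m" and m: "0 < m"
      using least unfolding m_def by blast
    have mult: "\<exists>k. pair n u (v e) = k * int m" if u: "u \<in> Q" for u
    proof -
      define k where "k = pair n u (v e) div int m"
      define u3 where "u3 = (\<lambda>q. u q + (- k) * u2 q)"
      have u3: "u3 \<in> Q" unfolding u3_def using insert.prems(1)[OF u insert.prems(3)[OF u2(1)]] .
      have "pair n u3 (v e) = pair n u (v e) + (- k) * int m"
        unfolding u3_def pair_add_left pair_scale_left u2(2) ..
      then have p3: "pair n u3 (v e) = pair n u (v e) mod int m"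
        using div_mult_mod_eq[of "pair n u (v e)" "int m"] unfolding k_def by linarith
      have "pair n u (v e) mod int m = 0"
      proof (rule ccontr)
        assume "pair n u (v e) mod int m \<noteq> 0"
        moreover have pos: "0 \<le> pair n u (v e) mod int m" using m by simp
        ultimately have "0 < nat (pair n u (v e) mod int m)" by simp
        moreover have "pair n u3 (v e) = int (nat (pair n u (v e) mod int m))"
          unfolding p3 using pos by simp
        ultimately have "?R (nat (pair n u (v e) mod int m))" using u3 by (intro conjI bexI)
        then have "m \<le> nat (pair n u (v e) mod int m)" unfolding m_def by (rule Least_le)
        moreover have "pair n u (v e) mod int m < int m" using m by simp
        ultimately show False using pos by linarith
      qed
      then show ?thesis by (metis mod_0_imp_dvd dvd_def mult.commute)
    qed
    \<comment> \<open>\<open>c\<close> measures by how much the product over \<open>E\<close> misses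
      the character at \<open>u2\<close>. As \<open>u2\<close> pairs to \<open>m\<close> with
      \<open>v e\<close>, the new coordinate must be an \<open>m\<close>-th root of
      \<open>c\<close>.\<close>
    define c where "c = \<gamma> u2 / (\<Prod>w\<in>E. t w powi pair n u2 (v w))"
    obtain r where r: "r ^ m = c" using nth_root_exists[OF m] by blast
    have "c \<noteq> 0" using insert.prems(4)[OF u2(1)] t finite insert.hyps by (auto simp: c_def)
    then have r0: "r \<noteq> 0" using r m by (auto simp: power_0_left)
    have "\<gamma> u = (\<Prod>w\<in>insert e E. (t(e := r)) w powi pair n u (v w))" if u: "u \<in> Q" for u
    proof -
      obtain k where k: "pair n u (v e) = k * int m" using mult[OF u] by blast
      define u3 where "u3 = (\<lambda>q. u q + (- k) * u2 q)"
      have u3: "u3 \<in> Q" unfolding u3_def using insert.prems(1)[OF u insert.prems(3)[OF u2(1)]] .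
      have "u3 \<in> Q0" using u3 by (simp add: Q0_def u3_def pair_add_left pair_scale_left u2(2) k del: mult_minus_left)
      have "\<gamma> u3 = (\<Prod>w\<in>E. t w powi (pair n u (v w) + (- k) * pair n u2 (v w)))"
        unfolding t0[OF \<open>u3 \<in> Q0\<close>] by (simp only: u3_def pair_add_left pair_scale_left)
      also have "\<dots> = (\<Prod>w\<in>E. t w powi pair n u (v w) * (t w powi pair n u2 (v w)) powi (- k))"
        unfolding power_int_mult[symmetric]
        using t by (intro prod.cong refl, subst power_int_add) (simp_all add: mult.commute)
      also have "\<dots> = (\<Prod>w\<in>E. t w powi pair n u (v w)) * (\<Prod>w\<in>E. t w powi pair n u2 (v w)) powi (- k)"
        by (simp add: prod.distrib prod_powi)
      finally have g3: "\<gamma> u3 = \<dots>" .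
      have "\<gamma> u3 = \<gamma> u * \<gamma> (\<lambda>q. (- k) * u2 q)"
        unfolding u3_def using insert.prems(2)[OF u insert.prems(3)[OF u2(1)]] .
      also have "\<gamma> (\<lambda>q. (- k) * u2 q) = \<gamma> u2 powi (- k)"
        by (rule hom_powi[of Q, OF insert.prems(2) insert.prems(3) insert.prems(4) u2(1)])
      finally have "\<gamma> u * \<gamma> u2 powi (- k) = (\<Prod>w\<in>E. t w powi pair n u (v w)) * (\<Prod>w\<in>E. t w powi pair n u2 (v w)) powi (- k)"
        using g3 by simp
      then have "\<gamma> u = c powi k * (\<Prod>w\<in>E. t w powi pair n u (v w))"
        using insert.prems(4)[OF u2(1)] t finite insert.hyps
        by (simp add: c_def power_int_divide_distrib power_int_minus field_simps)
      also have "c powi k = r powi pair n u (v e)"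
        unfolding k r[symmetric] by (simp add: power_int_power mult.commute)
      finally show ?thesis unfolding upd .
    qed
    then show ?thesis using t r0 by (intro exI[of _ "t(e := r)"]) auto
  qed
qed

section \<open>The Cox quotient in terms of characters\<close>

context complete_AP
begin

text \<open>The pullback of the character of \<open>u\<close> to the Cox coordinates. A vanishing
  coordinate contributes 1 for exponent 0 and 0 for every other exponent, also a negative one, so
  the value is meaningful only if \<open>u\<close> is nonnegative on the zeros of
  \<open>x\<close>.\<close>

definition pchar :: "(nat \<Rightarrow> int) \<Rightarrow> (var \<Rightarrow> 'k) \<Rightarrow> 'k" where
  "pchar u x = (\<Prod>w\<in>vars D. x w powi pr u w)"

lemma pchar_zero: "pchar (\<lambda>q. 0) x = 1"
  by (simp add: pchar_def)

text \<open>At a zero coordinate additivity breaks down for opposite nonzero exponents, where the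
  left side has the factor 1 and the right side 0. Membership in the dual monoid of a cone
  containing the zeros excludes this.\<close>

lemma pchar_add:
  assumes "\<sigma> \<in> \<Sigma>" "zeros D x \<subseteq> V \<sigma>" "u \<in> dual \<sigma>" "u' \<in> dual \<sigma>"
  shows "pchar (\<lambda>q. u q + u' q) x = pchar u x * pchar u' x"
proof -
  have "x w powi (pr u w + pr u' w) = x w powi pr u w * x w powi pr u' w" if w: "w \<in> vars D" for w
  proof (cases "x w = 0")
    case True
    then have "w \<in> V \<sigma>" using w assms(2) by (auto simp: zeros_def)
    then have "0 \<le> pr u w" "0 \<le> pr u' w" using assms by (auto simp: dual_iff)
    then show ?thesis using True by (auto simp: power_int_0_left_if)
  qed (simp add: power_int_add)
  then show ?thesis by (simp add: pchar_def pair_add_left flip: prod.distrib)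
qed

lemma pchar_eq_0_iff: "pchar u x = 0 \<longleftrightarrow> (\<exists>w\<in>zeros D x. pr u w \<noteq> 0)"
  unfolding pchar_def prod_zero_iff[OF finite_vars] by (auto simp: zeros_def)

text \<open>If \<open>u\<close> vanishes on the columns of the zero coordinates, the face where it
  vanishes still contains all these columns, so by minimality of the orbit cone it is the whole
  cone.\<close>

lemma perp_orbit_cone:
  assumes "x \<in> Zh" "u \<in> dual (oc x)"
  shows "u \<in> perp d (oc x) \<longleftrightarrow> (\<forall>w\<in>zeros D x. pr u w = 0)"
proof
  let ?oc = "oc x"
  have oc: "?oc \<in> \<Sigma>" using assms(1) by (rule orbit_cone_in_fan)
  show "u \<in> perp d ?oc \<Longrightarrow> \<forall>w\<in>zeros D x. pr u w = 0"
    using perp_iff[OF oc] zeros_subset_orbit_cone by blast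
  assume *: "\<forall>w\<in>zeros D x. pr u w = 0"
  obtain \<tau> where \<tau>: "\<tau> \<in> \<Sigma>" "\<tau> \<subseteq> ?oc" "V \<tau> = {w\<in>V ?oc. pr u w = 0}"
    using oc assms(2) by (rule face_of_dual)
  have "zeros D x \<subseteq> V \<tau>" using * \<tau>(3) zeros_subset_orbit_cone by auto
  then have "?oc \<subseteq> \<tau>" using orbit_cone_subset_iff \<tau>(1) assms(1) by blast
  then have "V ?oc \<subseteq> V \<tau>" by (auto simp: V_def)
  then show "u \<in> perp d ?oc" using \<tau>(3) assms(2) by (auto simp: perp_iff[OF oc] dual_iff[OF oc])
qed

lemma snd_cox:
  "snd (cox x) u = (if u \<in> dual (oc x) then pchar u x else 0)"
  by (simp add: cox_quotient_def pchar_def)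

lemma fst_cox: "fst (cox x) = oc x"
  by (simp add: cox_quotient_def)

lemma snd_cox_chart:
  assumes "x \<in> Zh" "\<sigma> \<in> \<Sigma>" "zeros D x \<subseteq> V \<sigma>" "u \<in> dual \<sigma>"
  shows "snd (cox x) u = pchar u x"
proof -
  have "oc x \<subseteq> \<sigma>" using assms orbit_cone_subset_iff by blast
  then show ?thesis using assms(4) dual_antimono by (auto simp: snd_cox)
qed

lemma cox_in_toric_points:
  assumes x: "x \<in> Zh"
  shows "cox x \<in> tpoints"
proof -
  let ?oc = "oc x" and ?\<gamma> = "snd (cox x)"
  have oc: "?oc \<in> \<Sigma>" using x by (rule orbit_cone_in_fan)
  have "?\<gamma> (\<lambda>q. 0) = 1" by (simp add: snd_cox dual_zero pchar_zero)
  moreover have "?\<gamma> (\<lambda>q. u q + u' q) = ?\<gamma> u * ?\<gamma> u'"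
    if "u \<in> dual ?oc" "u' \<in> dual ?oc" for u u'
    using that dual_add[OF oc that] pchar_add[OF oc zeros_subset_orbit_cone that] by (simp add: snd_cox)
  moreover have "?\<gamma> u \<noteq> 0 \<longleftrightarrow> u \<in> perp d ?oc" for u
    using perp_subset_dual perp_orbit_cone[OF x] by (auto simp: snd_cox pchar_eq_0_iff)
  ultimately have "(?oc, ?\<gamma>) \<in> tpoints"
    using oc by (auto simp: toric_points_def)
  then show ?thesis by (simp flip: fst_cox)
qed

lemma cox_in_chart_iff:
  assumes "x \<in> Zh" "\<sigma> \<in> \<Sigma>"
  shows "cox x \<in> tchart \<sigma> \<longleftrightarrow> zeros D x \<subseteq> V \<sigma>"
proof -
  have "cox x \<in> tchart \<sigma> \<longleftrightarrow> oc x \<subseteq> \<sigma>"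
    using cox_in_toric_points[OF assms(1)] by (auto simp: toric_chart_def cox_quotient_def)
  then show ?thesis using orbit_cone_subset_iff assms by simp
qed

section \<open>Points of an affine chart\<close>

lemma toric_chart_cases:
  assumes "z \<in> tchart \<sigma>"
  shows "fst z \<in> \<Sigma>" "fst z \<subseteq> \<sigma>" "snd z (\<lambda>q. 0) = 1"
    "u \<in> dual (fst z) \<Longrightarrow> u' \<in> dual (fst z) \<Longrightarrow> snd z (\<lambda>q. u q + u' q) = snd z u * snd z u'"
    "snd z u \<noteq> 0 \<longleftrightarrow> u \<in> perp d (fst z)"
  using assms by (auto simp: toric_chart_def toric_points_def)

lemma chart_add:
  assumes "z \<in> tchart \<sigma>" "u \<in> dual \<sigma>" "u' \<in> dual \<sigma>"
  shows "snd z (\<lambda>q. u q + u' q) = snd z u * snd z u'"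
  using toric_chart_cases[OF assms(1)] assms(2,3) dual_antimono by blast

lemma chart_shift:
  assumes z: "z \<in> tchart \<sigma>" and "u \<in> dual (fst z)" "u0 \<in> dual (fst z)"
  shows "snd z (\<lambda>q. u q + int k * u0 q) = snd z u * snd z u0 ^ k"
proof (induction k)
  case (Suc k)
  note fz = toric_chart_cases(1)[OF z]
  have "(\<lambda>q. u q + int k * u0 q) \<in> dual (fst z)"
    using assms dual_add[OF fz assms(2) dual_scale[OF fz assms(3)]] by simp
  then have "snd z (\<lambda>q. (u q + int k * u0 q) + u0 q) = snd z (\<lambda>q. u q + int k * u0 q) * snd z u0"
    by (rule toric_chart_cases(4)[OF z _ assms(3)])
  then show ?case using Suc by (simp add: algebra_simps)
qed simp

text \<open>Localising the chart of the cone at this character gives the chart of the orbit cone of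
  \<open>z\<close>.\<close>

lemma chart_perp:
  assumes "z \<in> tchart \<sigma>" "\<sigma> \<in> \<Sigma>"
  obtains u0 where "u0 \<in> dual \<sigma>" "V (fst z) = {w\<in>V \<sigma>. pr u0 w = 0}" "snd z u0 \<noteq> 0"
proof -
  note z = toric_chart_cases[OF assms(1)]
  have *: "\<sigma> \<inter> fst z = fst z" using z(2) by blast
  obtain u0 where u0: "u0 \<in> dual \<sigma>" "V (fst z) = {w\<in>V \<sigma>. pr u0 w = 0}"
    using Int_cut_out[OF assms(2) z(1)] unfolding * .
  moreover have "u0 \<in> perp d (fst z)"
    unfolding perp_iff[OF z(1)] u0(2) using u0(1) dual_iff[OF assms(2)] by blast
  ultimately show ?thesis using that z(5) by blast
qed

text \<open>The character of \<open>chart_perp\<close> for \<open>z\<close> is also nonzero at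
  \<open>z'\<close>, so it is orthogonal to the orbit cone of \<open>z'\<close>; its zeros among the
  generators are those of the orbit cone of \<open>z\<close>.\<close>

lemma chart_subset:
  assumes "z \<in> tchart \<sigma>" "z' \<in> tchart \<sigma>" "\<sigma> \<in> \<Sigma>"
    and eq: "\<And>u. u \<in> dual \<sigma> \<Longrightarrow> snd z u = snd z' u"
  shows "fst z' \<subseteq> fst z"
proof -
  note z = toric_chart_cases[OF assms(1)] and z' = toric_chart_cases[OF assms(2)]
  obtain u0 where u0: "u0 \<in> dual \<sigma>" "V (fst z) = {w\<in>V \<sigma>. pr u0 w = 0}" "snd z u0 \<noteq> 0"
    using assms(1,3) by (rule chart_perp)
  then have "u0 \<in> perp d (fst z')" using eq z'(5) by metis
  then have "V (fst z') \<subseteq> V (fst z)"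
    using z'(2) unfolding perp_iff[OF z'(1)] u0(2) by (auto simp: V_def)
  then show ?thesis using cone_subset_iff z(1) z'(1) by blast
qed

text \<open>The orbit cones agree by \<open>chart_subset\<close> in both directions. A character
  defined only on the smaller chart becomes one of the big chart after adding a multiple of
  \<open>u0\<close>, whose value at \<open>z\<close> can be divided out.\<close>

lemma chart_separated:
  assumes "z \<in> tchart \<sigma>" "z' \<in> tchart \<sigma>" "\<sigma> \<in> \<Sigma>"
    and eq: "\<And>u. u \<in> dual \<sigma> \<Longrightarrow> snd z u = snd z' u"
  shows "z = z'"
proof -
  note z = toric_chart_cases[OF assms(1)] and z' = toric_chart_cases[OF assms(2)]
  have fst: "fst z = fst z'"
    using chart_subset[OF assms(1-3) eq] chart_subset[OF assms(2,1,3) eq[symmetric]] by blast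
  obtain u0 where u0: "u0 \<in> dual \<sigma>" "V (fst z) = {w\<in>V \<sigma>. pr u0 w = 0}" "snd z u0 \<noteq> 0"
    using assms(1,3) by (rule chart_perp)
  have u0d: "u0 \<in> dual (fst z)" using u0(1) dual_antimono[OF z(2)] by blast
  have "snd z u = snd z' u" for u
  proof (cases "u \<in> perp d (fst z)")
    case False
    then have "snd z u = 0" using z(5)[of u] by blast
    moreover have "snd z' u = 0" using False z'(5)[of u] fst by metis
    ultimately show ?thesis by simp
  next
    case True
    then have u: "u \<in> dual (fst z)" using perp_subset_dual by blast
    obtain k where k: "(\<lambda>q. u q + int k * u0 q) \<in> dual \<sigma>"
      using assms(3) z(1) u0(1,2) u by (rule dual_shift)
    have "snd z u * snd z u0 ^ k = snd z' u * snd z' u0 ^ k"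
      using eq[OF k] chart_shift[OF assms(1) u u0d] chart_shift[OF assms(2), of u u0] u u0d fst by simp
    then show ?thesis using u0(3) eq[OF u0(1)] by simp
  qed
  then show ?thesis using fst by (auto intro: prod_eqI)
qed

text \<open>On the orthogonal lattice of its orbit cone the point is a group character. It extends
  to coordinates outside \<open>V \<tau>\<close> since, by \<open>lattice_eq_zero\<close>, an
  orthogonal vector is determined by its values on these columns.\<close>

lemma cox_surj:
  assumes z: "z \<in> tpoints"
  obtains x where "x \<in> Zh" "cox x = z"
proof -
  obtain \<tau> \<gamma> where z\<tau>: "z = (\<tau>, \<gamma>)" by (cases z)
  have \<tau>: "\<tau> \<in> \<Sigma>" "\<gamma> (\<lambda>q. 0) = 1"
    and mult: "\<And>u u'. u \<in> dual \<tau> \<Longrightarrow> u' \<in> dual \<tau> \<Longrightarrow> \<gamma> (\<lambda>q. u q + u' q) = \<gamma> u * \<gamma> u'"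
    and supp: "\<And>u. \<gamma> u \<noteq> 0 \<longleftrightarrow> u \<in> perp d \<tau>"
    using z by (auto simp: z\<tau> toric_points_def)
  note perp = perp_iff[OF \<tau>(1)]
  have "\<exists>t. (\<forall>w. t w \<noteq> 0) \<and> (\<forall>u\<in>perp d \<tau>. \<gamma> u = (\<Prod>w\<in>vars D - V \<tau>. t w powi pr u w))"
  proof (rule character_extension)
    show "\<gamma> u = 1" if u: "u \<in> perp d \<tau>" "\<forall>w\<in>vars D - V \<tau>. pr u w = 0" for u
    proof -
      have "u = (\<lambda>q. 0)" using u by (intro lattice_eq_zero) (auto simp: perp)
      then show ?thesis using \<tau>(2) by simp
    qed
    show "\<gamma> (\<lambda>q. u q + u' q) = \<gamma> u * \<gamma> u'" if "u \<in> perp d \<tau>" "u' \<in> perp d \<tau>" for u u'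
      using mult that perp_subset_dual by blast
  qed (auto simp: perp supp finite_vars lattice_add lattice_scale pair_add_left pair_scale_left)
  then obtain t where t: "\<And>w. t w \<noteq> 0"
    and \<gamma>t: "\<And>u. u \<in> perp d \<tau> \<Longrightarrow> \<gamma> u = (\<Prod>w\<in>vars D - V \<tau>. t w powi pr u w)" by auto
  \<comment> \<open>Zero exactly on the generators of \<open>\<tau>\<close>, so that the orbit cone
    of \<open>x\<close> comes out as \<open>\<tau>\<close>.\<close>
  define x where "x w = (if w \<in> vars D - V \<tau> then t w else 0)" for w
  have zx: "zeros D x = V \<tau>" using t V_subset_vars by (auto simp: zeros_def x_def)
  then have x: "x \<in> Zh" using \<tau>(1) by (auto simp: Zhat_iff Zbar_def x_def)
  note oc = orbit_cone_in_fan[OF x]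
  have "oc x \<subseteq> \<tau>" using orbit_cone_subset_iff[OF \<tau>(1) x] zx by simp
  moreover have "\<tau> \<subseteq> oc x"
    using cone_subset_iff[OF \<tau>(1) oc] zeros_subset_orbit_cone[of x] zx by simp
  ultimately have ocx: "oc x = \<tau>" by blast
  have "snd (cox x) u = \<gamma> u" for u
  proof (cases "u \<in> perp d \<tau>")
    case True
    have "pchar u x = (\<Prod>w\<in>vars D - V \<tau>. t w powi pr u w)" unfolding pchar_def
      by (rule prod.mono_neutral_cong_right) (use finite_vars True in \<open>auto simp: x_def perp\<close>)
    then show ?thesis using True perp_subset_dual \<gamma>t by (auto simp: snd_cox ocx)
  next
    case False
    then have "u \<in> dual \<tau> \<Longrightarrow> pchar u x = 0"
      using perp_orbit_cone[OF x, of u] by (auto simp: ocx pchar_eq_0_iff)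
    then show ?thesis using False supp[of u] by (auto simp: snd_cox ocx)
  qed
  then have "cox x = z"
    unfolding z\<tau> by (intro prod_eqI ext) (simp_all add: fst_cox ocx)
  then show ?thesis using x by (intro that)
qed

end

section \<open>Locally rational maps\<close>

text \<open>The local form of a morphism: on one principal open set all coordinate functions of the
  target pull back into the localisation of the source ring. One \<open>h\<close> serves every
  \<open>g\<close> and only the exponent varies, which makes the notion stable under
  composition.\<close>

definition chart_map ::
    "'p set \<times> ('p \<Rightarrow> 'k::field) set \<Rightarrow> 'q set \<times> ('q \<Rightarrow> 'k) set \<Rightarrow> ('p \<Rightarrow> 'q) \<Rightarrow> 'p \<Rightarrow> bool" where
  "chart_map c c' \<phi> z \<longleftrightarrow> z \<in> fst c \<and> (\<exists>h\<in>snd c. h z \<noteq> 0 \<and>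
     (\<forall>y\<in>fst c. h y \<noteq> 0 \<longrightarrow> \<phi> y \<in> fst c') \<and>
     (\<forall>g\<in>snd c'. \<exists>f\<in>snd c. \<exists>n. \<forall>y\<in>fst c. h y \<noteq> 0 \<longrightarrow> g (\<phi> y) = f y / h y ^ n))"

definition mult_closed :: "'p set \<times> ('p \<Rightarrow> 'k::field) set \<Rightarrow> bool" where
  "mult_closed c \<longleftrightarrow> (\<exists>e\<in>snd c. \<forall>y\<in>fst c. e y = 1) \<and>
     (\<forall>f\<in>snd c. \<forall>g\<in>snd c. \<exists>h\<in>snd c. \<forall>y\<in>fst c. h y = f y * g y)"

definition loc_rational ::
    "('p, 'k::field) atlas \<Rightarrow> ('q, 'k) atlas \<Rightarrow> ('p \<Rightarrow> 'q) \<Rightarrow> bool" where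
  "loc_rational \<A> \<B> \<phi> \<longleftrightarrow> \<phi> \<in> points \<A> \<rightarrow> points \<B> \<and>
     (\<forall>z\<in>points \<A>. \<forall>c'\<in>\<B>. \<phi> z \<in> fst c' \<longrightarrow> (\<exists>c\<in>\<A>. chart_map c c' \<phi> z))"

section \<open>Composition and gluing\<close>

lemma mult_closed_mult:
  assumes "mult_closed c" "f \<in> snd c" "g \<in> snd c"
  obtains h where "h \<in> snd c" "\<forall>y\<in>fst c. h y = f y * g y"
  using assms unfolding mult_closed_def by blast

lemma mult_closed_power:
  assumes "mult_closed c" "f \<in> snd c"
  obtains h where "h \<in> snd c" "\<forall>y\<in>fst c. h y = f y ^ n"
proof -
  have "\<exists>h\<in>snd c. \<forall>y\<in>fst c. h y = f y ^ n"
  proof (induction n)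
    case 0
    then show ?case using assms(1) by (simp add: mult_closed_def)
  next
    case (Suc n)
    then obtain h where h: "h \<in> snd c" "\<And>y. y \<in> fst c \<Longrightarrow> h y = f y ^ n" by blast
    obtain h' where h': "h' \<in> snd c" "\<forall>y\<in>fst c. h' y = f y * h y"
      by (rule mult_closed_mult[OF assms h(1)])
    then show ?case using h(2) by (intro bexI[OF _ h'(1)]) simp
  qed
  then show ?thesis using that by blast
qed

text \<open>The new denominator is \<open>h\<close> times the numerator of the pullback of
  \<open>h'\<close>, which is nonzero only where both maps are described by fractions.\<close>

lemma chart_map_comp:
  assumes c: "mult_closed c" and \<phi>: "chart_map c c' \<phi> z" and \<psi>: "chart_map c' c'' \<psi> (\<phi> z)"
  shows "chart_map c c'' (\<psi> \<circ> \<phi>) z"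
proof -
  obtain h where z: "z \<in> fst c" and h: "h \<in> snd c" "h z \<noteq> 0" "\<And>y. y \<in> fst c \<Longrightarrow> h y \<noteq> 0 \<Longrightarrow> \<phi> y \<in> fst c'"
    and \<phi>': "\<And>g. g \<in> snd c' \<Longrightarrow> \<exists>f\<in>snd c. \<exists>n. \<forall>y\<in>fst c. h y \<noteq> 0 \<longrightarrow> g (\<phi> y) = f y / h y ^ n"
    using \<phi> unfolding chart_map_def by blast
  obtain h' where h': "h' \<in> snd c'" "h' (\<phi> z) \<noteq> 0" "\<And>y. y \<in> fst c' \<Longrightarrow> h' y \<noteq> 0 \<Longrightarrow> \<psi> y \<in> fst c''"
    and \<psi>': "\<And>g. g \<in> snd c'' \<Longrightarrow> \<exists>f\<in>snd c'. \<exists>n. \<forall>y\<in>fst c'. h' y \<noteq> 0 \<longrightarrow> g (\<psi> y) = f y / h' y ^ n"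
    using \<psi> unfolding chart_map_def by blast
  obtain f n where f: "f \<in> snd c" "\<And>y. y \<in> fst c \<Longrightarrow> h y \<noteq> 0 \<Longrightarrow> h' (\<phi> y) = f y / h y ^ n"
    using \<phi>'[OF h'(1)] by blast
  obtain k where k: "k \<in> snd c" "\<forall>y\<in>fst c. k y = h y * f y"
    by (rule mult_closed_mult[OF c h(1) f(1)])
  have knz: "h y \<noteq> 0 \<and> f y \<noteq> 0 \<and> \<phi> y \<in> fst c' \<and> h' (\<phi> y) \<noteq> 0" if "y \<in> fst c" "k y \<noteq> 0" for y
    using that h(3) f(2) k(2) by auto
  have "k z \<noteq> 0" using h(2) h'(2) f(2) k(2) z by force
  moreover have "(\<psi> \<circ> \<phi>) y \<in> fst c''" if "y \<in> fst c" "k y \<noteq> 0" for y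
    using knz[OF that] h'(3) by simp
  moreover have "\<exists>F\<in>snd c. \<exists>N. \<forall>y\<in>fst c. k y \<noteq> 0 \<longrightarrow> g ((\<psi> \<circ> \<phi>) y) = F y / k y ^ N"
    if g: "g \<in> snd c''" for g
  proof -
    obtain g1 m where g1: "g1 \<in> snd c'" "\<And>y. y \<in> fst c' \<Longrightarrow> h' y \<noteq> 0 \<Longrightarrow> g (\<psi> y) = g1 y / h' y ^ m"
      using \<psi>'[OF g] by blast
    obtain g2 p where g2: "g2 \<in> snd c" "\<And>y. y \<in> fst c \<Longrightarrow> h y \<noteq> 0 \<Longrightarrow> g1 (\<phi> y) = g2 y / h y ^ p"
      using \<phi>'[OF g1(1)] by blast
    \<comment> \<open>The powers of \<open>h\<close> and \<open>f\<close> bring g2 h^(nm) / (h^p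
      f^m) to the single denominator (h f)^(p+m).\<close>
    obtain a where a: "a \<in> snd c" "\<forall>y\<in>fst c. a y = h y ^ (n * m + m)"
      by (rule mult_closed_power[OF c h(1)])
    obtain b where b: "b \<in> snd c" "\<forall>y\<in>fst c. b y = f y ^ p"
      by (rule mult_closed_power[OF c f(1)])
    obtain ab where ab: "ab \<in> snd c" "\<forall>y\<in>fst c. ab y = a y * b y"
      by (rule mult_closed_mult[OF c a(1) b(1)])
    obtain F where F: "F \<in> snd c" "\<forall>y\<in>fst c. F y = g2 y * ab y"
      by (rule mult_closed_mult[OF c g2(1) ab(1)])
    have "g ((\<psi> \<circ> \<phi>) y) = F y / k y ^ (p + m)" if y: "y \<in> fst c" "k y \<noteq> 0" for y
    proof -
      note nz = knz[OF y]
      have "g ((\<psi> \<circ> \<phi>) y) = (g2 y / h y ^ p) / (f y / h y ^ n) ^ m"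
        using nz y g1(2) g2(2) f(2) by simp
      also have "\<dots> = (g2 y * (h y ^ (n * m + m) * f y ^ p)) / (h y * f y) ^ (p + m)"
        using nz by (simp add: field_simps power_add power_mult_distrib flip: power_mult)
      finally show ?thesis using y a b ab F k by simp
    qed
    then show ?thesis using F(1) by blast
  qed
  ultimately show ?thesis unfolding chart_map_def using z k(1) by blast
qed

lemma loc_rational_comp:
  assumes "\<And>c. c \<in> \<A> \<Longrightarrow> mult_closed c"
    and \<phi>: "loc_rational \<A> \<B> \<phi>" and \<psi>: "loc_rational \<B> \<C> \<psi>"
  shows "loc_rational \<A> \<C> (\<psi> \<circ> \<phi>)"
  unfolding loc_rational_def
proof (intro conjI ballI impI)
  show "\<psi> \<circ> \<phi> \<in> points \<A> \<rightarrow> points \<C>" using \<phi> \<psi> by (auto simp: loc_rational_def)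
  fix z c'' assume z: "z \<in> points \<A>" and c'': "c'' \<in> \<C>" "(\<psi> \<circ> \<phi>) z \<in> fst c''"
  have \<phi>z: "\<phi> z \<in> points \<B>" using \<phi> z by (auto simp: loc_rational_def)
  obtain c' where c': "c' \<in> \<B>" "chart_map c' c'' \<psi> (\<phi> z)"
    using \<psi> c'' \<phi>z unfolding loc_rational_def comp_def by blast
  then have "\<phi> z \<in> fst c'" by (simp add: chart_map_def)
  then obtain c where c: "c \<in> \<A>" "chart_map c c' \<phi> z"
    using \<phi> z c'(1) unfolding loc_rational_def by blast
  then show "\<exists>c\<in>\<A>. chart_map c c'' (\<psi> \<circ> \<phi>) z"
    using chart_map_comp[OF assms(1)[OF c(1)] c(2) c'(2)] by blast
qed

text \<open>One description near each point suffices: composing with the identity between target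
  charts, which is itself given by fractions, changes the target chart.\<close>

lemma loc_rationalI:
  assumes "\<And>c. c \<in> \<A> \<Longrightarrow> mult_closed c"
    and compat: "\<And>c c' z. c \<in> \<B> \<Longrightarrow> c' \<in> \<B> \<Longrightarrow> z \<in> fst c \<Longrightarrow> z \<in> fst c' \<Longrightarrow> chart_map c c' id z"
    and ex: "\<And>z. z \<in> points \<A> \<Longrightarrow> \<exists>c\<in>\<A>. \<exists>c'\<in>\<B>. \<phi> z \<in> fst c' \<and> chart_map c c' \<phi> z"
  shows "loc_rational \<A> \<B> \<phi>"
  unfolding loc_rational_def
proof (intro conjI ballI impI)
  show "\<phi> \<in> points \<A> \<rightarrow> points \<B>" using ex by (fastforce simp: points_def)
  fix z c'' assume z: "z \<in> points \<A>" and c'': "c'' \<in> \<B>" "\<phi> z \<in> fst c''"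
  obtain c c' where c: "c \<in> \<A>" "c' \<in> \<B>" "\<phi> z \<in> fst c'" "chart_map c c' \<phi> z" using ex[OF z] by blast
  have "chart_map c c'' (id \<circ> \<phi>) z"
    using chart_map_comp[OF assms(1)[OF c(1)] c(4) compat[OF c(2) c''(1) c(3) c''(2)]] .
  then show "\<exists>c\<in>\<A>. chart_map c c'' \<phi> z" using c(1) by auto
qed

lemma chart_map_cong:
  assumes "chart_map c c' \<phi> z" "\<And>y. y \<in> fst c \<Longrightarrow> \<phi> y = \<psi> y"
  shows "chart_map c c' \<psi> z"
  using assms unfolding chart_map_def by auto

lemma loc_rational_cong:
  assumes \<phi>: "loc_rational \<A> \<B> \<phi>" and eq: "\<And>z. z \<in> points \<A> \<Longrightarrow> \<phi> z = \<psi> z"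
  shows "loc_rational \<A> \<B> \<psi>"
  unfolding loc_rational_def
proof (intro conjI ballI impI)
  show "\<psi> \<in> points \<A> \<rightarrow> points \<B>"
    using \<phi> eq by (metis PiE Pi_I loc_rational_def)
  fix z c' assume "z \<in> points \<A>" "c' \<in> \<B>" "\<psi> z \<in> fst c'"
  then obtain c where c: "c \<in> \<A>" "chart_map c c' \<phi> z"
    using \<phi> eq unfolding loc_rational_def by metis
  have "chart_map c c' \<psi> z"
    using c(2) by (rule chart_map_cong) (use c(1) eq in \<open>auto simp: points_def\<close>)
  then show "\<exists>c\<in>\<A>. chart_map c c' \<psi> z" using c(1) by blast
qed

text \<open>The topology and the regular functions are both defined by fractions in charts, and
  numerators and denominators can be pulled back separately.\<close>

lemma loc_rational_morphism:
  assumes mc: "\<And>c. c \<in> \<A> \<Longrightarrow> mult_closed c" and \<phi>: "loc_rational \<A> \<B> \<phi>"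
  shows "morphism \<A> \<B> \<phi>"
  unfolding morphism_def
proof (intro conjI allI impI)
  have into: "\<phi> \<in> points \<A> \<rightarrow> points \<B>" using \<phi> by (simp add: loc_rational_def)
  then show "\<phi> \<in> points \<A> \<rightarrow> points \<B>" .
  have loc: "\<exists>c\<in>\<A>. \<exists>h\<in>snd c. z \<in> fst c \<and> h z \<noteq> 0 \<and> (\<forall>y\<in>fst c. h y \<noteq> 0 \<longrightarrow> \<phi> y \<in> fst c') \<and>
      (\<forall>g\<in>snd c'. \<exists>f\<in>snd c. \<exists>n. \<forall>y\<in>fst c. h y \<noteq> 0 \<longrightarrow> g (\<phi> y) = f y / h y ^ n)"
    if "z \<in> points \<A>" "c' \<in> \<B>" "\<phi> z \<in> fst c'" for z c'
    using that \<phi> unfolding loc_rational_def chart_map_def by blast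
  fix W assume W: "zariski_open \<B> W"
  let ?W = "\<phi> -` W \<inter> points \<A>"
  show "zariski_open \<A> ?W"
    unfolding zariski_open_def
  proof (intro conjI ballI)
    fix z assume z: "z \<in> ?W"
    obtain c' h' where c': "c' \<in> \<B>" "\<phi> z \<in> fst c'" "h' \<in> snd c'" "h' (\<phi> z) \<noteq> 0"
      "{y\<in>fst c'. h' y \<noteq> 0} \<subseteq> W"
      using W z unfolding zariski_open_def by fastforce
    obtain c h where c: "c \<in> \<A>" "h \<in> snd c" "z \<in> fst c" "h z \<noteq> 0"
      and h: "\<And>y. y \<in> fst c \<Longrightarrow> h y \<noteq> 0 \<Longrightarrow> \<phi> y \<in> fst c'"
      and pb: "\<forall>g\<in>snd c'. \<exists>f\<in>snd c. \<exists>n. \<forall>y\<in>fst c. h y \<noteq> 0 \<longrightarrow> g (\<phi> y) = f y / h y ^ n"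
      using loc[of z c'] z c' by blast
    obtain f n where f: "f \<in> snd c" "\<And>y. y \<in> fst c \<Longrightarrow> h y \<noteq> 0 \<Longrightarrow> h' (\<phi> y) = f y / h y ^ n"
      using pb c'(3) by blast
    \<comment> \<open>The factor \<open>h\<close> keeps the principal open set inside the region
      where \<open>f\<close> describes the pullback of \<open>h'\<close>.\<close>
    obtain k where k: "k \<in> snd c" "\<forall>y\<in>fst c. k y = f y * h y"
      by (rule mult_closed_mult[OF mc[OF c(1)] f(1) c(2)])
    have "k z \<noteq> 0" using k(2) f(2) c c'(4) by auto
    moreover have "{y\<in>fst c. k y \<noteq> 0} \<subseteq> ?W"
    proof
      fix y assume y: "y \<in> {y\<in>fst c. k y \<noteq> 0}"
      then have "h y \<noteq> 0" "h' (\<phi> y) \<noteq> 0" "\<phi> y \<in> fst c'" using k(2) f(2) h by auto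
      then show "y \<in> ?W" using c'(5) y c(1) by (auto simp: points_def)
    qed
    ultimately show "\<exists>(U, R)\<in>\<A>. z \<in> U \<and> (\<exists>h\<in>R. h z \<noteq> 0 \<and> {y\<in>U. h y \<noteq> 0} \<subseteq> ?W)"
      using c k(1) by (intro bexI[OF _ c(1)]) (auto simp: case_prod_beta)
  qed simp
  fix f0 assume reg: "regular_on \<B> W f0"
  show "regular_on \<A> ?W (f0 \<circ> \<phi>)"
    unfolding regular_on_def
  proof
    fix z assume z: "z \<in> ?W"
    then have "\<phi> z \<in> W" by simp
    with reg have "\<exists>(U, R)\<in>\<B>. \<phi> z \<in> U \<and> (\<exists>g\<in>R. \<exists>h\<in>R. h (\<phi> z) \<noteq> 0 \<and> (\<forall>y\<in>W \<inter> U. h y \<noteq> 0 \<longrightarrow> f0 y = g y / h y))"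
      unfolding regular_on_def by (rule bspec)
    then obtain c' g h' where c': "c' \<in> \<B>" "\<phi> z \<in> fst c'" "g \<in> snd c'" "h' \<in> snd c'" "h' (\<phi> z) \<noteq> 0"
      and f0: "\<And>y. y \<in> W \<Longrightarrow> y \<in> fst c' \<Longrightarrow> h' y \<noteq> 0 \<Longrightarrow> f0 y = g y / h' y"
      by (auto simp: case_prod_beta)
    obtain c h where c: "c \<in> \<A>" "h \<in> snd c" "z \<in> fst c" "h z \<noteq> 0"
      and h: "\<And>y. y \<in> fst c \<Longrightarrow> h y \<noteq> 0 \<Longrightarrow> \<phi> y \<in> fst c'"
      and pb: "\<forall>g\<in>snd c'. \<exists>f\<in>snd c. \<exists>n. \<forall>y\<in>fst c. h y \<noteq> 0 \<longrightarrow> g (\<phi> y) = f y / h y ^ n"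
      using loc[of z c'] z c' by blast
    note mcc = mc[OF c(1)]
    obtain f1 n where f1: "f1 \<in> snd c" "\<And>y. y \<in> fst c \<Longrightarrow> h y \<noteq> 0 \<Longrightarrow> g (\<phi> y) = f1 y / h y ^ n"
      using pb c'(3) by blast
    obtain f2 m where f2: "f2 \<in> snd c" "\<And>y. y \<in> fst c \<Longrightarrow> h y \<noteq> 0 \<Longrightarrow> h' (\<phi> y) = f2 y / h y ^ m"
      using pb c'(4) by blast
    \<comment> \<open>The successor matters: \<open>q\<close> must be divisible by \<open>h\<close>
      even if \<open>n\<close> is 0, so that \<open>q y\<close> nonzero implies \<open>h y\<close>
      nonzero. The numerator receives the same additional factor.\<close>
    obtain a where a: "a \<in> snd c" "\<forall>y\<in>fst c. a y = h y ^ Suc m"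
      by (rule mult_closed_power[OF mcc c(2)])
    obtain b where b: "b \<in> snd c" "\<forall>y\<in>fst c. b y = h y ^ Suc n"
      by (rule mult_closed_power[OF mcc c(2)])
    obtain p where p: "p \<in> snd c" "\<forall>y\<in>fst c. p y = f1 y * a y"
      by (rule mult_closed_mult[OF mcc f1(1) a(1)])
    obtain q where q: "q \<in> snd c" "\<forall>y\<in>fst c. q y = f2 y * b y"
      by (rule mult_closed_mult[OF mcc f2(1) b(1)])
    have "q z \<noteq> 0" using q(2) b(2) f2(2) c c'(5) by auto
    moreover have "(f0 \<circ> \<phi>) y = p y / q y" if y: "y \<in> ?W \<inter> fst c" "q y \<noteq> 0" for y
    proof -
      have hy: "h y \<noteq> 0" "f2 y \<noteq> 0" "y \<in> fst c" using y q(2) b(2) by auto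
      have "f0 (\<phi> y) = (f1 y / h y ^ n) / (f2 y / h y ^ m)"
        using f0[of "\<phi> y"] f1(2) f2(2) h hy y by auto
      also have "\<dots> = p y / q y" using hy p(2) q(2) a(2) b(2) by (simp add: field_simps)
      finally show ?thesis by simp
    qed
    ultimately show "\<exists>(U, R)\<in>\<A>. z \<in> U \<and> (\<exists>g\<in>R. \<exists>h\<in>R. h z \<noteq> 0 \<and>
        (\<forall>y\<in>?W \<inter> U. h y \<noteq> 0 \<longrightarrow> (f0 \<circ> \<phi>) y = g y / h y))"
      using c p(1) q(1) by (intro bexI[OF _ c(1)]) (auto simp: case_prod_beta)
  qed
qed

text \<open>An explicit inverse instead of \<open>inv_into\<close>, with the inverse law imposed on
  the points only; in this form automorphisms compose without effort.\<close>

definition rat_automorphism :: "('p, 'k::field) atlas \<Rightarrow> ('p \<Rightarrow> 'p) \<Rightarrow> bool" where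
  "rat_automorphism \<A> \<phi> \<longleftrightarrow> loc_rational \<A> \<A> \<phi> \<and>
     (\<exists>\<psi>. loc_rational \<A> \<A> \<psi> \<and> (\<forall>z\<in>points \<A>. \<psi> (\<phi> z) = z \<and> \<phi> (\<psi> z) = z))"

lemma rat_automorphism_comp:
  assumes "\<And>c. c \<in> \<A> \<Longrightarrow> mult_closed c"
    and \<phi>: "rat_automorphism \<A> \<phi>" and \<psi>: "rat_automorphism \<A> \<psi>"
  shows "rat_automorphism \<A> (\<psi> \<circ> \<phi>)"
proof -
  obtain \<phi>' where \<phi>': "loc_rational \<A> \<A> \<phi>" "loc_rational \<A> \<A> \<phi>'"
    "\<forall>z\<in>points \<A>. \<phi>' (\<phi> z) = z \<and> \<phi> (\<phi>' z) = z"
    using \<phi> unfolding rat_automorphism_def by blast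
  obtain \<psi>' where \<psi>': "loc_rational \<A> \<A> \<psi>" "loc_rational \<A> \<A> \<psi>'"
    "\<forall>z\<in>points \<A>. \<psi>' (\<psi> z) = z \<and> \<psi> (\<psi>' z) = z"
    using \<psi> unfolding rat_automorphism_def by blast
  have into: "\<phi> z \<in> points \<A>" "\<psi>' z \<in> points \<A>" if "z \<in> points \<A>" for z
    using \<phi>'(1) \<psi>'(2) that by (auto simp: loc_rational_def)
  have "loc_rational \<A> \<A> (\<psi> \<circ> \<phi>)" "loc_rational \<A> \<A> (\<phi>' \<circ> \<psi>')"
    apply (rule loc_rational_comp[OF assms(1) \<phi>'(1) \<psi>'(1)]; assumption)
    by (rule loc_rational_comp[OF assms(1) \<psi>'(2) \<phi>'(2)]; assumption)
  moreover have "(\<phi>' \<circ> \<psi>') ((\<psi> \<circ> \<phi>) z) = z \<and> (\<psi> \<circ> \<phi>) ((\<phi>' \<circ> \<psi>') z) = z" if "z \<in> points \<A>" for z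
    using \<phi>'(3) \<psi>'(3) into that by simp
  ultimately show ?thesis unfolding rat_automorphism_def by blast
qed

lemma rat_automorphism_automorphism:
  assumes mc: "\<And>c. c \<in> \<A> \<Longrightarrow> mult_closed c" and \<phi>: "rat_automorphism \<A> \<phi>"
  shows "automorphism \<A> \<phi>"
proof -
  obtain \<psi> where \<psi>: "loc_rational \<A> \<A> \<phi>" "loc_rational \<A> \<A> \<psi>"
    "\<forall>z\<in>points \<A>. \<psi> (\<phi> z) = z \<and> \<phi> (\<psi> z) = z"
    using \<phi> unfolding rat_automorphism_def by blast
  have into: "\<phi> z \<in> points \<A>" "\<psi> z \<in> points \<A>" if "z \<in> points \<A>" for z
    using \<psi>(1,2) that by (auto simp: loc_rational_def)
  have bij: "bij_betw \<phi> (points \<A>) (points \<A>)"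
    by (rule bij_betwI[where g = \<psi>]) (use into \<psi>(3) in auto)
  have "\<psi> z = inv_into (points \<A>) \<phi> z" if z: "z \<in> points \<A>" for z
    using inv_into_f_eq[of \<phi> "points \<A>" "\<psi> z" z] bij \<psi>(3) into z by (auto simp: bij_betw_def)
  then have "loc_rational \<A> \<A> (inv_into (points \<A>) \<phi>)"
    by (rule loc_rational_cong[OF \<psi>(2)])
  then show ?thesis unfolding automorphism_def
    using bij loc_rational_morphism[OF mc] \<psi>(1) by blast
qed

section \<open>Restriction to a subset\<close>

lemma points_restrict: "points ((\<lambda>(U, R). (U \<inter> X, R)) ` \<A>) = points \<A> \<inter> X"
  by (auto simp: points_def)

lemma mult_closed_restrict:
  "mult_closed c \<Longrightarrow> mult_closed ((\<lambda>(U, R). (U \<inter> X, R)) c)"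
  unfolding mult_closed_def case_prod_beta fst_conv snd_conv by (meson IntD1)

lemma loc_rational_restrict:
  assumes \<phi>: "loc_rational \<A> \<A> \<phi>" and X: "\<And>z. z \<in> points \<A> \<inter> X \<Longrightarrow> \<phi> z \<in> X"
  shows "loc_rational ((\<lambda>(U, R). (U \<inter> X, R)) ` \<A>) ((\<lambda>(U, R). (U \<inter> X, R)) ` \<A>) \<phi>"
  unfolding loc_rational_def points_restrict
proof (intro conjI ballI impI)
  show "\<phi> \<in> points \<A> \<inter> X \<rightarrow> points \<A> \<inter> X" using \<phi> X by (auto simp: loc_rational_def)
  fix z c1 assume z: "z \<in> points \<A> \<inter> X" and c1: "c1 \<in> (\<lambda>(U, R). (U \<inter> X, R)) ` \<A>" "\<phi> z \<in> fst c1"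
  obtain c' where c': "c' \<in> \<A>" "c1 = (fst c' \<inter> X, snd c')" using c1(1) by (auto simp: case_prod_beta)
  then obtain c where c: "c \<in> \<A>" "chart_map c c' \<phi> z"
    using \<phi> z c1(2) unfolding loc_rational_def by (metis IntD1 fst_conv)
  obtain h where zc: "z \<in> fst c" and h: "h \<in> snd c" "h z \<noteq> 0" "\<forall>y\<in>fst c. h y \<noteq> 0 \<longrightarrow> \<phi> y \<in> fst c'"
    "\<forall>g\<in>snd c'. \<exists>f\<in>snd c. \<exists>n. \<forall>y\<in>fst c. h y \<noteq> 0 \<longrightarrow> g (\<phi> y) = f y / h y ^ n"
    using c(2) unfolding chart_map_def by blast
  have "chart_map (fst c \<inter> X, snd c) c1 \<phi> z"
    unfolding chart_map_def c'(2) fst_conv snd_conv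
  proof (rule conjI[OF _ bexI[OF _ h(1)]], goal_cases)
    case 2
    show ?case
    proof (intro conjI ballI impI)
    show "\<phi> y \<in> fst c' \<inter> X" if "y \<in> fst c \<inter> X" "h y \<noteq> 0" for y
      using h(3) that X[of y] c(1) by (auto simp: points_def)
    show "\<exists>f\<in>snd c. \<exists>n. \<forall>y\<in>fst c \<inter> X. h y \<noteq> 0 \<longrightarrow> g (\<phi> y) = f y / h y ^ n" if "g \<in> snd c'" for g
      using h(4) that by (meson IntD1)
    qed (use h(2) in auto)
  qed (use z zc in auto)
  moreover have "(fst c \<inter> X, snd c) \<in> (\<lambda>(U, R). (U \<inter> X, R)) ` \<A>" using c(1) by force
  ultimately show "\<exists>c\<in>(\<lambda>(U, R). (U \<inter> X, R)) ` \<A>. chart_map c c1 \<phi> z" by blast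
qed

section \<open>Root subgroups of toric varieties\<close>

abbreviation keys :: "('a \<Rightarrow>\<^sub>0 'b::zero) \<Rightarrow> 'a set" where "keys \<equiv> Poly_Mapping.keys"

abbreviation lookup :: "('a \<Rightarrow>\<^sub>0 'b::zero) \<Rightarrow> 'a \<Rightarrow> 'b" where "lookup \<equiv> Poly_Mapping.lookup"

abbreviation single :: "'a \<Rightarrow> 'b \<Rightarrow> 'a \<Rightarrow>\<^sub>0 'b::zero" where "single \<equiv> Poly_Mapping.single"

section \<open>Character sums\<close>

lemma char_sum_superset:
  assumes "finite S" "keys f \<subseteq> S"
  shows "char_sum f z = (\<Sum>u\<in>S. lookup f u * snd z u)"
  unfolding char_sum_def using assms by (intro sum.mono_neutral_left) (auto simp: in_keys_iff)

lemma char_sum_add: "char_sum (f + g) z = char_sum f z + char_sum g z"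
proof -
  let ?S = "keys f \<union> keys g"
  have "finite ?S" "keys (f + g) \<subseteq> ?S" using Poly_Mapping.keys_add[of f g] by auto
  then show ?thesis
    by (simp add: char_sum_superset[of ?S] lookup_add distrib_right sum.distrib)
qed

lemma char_sum_single: "char_sum (single u a) z = a * snd z u"
  by (simp add: char_sum_superset[of "{u}"])

lemma descend_eq:
  assumes "x \<in> W" "p x = z" "\<And>x'. x' \<in> W \<Longrightarrow> p x' = z \<Longrightarrow> f x' \<in> W \<and> p (f x') = y"
  shows "descend W p f z = y"
  unfolding descend_def using assms by (intro the_equality) blast+

lemma descend_cong:
  assumes "\<And>x. x \<in> W \<Longrightarrow> f x = g x"
  shows "descend W p f = descend W p g"
proof
  show "descend W p f z = descend W p g z" for z
    unfolding descend_def by (rule arg_cong[of _ _ The]) (use assms in auto)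
qed

context complete_AP
begin

text \<open>Agreement on the chart only: characters multiply correctly just at points of the chart,
  so a product of two members of the coordinate ring need not be a character sum as a function on
  all points.\<close>

definition regular :: "(nat \<Rightarrow> rat) set \<Rightarrow> ('k tpoint \<Rightarrow> 'k) \<Rightarrow> bool" where
  "regular \<sigma> F \<longleftrightarrow> (\<exists>f\<in>toric_coord_ring d \<sigma>. \<forall>z\<in>tchart \<sigma>. F z = f z)"

lemma regular_char_sum:
  assumes "keys f \<subseteq> dual \<sigma>"
    and "\<And>z. z \<in> tchart \<sigma> \<Longrightarrow> F z = char_sum f z"
  shows "regular \<sigma> F"
  unfolding regular_def using assms by (intro bexI[of _ "char_sum f"]) (auto simp: toric_coord_ring_def)

lemma regularE:
  assumes "regular \<sigma> F"
  obtains f where "keys f \<subseteq> dual \<sigma>" "\<forall>z\<in>tchart \<sigma>. F z = char_sum f z"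
  using assms by (auto simp: regular_def toric_coord_ring_def)

lemma regular_cong:
  "regular \<sigma> F \<Longrightarrow> (\<And>z. z \<in> tchart \<sigma> \<Longrightarrow> F z = G z) \<Longrightarrow> regular \<sigma> G"
  unfolding regular_def by (metis (no_types, lifting))

lemma regular_char: "u \<in> dual \<sigma> \<Longrightarrow> regular \<sigma> (\<lambda>z. a * snd z u)"
  by (rule regular_char_sum[of "single u a"]) (simp_all add: char_sum_single)

lemma regular_const: "regular \<sigma> (\<lambda>z. a)"
  by (rule regular_cong[OF regular_char[OF dual_zero, of _ a]]) (simp add: toric_chart_cases(3))

lemma regular_add:
  assumes "regular \<sigma> F" "regular \<sigma> G" shows "regular \<sigma> (\<lambda>z. F z + G z)"
proof -
  obtain f where f: "keys f \<subseteq> dual \<sigma>" "\<forall>z\<in>tchart \<sigma>. F z = char_sum f z"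
    using assms(1) by (rule regularE)
  obtain g where g: "keys g \<subseteq> dual \<sigma>" "\<forall>z\<in>tchart \<sigma>. G z = char_sum g z"
    using assms(2) by (rule regularE)
  show ?thesis
    by (rule regular_char_sum[of "f + g"])
      (use f g Poly_Mapping.keys_add[of f g] in \<open>auto simp: char_sum_add\<close>)
qed

lemma regular_sum: "(\<And>i. i \<in> I \<Longrightarrow> regular \<sigma> (F i)) \<Longrightarrow> regular \<sigma> (\<lambda>z. \<Sum>i\<in>I. F i z)"
  by (induction I rule: infinite_finite_induct) (auto intro: regular_const regular_add)

lemma regular_mult:
  assumes \<sigma>: "\<sigma> \<in> \<Sigma>" and "regular \<sigma> F" "regular \<sigma> G" shows "regular \<sigma> (\<lambda>z. F z * G z)"
proof -
  obtain f where f: "keys f \<subseteq> dual \<sigma>" "\<forall>z\<in>tchart \<sigma>. F z = char_sum f z"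
    using assms(2) by (rule regularE)
  obtain g where g: "keys g \<subseteq> dual \<sigma>" "\<forall>z\<in>tchart \<sigma>. G z = char_sum g z"
    using assms(3) by (rule regularE)
  let ?H = "\<lambda>z. \<Sum>u\<in>keys f. \<Sum>u'\<in>keys g.
    (lookup f u * lookup g u') * snd z (\<lambda>q. u q + u' q)"
  have "regular \<sigma> ?H"
    by (intro regular_sum regular_char dual_add[OF \<sigma>]) (use f(1) g(1) in auto)
  then show ?thesis
  proof (rule regular_cong)
    fix z :: "'k tpoint" assume z: "z \<in> tchart \<sigma>"
    have "?H z = (\<Sum>u\<in>keys f. \<Sum>u'\<in>keys g.
        (lookup f u * snd z u) * (lookup g u' * snd z u'))"
      by (intro sum.cong refl) (use chart_add[OF z] f(1) g(1) in auto)
    also have "\<dots> = F z * G z"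
      using z f(2) g(2) by (simp add: char_sum_def sum_product)
    finally show "?H z = F z * G z" .
  qed
qed

lemma regular_power: "\<sigma> \<in> \<Sigma> \<Longrightarrow> regular \<sigma> F \<Longrightarrow> regular \<sigma> (\<lambda>z. F z ^ n)"
  by (induction n) (auto intro: regular_const regular_mult)

section \<open>The charts of \<open>Z\<close> and their gluing\<close>

abbreviation chart :: "(nat \<Rightarrow> rat) set \<Rightarrow> 'k tpoint set \<times> ('k tpoint \<Rightarrow> 'k) set" where
  "chart \<sigma> \<equiv> (tchart \<sigma>, toric_coord_ring d \<sigma>)"

lemma Z_var_iff: "c \<in> ZV \<longleftrightarrow> (\<exists>\<sigma>\<in>\<Sigma>. c = chart \<sigma>)"
  by (auto simp: Z_var_def toric_variety_def)

lemma points_Z_var: "points (ZV) = tpoints"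
  by (force simp: points_def Z_var_iff toric_chart_def toric_points_def)

lemma coord_ring_regular: "f \<in> toric_coord_ring d \<sigma> \<Longrightarrow> regular \<sigma> f"
  by (auto simp: regular_def)

lemma mult_closed_Z_var: "c \<in> ZV \<Longrightarrow> mult_closed c"
proof -
  assume "c \<in> ZV"
  then obtain \<sigma> where \<sigma>: "\<sigma> \<in> \<Sigma>" "c = chart \<sigma>" by (auto simp: Z_var_iff)
  have reg: "\<exists>h\<in>toric_coord_ring d \<sigma>. \<forall>z\<in>tchart \<sigma>. h z = F z" if "regular \<sigma> F" for F
    using that unfolding regular_def by auto
  show "mult_closed c"
    unfolding mult_closed_def \<sigma>(2) fst_conv snd_conv
    by (intro conjI ballI reg regular_const regular_mult[OF \<sigma>(1)] coord_ring_regular)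
qed

text \<open>The coordinate ring is spanned by characters, so it suffices to pull these back; a
  finite sum of them is brought to a common denominator.\<close>

lemma chart_mapI:
  assumes \<sigma>: "\<sigma> \<in> \<Sigma>" and z: "z \<in> tchart \<sigma>"
    and H: "regular \<sigma> H" "H z \<noteq> 0" "\<And>y. y \<in> tchart \<sigma> \<Longrightarrow> H y \<noteq> 0 \<Longrightarrow> \<phi> y \<in> tchart \<sigma>'"
    and pb: "\<And>u. u \<in> dual \<sigma>' \<Longrightarrow> \<exists>F n. regular \<sigma> F \<and>
      (\<forall>y\<in>tchart \<sigma>. H y \<noteq> 0 \<longrightarrow> snd (\<phi> y) u = F y / H y ^ n)"
  shows "chart_map (chart \<sigma>) (chart \<sigma>') \<phi> z"
proof -
  obtain h where h: "h \<in> toric_coord_ring d \<sigma>" "\<forall>y\<in>tchart \<sigma>. H y = h y"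
    using H(1) unfolding regular_def by blast
  have "\<exists>f\<in>toric_coord_ring d \<sigma>. \<exists>n. \<forall>y\<in>tchart \<sigma>. h y \<noteq> 0 \<longrightarrow> g (\<phi> y) = f y / h y ^ n"
    if g: "g \<in> toric_coord_ring d \<sigma>'" for g
  proof -
    obtain p where p: "g = char_sum p" "keys p \<subseteq> dual \<sigma>'"
      using g by (auto simp: toric_coord_ring_def)
    let ?K = "keys p"
    have "\<forall>u\<in>?K. \<exists>Fn. regular \<sigma> (fst Fn) \<and>
      (\<forall>y\<in>tchart \<sigma>. H y \<noteq> 0 \<longrightarrow> snd (\<phi> y) u = fst Fn y / H y ^ snd Fn)"
    proof
      fix u assume "u \<in> ?K"
      then have "u \<in> dual \<sigma>'" using p(2) by blast
      from pb[OF this] obtain F n where "regular \<sigma> F \<and>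
        (\<forall>y\<in>tchart \<sigma>. H y \<noteq> 0 \<longrightarrow> snd (\<phi> y) u = F y / H y ^ n)" by (elim exE)
      then show "\<exists>Fn. regular \<sigma> (fst Fn) \<and>
        (\<forall>y\<in>tchart \<sigma>. H y \<noteq> 0 \<longrightarrow> snd (\<phi> y) u = fst Fn y / H y ^ snd Fn)"
        by (intro exI[of _ "(F, n)"]) simp
    qed
    from bchoice[OF this] obtain Fn where Fn: "\<forall>u\<in>?K. regular \<sigma> (fst (Fn u)) \<and>
      (\<forall>y\<in>tchart \<sigma>. H y \<noteq> 0 \<longrightarrow> snd (\<phi> y) u = fst (Fn u) y / H y ^ snd (Fn u))" by (elim exE)
    define F where "F u = fst (Fn u)" for u
    define n where "n u = snd (Fn u)" for u
    have F: "regular \<sigma> (F u)" if "u \<in> ?K" for u using Fn that by (simp add: F_def)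
    have \<phi>: "snd (\<phi> y) u = F u y / H y ^ n u"
      if "u \<in> ?K" "y \<in> tchart \<sigma>" "H y \<noteq> 0" for u y
      using Fn that by (simp add: F_def n_def)
    \<comment> \<open>Each character comes with its own exponent; the sum bounds all of
      them.\<close>
    define N where "N = (\<Sum>u\<in>?K. n u)"
    have N: "n u \<le> N" if "u \<in> ?K" for u
      unfolding N_def using that by (intro member_le_sum) auto
    let ?G = "\<lambda>y. \<Sum>u\<in>?K. lookup p u * (F u y * H y ^ (N - n u))"
    have "regular \<sigma> ?G"
      by (intro regular_sum regular_mult[OF \<sigma>] regular_const regular_power[OF \<sigma>] F H(1))
    then obtain f where f: "f \<in> toric_coord_ring d \<sigma>" "\<forall>y\<in>tchart \<sigma>. ?G y = f y"
      unfolding regular_def by blast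
    have "g (\<phi> y) = f y / h y ^ N" if y: "y \<in> tchart \<sigma>" "h y \<noteq> 0" for y
    proof -
      have Hy: "H y \<noteq> 0" "H y = h y" using h(2) y by auto
      have "g (\<phi> y) = (\<Sum>u\<in>?K. lookup p u * (F u y / H y ^ n u))"
        unfolding p(1) char_sum_def by (intro sum.cong refl) (simp add: \<phi> y Hy(1))
      also have "\<dots> = (\<Sum>u\<in>?K. lookup p u * (F u y * H y ^ (N - n u)) / H y ^ N)"
      proof (intro sum.cong refl)
        fix u assume "u \<in> ?K"
        then have "H y ^ N = H y ^ (N - n u) * H y ^ n u" using N by (simp flip: power_add)
        then show "lookup p u * (F u y / H y ^ n u) =
            lookup p u * (F u y * H y ^ (N - n u)) / H y ^ N"
          using Hy(1) by simp
      qed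
      also have "\<dots> = f y / h y ^ N"
        using bspec[OF f(2) y(1)] by (simp add: Hy(2) flip: sum_divide_distrib)
      finally show ?thesis .
    qed
    then show ?thesis using f(1) by blast
  qed
  moreover have "h z \<noteq> 0" "\<And>y. y \<in> tchart \<sigma> \<Longrightarrow> h y \<noteq> 0 \<Longrightarrow> \<phi> y \<in> tchart \<sigma>'"
    using H(2,3) h(2) z by auto
  ultimately show ?thesis unfolding chart_map_def fst_conv snd_conv using z h(1) by blast
qed

text \<open>The charts meet in the chart of their common face, which is the nonvanishing locus of
  the character of \<open>u0\<close>. By \<open>dual_shift\<close> a character of the second chart
  is one of the first divided by a power of it.\<close>

lemma chart_map_id:
  assumes "c \<in> ZV" "c' \<in> ZV" "z \<in> fst c" "z \<in> fst c'"
  shows "chart_map c c' id z"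
proof -
  obtain \<sigma> \<sigma>' where \<sigma>: "\<sigma> \<in> \<Sigma>" "c = chart \<sigma>" and \<sigma>': "\<sigma>' \<in> \<Sigma>" "c' = chart \<sigma>'"
    using assms(1,2) by (auto simp: Z_var_iff)
  have z: "z \<in> tchart \<sigma>" "z \<in> tchart \<sigma>'" using assms \<sigma> \<sigma>' by auto
  obtain u0 where u0: "u0 \<in> dual \<sigma>" "V (\<sigma> \<inter> \<sigma>') = {w\<in>V \<sigma>. pr u0 w = 0}"
    using \<sigma>(1) \<sigma>'(1) by (rule Int_cut_out)
  have iff: "snd y u0 \<noteq> 0 \<longleftrightarrow> fst y \<subseteq> \<sigma>'" if y: "y \<in> tchart \<sigma>" for y
  proof -
    note y' = toric_chart_cases[OF y]
    have "V (fst y) \<subseteq> V \<sigma>" using y'(2) by (auto simp: V_def)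
    then have "snd y u0 \<noteq> 0 \<longleftrightarrow> V (fst y) \<subseteq> V (\<sigma> \<inter> \<sigma>')"
      unfolding y'(5) perp_iff[OF y'(1)] u0(2) using u0(1) by (auto simp: dual_iff[OF \<sigma>(1)])
    also have "\<dots> \<longleftrightarrow> fst y \<subseteq> \<sigma> \<inter> \<sigma>'" using cone_subset_iff fan_Int y'(1) \<sigma>(1) \<sigma>'(1) by blast
    finally show ?thesis using y'(2) by blast
  qed
  have mem: "y \<in> tchart \<sigma>' \<longleftrightarrow> fst y \<subseteq> \<sigma>'" if "y \<in> tchart \<sigma>" for y
    using that by (auto simp: toric_chart_def)
  show ?thesis unfolding \<sigma>(2) \<sigma>'(2)
  proof (rule chart_mapI[OF \<sigma>(1) z(1), where H = "\<lambda>y. 1 * snd y u0"])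
    show "regular \<sigma> (\<lambda>y. 1 * snd y u0)" using u0(1) by (rule regular_char)
    show "1 * snd z u0 \<noteq> 0" using iff[OF z(1)] mem[OF z(1)] z(2) by simp
    show "id y \<in> tchart \<sigma>'" if "y \<in> tchart \<sigma>" "1 * snd y u0 \<noteq> 0" for y
      using that iff[OF that(1)] mem[OF that(1)] by simp
    fix u assume u: "u \<in> dual \<sigma>'"
    have "u \<in> dual (\<sigma> \<inter> \<sigma>')" using u dual_antimono by blast
    then obtain k where k: "(\<lambda>q. u q + int k * u0 q) \<in> dual \<sigma>"
      by (rule dual_shift[OF \<sigma>(1) fan_Int[OF \<sigma>(1) \<sigma>'(1)] u0])
    have "snd (id y) u = (1 * snd y (\<lambda>q. u q + int k * u0 q)) / (1 * snd y u0) ^ k"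
      if y: "y \<in> tchart \<sigma>" "1 * snd y u0 \<noteq> 0" for y
    proof -
      have "fst y \<subseteq> \<sigma>'" "fst y \<subseteq> \<sigma>"
        using iff[OF y(1)] y(2) toric_chart_cases(2)[OF y(1)] by simp_all
      then have "u \<in> dual (fst y)" "u0 \<in> dual (fst y)"
        using u u0(1) dual_antimono by blast+
      then show ?thesis using chart_shift[OF y(1)] y(2) by simp
    qed
    then show "\<exists>F n. regular \<sigma> F \<and>
        (\<forall>y\<in>tchart \<sigma>. 1 * snd y u0 \<noteq> 0 \<longrightarrow> snd (id y) u = F y / (1 * snd y u0) ^ n)"
      using regular_char[OF k, of 1] by blast
  qed
qed

lemma loc_rational_id: "loc_rational (ZV) (ZV) id"
proof (rule loc_rationalI[OF mult_closed_Z_var chart_map_id])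
  fix z assume "z \<in> points (ZV)"
  then obtain c where "c \<in> ZV" "z \<in> fst c" by (auto simp: points_def)
  then show "\<exists>c\<in>ZV. \<exists>c'\<in>ZV. id z \<in> fst c' \<and> chart_map c c' id z"
    using chart_map_id by fastforce
qed

lemma rat_automorphism_id: "rat_automorphism (ZV) id"
  unfolding rat_automorphism_def using loc_rational_id by (intro conjI exI[of _ id]) auto

text \<open>The value of \<delta>_u(T_v) at \<open>x\<close>. The coordinate of \<open>v\<close> is
  left out because its exponent is 1 - 1; the remaining exponents are nonnegative for a Demazure
  root, so \<open>nat\<close> loses nothing.\<close>

definition root_monom :: "var \<Rightarrow> (nat \<Rightarrow> int) \<Rightarrow> (var \<Rightarrow> 'k) \<Rightarrow> 'k" where
  "root_monom v u x = (\<Prod>w\<in>vars D - {v}. x w ^ nat (pr u w))"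

definition root_flow :: "var \<Rightarrow> (nat \<Rightarrow> int) \<Rightarrow> 'k \<Rightarrow> (var \<Rightarrow> 'k) \<Rightarrow> var \<Rightarrow> 'k" where
  "root_flow v u s x = x(v := x v + s * root_monom v u x)"

definition root_map :: "var \<Rightarrow> (nat \<Rightarrow> int) \<Rightarrow> 'k \<Rightarrow> 'k tpoint \<Rightarrow> 'k tpoint" where
  "root_map v u s = descend (Zh) (cox) (root_flow v u s)"

lemma root_flow_inverse: "root_flow v u (- s) (root_flow v u s x) = x"
proof -
  have "root_monom v u (root_flow v u s x) = root_monom v u x"
    unfolding root_monom_def by (intro prod.cong) (auto simp: root_flow_def)
  then show ?thesis unfolding root_flow_def[of _ _ "- s"] by (auto simp: root_flow_def)
qed

lemma root_flow_Zbar: "demazure_root v u \<Longrightarrow> x \<in> Zbar D \<Longrightarrow> root_flow v u s x \<in> Zbar D"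
  by (auto simp: root_flow_def Zbar_def demazure_root_def)

section \<open>Effect of a root flow on characters\<close>

lemma pchar_remove:
  assumes "v \<in> vars D"
  shows "pchar u x = x v powi pr u v * (\<Prod>w\<in>vars D - {v}. x w powi pr u w)"
  unfolding pchar_def using finite_vars assms by (rule prod.remove)

lemma pchar_root_flow:
  assumes "v \<in> vars D"
  shows "pchar u' (root_flow v u s x) =
    (x v + s * root_monom v u x) powi pr u' v * (\<Prod>w\<in>vars D - {v}. x w powi pr u' w)"
proof -
  have "(\<Prod>w\<in>vars D - {v}. root_flow v u s x w powi pr u' w) = (\<Prod>w\<in>vars D - {v}. x w powi pr u' w)"
    by (intro prod.cong) (auto simp: root_flow_def)
  then show ?thesis unfolding pchar_remove[OF assms] by (simp add: root_flow_def)
qed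

text \<open>Adding \<open>u\<close> lowers only the value at \<open>v\<close>, by one each time, so
  it may be repeated as often as that value allows.\<close>

lemma root_dual:
  assumes u: "demazure_root v u" and \<sigma>: "\<sigma> \<in> \<Sigma>" "u' \<in> dual \<sigma>" and k: "k \<le> nat (pr u' v)"
    and v: "v \<in> V \<sigma>"
  shows "(\<lambda>q. u' q + int k * u q) \<in> dual \<sigma>"
proof -
  have "0 \<le> pr u' w + int k * pr u w" if w: "w \<in> V \<sigma>" for w
  proof (cases "w = v")
    case True
    have "0 \<le> pr u' v" using \<sigma> v by (auto simp: dual_iff)
    then show ?thesis using True u k by (simp add: demazure_root_def)
  next
    case False
    then have "0 \<le> pr u w" using u w V_subset_vars by (auto simp: demazure_root_def)
    moreover have "0 \<le> pr u' w" using \<sigma> w by (auto simp: dual_iff)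
    ultimately show ?thesis by simp
  qed
  then show ?thesis
    using u \<sigma> by (auto simp: dual_iff pair_add_left pair_scale_left lattice_add lattice_scale demazure_root_def)
qed

text \<open>The delicate case is a vanishing base with total exponent 0: the sign conditions then
  force both summands of the exponent to be 0.\<close>

lemma powi_add_nonneg:
  assumes "0 \<le> b" "(x::'k) \<noteq> 0 \<or> 0 \<le> a"
  shows "x powi (a + int k * b) = x powi a * (x ^ nat b) ^ k"
proof -
  have "x powi (int k * b) = (x ^ nat b) ^ k"
    using assms(1) by (metis int_nat_eq mult.commute power_int_of_nat power_mult of_nat_mult)
  moreover have "x powi (a + int k * b) = x powi a * x powi (int k * b)"
  proof (cases "x \<noteq> 0 \<or> a + int k * b \<noteq> 0")
    case True
    then show ?thesis by (rule power_int_add)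
  next
    case False
    then have "x = 0" "0 \<le> a" "a + int k * b = 0" using assms(2) by auto
    moreover have "0 \<le> int k * b" using assms(1) by simp
    ultimately have "a = 0 \<and> int k * b = 0" by linarith
    then show ?thesis by simp
  qed
  ultimately show ?thesis by simp
qed

text \<open>On charts of cones containing \<open>v\<close>, the root subgroup acts by polynomials: expanding
  \<open>(T\<^sub>v + s h)\<^sup>n\<close> yields the characters \<open>u' + k u\<close>, which are still nonnegative on the cone.\<close>

lemma pchar_root_flow_chart:
  assumes u: "demazure_root v u" and \<sigma>: "\<sigma> \<in> \<Sigma>" "v \<in> V \<sigma>" and x: "zeros D x \<subseteq> V \<sigma>"
    and u': "u' \<in> dual \<sigma>"
  shows "pchar u' (root_flow v u s x) =
    (\<Sum>k\<le>nat (pr u' v). of_nat (nat (pr u' v) choose k) * s ^ k * pchar (\<lambda>q. u' q + int k * u q) x)"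
proof -
  have v: "v \<in> vars D" "pr u v = -1" using u by (auto simp: demazure_root_def)
  let ?M = "root_monom v u x" and ?R = "\<Prod>w\<in>vars D - {v}. x w powi pr u' w" and ?n = "nat (pr u' v)"
  have n: "pr u' v = int ?n" using u' \<sigma> by (auto simp: dual_iff)
  have *: "pchar (\<lambda>q. u' q + int k * u q) x = x v ^ (?n - k) * ?R * ?M ^ k" if k: "k \<le> ?n" for k
  proof -
    have "x w powi (pr u' w + int k * pr u w) = x w powi pr u' w * (x w ^ nat (pr u w)) ^ k"
      if w: "w \<in> vars D - {v}" for w
    proof (rule powi_add_nonneg)
      show "0 \<le> pr u w" using u w by (auto simp: demazure_root_def)
      show "x w \<noteq> 0 \<or> 0 \<le> pr u' w" using x w u' \<sigma>(1) by (auto simp: zeros_def dual_iff)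
    qed
    then have "(\<Prod>w\<in>vars D - {v}. x w powi (pr u' w + int k * pr u w)) = ?R * ?M ^ k"
      by (simp add: root_monom_def prod.distrib prod_power_distrib)
    moreover have "pr u' v + int k * pr u v = int (?n - k)" using k n v(2) by simp
    ultimately show ?thesis
      unfolding pchar_remove[OF v(1)] by (simp add: pair_add_left pair_scale_left)
  qed
  have "pchar u' (root_flow v u s x) = (s * ?M + x v) ^ ?n * ?R"
    unfolding pchar_root_flow[OF v(1)] by (subst n) (simp only: power_int_of_nat add.commute)
  also have "\<dots> = (\<Sum>k\<le>?n. of_nat (?n choose k) * (s * ?M) ^ k * x v ^ (?n - k)) * ?R"
    by (simp only: binomial_ring)
  also have "\<dots> = (\<Sum>k\<le>?n. of_nat (?n choose k) * s ^ k * pchar (\<lambda>q. u' q + int k * u q) x)"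
    unfolding sum_distrib_right by (intro sum.cong refl) (simp add: * power_mult_distrib mult_ac)
  finally show ?thesis .
qed

lemma zeros_root_flow_chart:
  assumes "v \<in> V \<sigma>" "zeros D x \<subseteq> V \<sigma>"
  shows "zeros D (root_flow v u s x) \<subseteq> V \<sigma>"
  using assms by (auto simp: zeros_def root_flow_def)

text \<open>Here T_v is nonzero and the root monomial is T_v \<chi>^u, so the shifted coordinate is
  T_v (1 + s \<chi>^u): the flow only rescales T_v by a nonzero factor.\<close>

lemma root_flow_off_chart:
  assumes u: "demazure_root v u" and \<sigma>: "\<sigma> \<in> \<Sigma>" "v \<notin> V \<sigma>" and x: "zeros D x \<subseteq> V \<sigma>"
    and nz: "1 + s * pchar u x \<noteq> 0"
  shows "zeros D (root_flow v u s x) = zeros D x"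
    "pchar u' (root_flow v u s x) = pchar u' x * (1 + s * pchar u x) powi pr u' v"
proof -
  have v: "v \<in> vars D" "pr u v = -1" using u by (auto simp: demazure_root_def)
  have xv: "x v \<noteq> 0" using x \<sigma>(2) v(1) by (auto simp: zeros_def)
  have "(\<Prod>w\<in>vars D - {v}. x w powi pr u w) = root_monom v u x"
    unfolding root_monom_def by (intro prod.cong) (use u in \<open>auto simp: demazure_root_def power_int_def\<close>)
  then have "pchar u x = root_monom v u x / x v"
    unfolding pchar_remove[OF v(1)] v(2) by (simp add: power_int_minus divide_inverse mult.commute)
  then have fv: "x v + s * root_monom v u x = x v * (1 + s * pchar u x)"
    using xv by (simp add: field_simps)
  show "zeros D (root_flow v u s x) = zeros D x"
    using fv xv nz by (auto simp: zeros_def root_flow_def)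
  show "pchar u' (root_flow v u s x) = pchar u' x * (1 + s * pchar u x) powi pr u' v"
    unfolding pchar_root_flow[OF v(1)] fv pchar_remove[OF v(1), of u'] by (simp add: power_int_mult_distrib)
qed

lemma root_dual_off_chart:
  assumes "demazure_root v u" "\<sigma> \<in> \<Sigma>" "v \<notin> V \<sigma>"
  shows "u \<in> dual \<sigma>"
  using assms V_subset_vars by (auto simp: dual_iff demazure_root_def)

lemma root_point_cases:
  assumes u: "demazure_root v u" and z: "z \<in> tpoints"
  obtains (on) \<sigma> where "\<sigma> \<in> \<Sigma>" "v \<in> V \<sigma>" "z \<in> tchart \<sigma>"
    | (off) \<sigma> where "\<sigma> \<in> \<Sigma>" "v \<notin> V \<sigma>" "z \<in> tchart \<sigma>" "snd z u = 0"
proof -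
  have zc: "z \<in> tchart \<sigma> \<longleftrightarrow> fst z \<subseteq> \<sigma>" for \<sigma>
    using z by (auto simp: toric_chart_def)
  then have zz: "z \<in> tchart (fst z)" by simp
  note z' = toric_chart_cases[OF zz]
  show ?thesis
  proof (cases "v \<in> V (fst z)")
    case True
    then show ?thesis using on z'(1) zz by blast
  next
    case v: False
    show ?thesis
    proof (cases "snd z u = 0")
      case True
      then show ?thesis using off z'(1) v zz by blast
    next
      case False
      then have "\<forall>w\<in>V (fst z). pr u w = 0" using z'(5) perp_iff[OF z'(1)] by blast
      then obtain \<sigma> where "\<sigma> \<in> \<Sigma>" "fst z \<subseteq> \<sigma>" "v \<in> V \<sigma>"
        by (rule demazure_root_cone[OF u z'(1) v])
      then show ?thesis using on zc by blast
    qed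
  qed
qed

lemma chart_cox_zeros:
  assumes "x \<in> Zh" "cox x = z" "z \<in> tchart \<sigma>" "\<sigma> \<in> \<Sigma>"
  shows "zeros D x \<subseteq> V \<sigma>" "u \<in> dual \<sigma> \<Longrightarrow> pchar u x = snd z u"
  using assms cox_in_chart_iff snd_cox_chart by auto

text \<open>The point \<open>x\<close> enters the resulting formula only through its image in
  \<open>Z\<close>; hence all points of a fibre have the same image.\<close>

lemma root_flow_on:
  assumes u: "demazure_root v u" and x: "x \<in> Zh"
    and \<sigma>: "\<sigma> \<in> \<Sigma>" "v \<in> V \<sigma>" "cox x \<in> tchart \<sigma>"
  shows "root_flow v u s x \<in> Zh"
    "cox (root_flow v u s x) \<in> tchart \<sigma>"
    "u' \<in> dual \<sigma> \<Longrightarrow> snd (cox (root_flow v u s x)) u' =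
      (\<Sum>k\<le>nat (pr u' v). of_nat (nat (pr u' v) choose k) * s ^ k *
        snd (cox x) (\<lambda>q. u' q + int k * u q))"
proof -
  note x\<sigma> = chart_cox_zeros[OF x refl \<sigma>(3,1)]
  have z: "zeros D (root_flow v u s x) \<subseteq> V \<sigma>" using \<sigma>(2) x\<sigma>(1) by (rule zeros_root_flow_chart)
  show y: "root_flow v u s x \<in> Zh"
    using z \<sigma>(1) x root_flow_Zbar[OF u] by (auto simp: Zhat_iff)
  show "cox (root_flow v u s x) \<in> tchart \<sigma>"
    using cox_in_chart_iff[OF y \<sigma>(1)] z by simp
  assume u': "u' \<in> dual \<sigma>"
  show "snd (cox (root_flow v u s x)) u' =
      (\<Sum>k\<le>nat (pr u' v). of_nat (nat (pr u' v) choose k) * s ^ k *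
        snd (cox x) (\<lambda>q. u' q + int k * u q))"
    unfolding snd_cox_chart[OF y \<sigma>(1) z u'] pchar_root_flow_chart[OF u \<sigma>(1,2) x\<sigma>(1) u']
    by (intro sum.cong refl) (use x\<sigma>(2) root_dual[OF u \<sigma>(1) u' _ \<sigma>(2)] in auto)
qed

lemma root_flow_off:
  assumes u: "demazure_root v u" and x: "x \<in> Zh"
    and \<sigma>: "\<sigma> \<in> \<Sigma>" "v \<notin> V \<sigma>" "cox x \<in> tchart \<sigma>"
    and nz: "1 + s * snd (cox x) u \<noteq> 0"
  shows "root_flow v u s x \<in> Zh"
    "cox (root_flow v u s x) \<in> tchart \<sigma>"
    "u' \<in> dual \<sigma> \<Longrightarrow> snd (cox (root_flow v u s x)) u' =
      snd (cox x) u' * (1 + s * snd (cox x) u) powi pr u' v"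
proof -
  note x\<sigma> = chart_cox_zeros[OF x refl \<sigma>(3,1)]
  note xu = x\<sigma>(2)[OF root_dual_off_chart[OF u \<sigma>(1,2)]]
  have nz': "1 + s * pchar u x \<noteq> 0" using nz xu by simp
  note fl = root_flow_off_chart[OF u \<sigma>(1,2) x\<sigma>(1) nz']
  have z: "zeros D (root_flow v u s x) \<subseteq> V \<sigma>" using fl(1) x\<sigma>(1) by simp
  show y: "root_flow v u s x \<in> Zh"
    using z \<sigma>(1) x root_flow_Zbar[OF u] by (auto simp: Zhat_iff)
  show "cox (root_flow v u s x) \<in> tchart \<sigma>"
    using cox_in_chart_iff[OF y \<sigma>(1)] z by simp
  assume u': "u' \<in> dual \<sigma>"
  show "snd (cox (root_flow v u s x)) u' =
      snd (cox x) u' * (1 + s * snd (cox x) u) powi pr u' v"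
    unfolding snd_cox_chart[OF y \<sigma>(1) z u'] fl(2) xu x\<sigma>(2)[OF u'] ..
qed

lemma root_flow_Zhat:
  assumes "demazure_root v u" "x \<in> Zh"
  shows "root_flow v u s x \<in> Zh"
  using assms(1) cox_in_toric_points[OF assms(2)]
proof (cases rule: root_point_cases)
  case (on \<sigma>)
  then show ?thesis using root_flow_on(1) assms by blast
next
  case (off \<sigma>)
  then show ?thesis using root_flow_off(1)[OF assms off(1-3)] by simp
qed

lemma root_map_cox:
  assumes u: "demazure_root v u" and x: "x \<in> Zh"
  shows "root_map v u s (cox x) = cox (root_flow v u s x)"
  unfolding root_map_def
proof (rule descend_eq[OF x refl], rule conjI)
  fix x' assume x': "x' \<in> Zh" "cox x' = cox x"
  show "root_flow v u s x' \<in> Zh" using u x'(1) by (rule root_flow_Zhat)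
  show "cox (root_flow v u s x') = cox (root_flow v u s x)"
    using u cox_in_toric_points[OF x]
  proof (cases rule: root_point_cases)
    case (on \<sigma>)
    note on' = on(3)[folded x'(2)]
    show ?thesis
      by (rule chart_separated[OF root_flow_on(2)[OF u x'(1) on(1,2) on'] root_flow_on(2)[OF u x on] on(1)])
        (simp add: root_flow_on(3)[OF u x'(1) on(1,2) on'] root_flow_on(3)[OF u x on] x'(2))
  next
    case (off \<sigma>)
    have nz: "1 + s * snd (cox x) u \<noteq> 0" using off(4) by simp
    note off' = off(3)[folded x'(2)] and nz' = nz[folded x'(2)]
    show ?thesis
      by (rule chart_separated[OF root_flow_off(2)[OF u x'(1) off(1,2) off' nz'] root_flow_off(2)[OF u x off(1-3) nz] off(1)])
        (simp add: root_flow_off(3)[OF u x'(1) off(1,2) off' nz'] root_flow_off(3)[OF u x off(1-3) nz] x'(2))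
  qed
qed

text \<open>The formulas of \<open>root_flow_on\<close> and \<open>root_flow_off\<close> hold at
  every point of the respective open set, because each point lifts to \<open>Zhat\<close>;
  regularity can then be read off from them.\<close>

lemma root_map_loc_rational:
  assumes u: "demazure_root v u"
  shows "loc_rational (ZV) (ZV) (root_map v u s)"
proof (rule loc_rationalI[OF mult_closed_Z_var chart_map_id])
  fix z assume "z \<in> points (ZV)"
  then have z: "z \<in> tpoints" by (simp add: points_Z_var)
  have lift: "\<exists>x. x \<in> Zh \<and> y = cox x" if "y \<in> tchart \<sigma>" for y \<sigma>
  proof -
    have "y \<in> tpoints" using that by (auto simp: toric_chart_def)
    then obtain x where "x \<in> Zh" "cox x = y" by (rule cox_surj)
    then show ?thesis by blast
  qed
  show "\<exists>c\<in>ZV. \<exists>c'\<in>ZV. root_map v u s z \<in> fst c' \<and> chart_map c c' (root_map v u s) z"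
    using u z
  proof (cases rule: root_point_cases)
    case (on \<sigma>)
    have im: "root_map v u s y \<in> tchart \<sigma>" if y: "y \<in> tchart \<sigma>" for y
    proof -
      obtain x where x: "x \<in> Zh" "y = cox x" using lift[OF y] by (elim exE conjE)
      show ?thesis
        using root_flow_on(2)[OF u x(1) on(1,2) y[unfolded x(2)]] unfolding x(2) root_map_cox[OF u x(1)] .
    qed
    have "chart_map (chart \<sigma>) (chart \<sigma>) (root_map v u s) z"
    proof (rule chart_mapI[OF on(1,3), where H = "\<lambda>y. 1"])
      fix u' assume u': "u' \<in> dual \<sigma>"
      let ?F = "\<lambda>y. \<Sum>k\<le>nat (pr u' v). of_nat (nat (pr u' v) choose k) * s ^ k * snd y (\<lambda>q. u' q + int k * u q)"
      have "regular \<sigma> ?F"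
        by (intro regular_sum regular_char root_dual[OF u on(1) u' _ on(2)]) simp
      moreover have "snd (root_map v u s y) u' = ?F y / 1 ^ 0" if y: "y \<in> tchart \<sigma>" for y
      proof -
        obtain x where x: "x \<in> Zh" "y = cox x" using lift[OF y] by (elim exE conjE)
        show ?thesis
          using root_flow_on(3)[OF u x(1) on(1,2) y[unfolded x(2)] u']
          unfolding x(2) root_map_cox[OF u x(1)] by simp
      qed
      ultimately show "\<exists>F n. regular \<sigma> F \<and> (\<forall>y\<in>tchart \<sigma>. (1::'k) \<noteq> 0 \<longrightarrow> snd (root_map v u s y) u' = F y / 1 ^ n)"
        by blast
    qed (use im regular_const in auto)
    then show ?thesis
      using on(1) im[OF on(3)] by (intro bexI[of _ "chart \<sigma>"] Z_var_iff[THEN iffD2] bexI[of _ \<sigma>]) simp_all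
  next
    case (off \<sigma>)
    let ?H = "\<lambda>y. 1 + s * snd y u"
    have im: "root_map v u s y \<in> tchart \<sigma>" if y: "y \<in> tchart \<sigma>" "?H y \<noteq> 0" for y
    proof -
      obtain x where x: "x \<in> Zh" "y = cox x" using lift[OF y(1)] by (elim exE conjE)
      show ?thesis
        using root_flow_off(2)[OF u x(1) off(1,2) y[unfolded x(2)]] unfolding x(2) root_map_cox[OF u x(1)] .
    qed
    have "chart_map (chart \<sigma>) (chart \<sigma>) (root_map v u s) z"
    proof (rule chart_mapI[OF off(1,3), where H = ?H])
      show H: "regular \<sigma> ?H"
        using root_dual_off_chart[OF u off(1,2)] by (intro regular_add regular_const regular_char)
      show "?H z \<noteq> 0" using off(4) by simp
      fix u' assume u': "u' \<in> dual \<sigma>"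
      have eq: "snd (root_map v u s y) u' = snd y u' * ?H y powi pr u' v"
        if y: "y \<in> tchart \<sigma>" "?H y \<noteq> 0" for y
      proof -
        obtain x where x: "x \<in> Zh" "y = cox x" using lift[OF y(1)] by (elim exE conjE)
        show ?thesis
          using root_flow_off(3)[OF u x(1) off(1,2) y[unfolded x(2)] u'] unfolding x(2) root_map_cox[OF u x(1)] .
      qed
      \<comment> \<open>The exponent \<open>pr u' v\<close> may have either sign here, so its
        positive part goes into the numerator and its negative part into the denominator.\<close>
      let ?F = "\<lambda>y. (1 * snd y u') * ?H y ^ nat (pr u' v)"
      have "regular \<sigma> ?F" by (intro regular_mult[OF off(1)] regular_char[OF u'] regular_power[OF off(1) H])
      moreover have "snd (root_map v u s y) u' = ?F y / ?H y ^ nat (- pr u' v)"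
        if y: "y \<in> tchart \<sigma>" "?H y \<noteq> 0" for y
        unfolding eq[OF y] by (cases "0 \<le> pr u' v") (simp_all add: power_int_def divide_inverse power_inverse)
      ultimately show "\<exists>F n. regular \<sigma> F \<and> (\<forall>y\<in>tchart \<sigma>. ?H y \<noteq> 0 \<longrightarrow> snd (root_map v u s y) u' = F y / ?H y ^ n)"
        by blast
    qed (use im in auto)
    moreover have "root_map v u s z \<in> tchart \<sigma>" using im[OF off(3)] off(4) by simp
    ultimately show ?thesis
      using off(1) by (intro bexI[of _ "chart \<sigma>"] Z_var_iff[THEN iffD2] bexI[of _ \<sigma>]) simp_all
  qed
qed

lemma root_map_rat_automorphism:
  assumes u: "demazure_root v u"
  shows "rat_automorphism (ZV) (root_map v u s)"
proof -
  have inv: "root_map v u (- t) (root_map v u t z) = z" if "z \<in> points (ZV)" for z t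
  proof -
    have "z \<in> tpoints" using that by (simp add: points_Z_var)
    then obtain x where x: "x \<in> Zh" "cox x = z" by (rule cox_surj)
    have "root_map v u (- t) (root_map v u t z) = cox (root_flow v u (- t) (root_flow v u t x))"
      using root_map_cox[OF u x(1)] root_map_cox[OF u root_flow_Zhat[OF u x(1)]] x(2) by simp
    then show ?thesis by (simp add: root_flow_inverse x(2))
  qed
  show ?thesis unfolding rat_automorphism_def
    using root_map_loc_rational[OF u] inv inv[of _ "- s"]
    by (intro conjI exI[of _ "root_map v u (- s)"]) auto
qed

end

section \<open>Polynomials and derivations\<close>

lemma mpoly_sum_single:
  fixes f :: "'a \<Rightarrow>\<^sub>0 'b::comm_monoid_add"
  shows "(\<Sum>a\<in>keys f. single a (lookup f a)) = f"
proof (rule poly_mapping_eqI)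
  fix k
  have "(\<Sum>a\<in>keys f. if a = k then lookup f a else 0) = lookup f k"
    by (simp add: in_keys_iff)
  then show "lookup (\<Sum>a\<in>keys f. single a (lookup f a)) k = lookup f k"
    by (simp add: lookup_sum lookup_single when_def)
qed

lemma mpoly_induct [case_names zero single add]:
  fixes f :: "'a \<Rightarrow>\<^sub>0 'b::comm_monoid_add"
  assumes "P 0" "\<And>a c. P (single a c)" "\<And>f g. P f \<Longrightarrow> P g \<Longrightarrow> P (f + g)"
  shows "P f"
proof -
  have "P (\<Sum>a\<in>A. single a (lookup f a))" for A
    by (induction A rule: infinite_finite_induct) (auto intro: assms)
  then show ?thesis using mpoly_sum_single[of f] by metis
qed

definition mono_eval :: "(var \<Rightarrow> 'k) \<Rightarrow> (var \<Rightarrow>\<^sub>0 nat) \<Rightarrow> 'k::field" where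
  "mono_eval x a = (\<Prod>w\<in>keys a. x w ^ lookup a w)"

lemma mono_eval_superset:
  assumes "finite S" "keys a \<subseteq> S"
  shows "mono_eval x a = (\<Prod>w\<in>S. x w ^ lookup a w)"
  unfolding mono_eval_def using assms by (intro prod.mono_neutral_left) (auto simp: in_keys_iff)

lemma mono_eval_add: "mono_eval x (a + b) = mono_eval x a * mono_eval x b"
proof -
  let ?S = "keys a \<union> keys b"
  have S: "finite ?S" "keys (a + b) \<subseteq> ?S" using Poly_Mapping.keys_add[of a b] by auto
  show ?thesis
    using S by (simp add: mono_eval_superset[of ?S] lookup_add power_add prod.distrib)
qed

lemma mp_eval_superset:
  assumes "finite S" "keys f \<subseteq> S"
  shows "mp_eval x f = (\<Sum>a\<in>S. lookup f a * mono_eval x a)"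
  unfolding mp_eval_def mono_eval_def using assms by (intro sum.mono_neutral_left) (auto simp: in_keys_iff)

lemma mp_eval_add: "mp_eval x (f + g) = mp_eval x f + mp_eval x g"
proof -
  let ?S = "keys f \<union> keys g"
  have S: "finite ?S" "keys (f + g) \<subseteq> ?S" using Poly_Mapping.keys_add[of f g] by auto
  show ?thesis
    using S by (simp add: mp_eval_superset[of ?S] lookup_add distrib_right sum.distrib)
qed

lemma mp_eval_0: "mp_eval x 0 = 0"
  by (simp add: mp_eval_def)

lemma mp_eval_single: "mp_eval x (single a c) = c * mono_eval x a"
  by (simp add: mp_eval_superset[of "{a}"])

lemma mp_eval_mult: "mp_eval x (f * g) = mp_eval x f * mp_eval x g"
proof (induction f rule: mpoly_induct)
  case (single a c)
  show ?case
  proof (induction g rule: mpoly_induct)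
    case (single b e)
    then show ?case by (simp add: mult_single mp_eval_single mono_eval_add mult_ac)
  qed (simp_all add: mp_eval_0 mp_eval_add distrib_left)
qed (simp_all add: mp_eval_0 mp_eval_add distrib_right)

lemma mp_eval_Const: "mp_eval x (Const c) = c"
  by (simp add: Const_def mp_eval_single mono_eval_def)

lemma mp_eval_1: "mp_eval x 1 = 1"
  using mp_eval_Const[of x 1] by (simp add: Const_def)

lemma mp_eval_Var: "mp_eval x (Var w) = x w"
  by (simp add: Var_def mp_eval_single mono_eval_def)

lemma mp_eval_power: "mp_eval x (f ^ n) = mp_eval x f ^ n"
  by (induction n) (simp_all add: mp_eval_1 mp_eval_mult)

lemma mp_eval_prod: "mp_eval x (\<Prod>i\<in>I. f i) = (\<Prod>i\<in>I. mp_eval x (f i))"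
  by (induction I rule: infinite_finite_induct) (simp_all add: mp_eval_1 mp_eval_mult)

lemma mp_eval_sum: "mp_eval x (\<Sum>i\<in>I. f i) = (\<Sum>i\<in>I. mp_eval x (f i))"
  by (induction I rule: infinite_finite_induct) (simp_all add: mp_eval_0 mp_eval_add)

lemma mp_eval_minus: "mp_eval x (f - g) = mp_eval x f - mp_eval x g"
  using mp_eval_add[of x "f - g" g] by simp

lemmas mp_eval_simps = mp_eval_0 mp_eval_1 mp_eval_add mp_eval_minus mp_eval_mult mp_eval_power
  mp_eval_Const mp_eval_Var mp_eval_prod mp_eval_sum

lemma Const_0: "Const 0 = 0" and Const_1: "Const 1 = 1"
  and Const_add: "Const (a + b) = Const a + Const b"
  and Const_mult: "Const (a * b) = Const a * Const b"
  by (simp_all add: Const_def single_add mult_single)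

lemma Const_of_nat: "Const (of_nat n) = of_nat n"
  by (induction n) (simp_all add: Const_0 Const_1 Const_add)

section \<open>Partial derivatives and derivations\<close>

lemma mp_deriv_superset:
  assumes "finite S" "keys f \<subseteq> S"
  shows "mp_deriv w f = (\<Sum>a\<in>S. single (a - single w 1) (of_nat (lookup a w) * lookup f a))"
  unfolding mp_deriv_def using assms by (intro sum.mono_neutral_left) (auto simp: in_keys_iff)

lemma mp_deriv_add: "mp_deriv w (f + g) = mp_deriv w f + mp_deriv w g"
proof -
  let ?S = "keys f \<union> keys g"
  have S: "finite ?S" "keys (f + g) \<subseteq> ?S" using Poly_Mapping.keys_add[of f g] by auto
  show ?thesis
    using S by (simp add: mp_deriv_superset[of ?S] lookup_add distrib_left single_add sum.distrib)
qed

lemma mp_deriv_0: "mp_deriv w 0 = 0"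
  by (simp add: mp_deriv_def)

lemma mp_deriv_single: "mp_deriv w (single a c) =
    single (a - single w 1) (of_nat (lookup a w) * c)"
  by (simp add: mp_deriv_superset[of "{a}"])

text \<open>Truncated subtraction of exponents commutes with adding exponents unless
  \<open>w\<close> is absent from the monomial, and then the coefficient is 0.\<close>

lemma mp_deriv_mult_single:
  "mp_deriv w (single a c * single b e) =
    mp_deriv w (single a c) * single b e +
    single a c * mp_deriv w (single b e)"
proof -
  let ?e = "single w 1 :: var \<Rightarrow>\<^sub>0 nat"
  have shift: "(a - ?e) + b = a + b - ?e" if "lookup a w \<noteq> 0" for a b :: "var \<Rightarrow>\<^sub>0 nat"
    by (rule poly_mapping_eqI) (use that in \<open>auto simp: lookup_add lookup_minus lookup_single when_def\<close>)
  have 1: "single ((a - ?e) + b) (of_nat (lookup a w) * c * e) =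
      single (a + b - ?e) (of_nat (lookup a w) * c * e)"
    by (metis shift mult_zero_left of_nat_0 single_zero)
  have 2: "single (a + (b - ?e)) (c * (of_nat (lookup b w) * e)) =
      single (a + b - ?e) (c * (of_nat (lookup b w) * e))"
    by (metis shift[of b a] add.commute mult_zero_left mult_zero_right of_nat_0 single_zero)
  show ?thesis
    unfolding mult_single mp_deriv_single 1 2
    by (simp add: lookup_add algebra_simps flip: single_add)
qed

lemma mp_deriv_mult: "mp_deriv w (f * g) = mp_deriv w f * g + f * mp_deriv w g"
proof (induction f rule: mpoly_induct)
  case (single a c)
  show ?case
  proof (induction g rule: mpoly_induct)
    case (single b e)
    show ?case by (rule mp_deriv_mult_single)
  qed (simp_all add: mp_deriv_0 mp_deriv_add algebra_simps)
qed (simp_all add: mp_deriv_0 mp_deriv_add algebra_simps)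

lemma mp_deriv_Const: "mp_deriv w (Const c) = 0"
  by (simp add: Const_def mp_deriv_single)

lemma mp_deriv_Var: "mp_deriv w (Var w') = (if w = w' then 1 else 0)"
  by (auto simp: Var_def mp_deriv_single lookup_single)

lemma mp_deriv_1: "mp_deriv w 1 = 0"
  using mp_deriv_Const[of w 1] by (simp add: Const_1)

lemma mp_deriv_power: "mp_deriv w (f ^ n) = of_nat n * f ^ (n - 1) * mp_deriv w f"
proof (induction n)
  case (Suc n)
  then show ?case by (cases n) (simp_all add: mp_deriv_mult algebra_simps)
qed (simp add: mp_deriv_1)

lemma mp_deriv_prod_zero: "(\<And>i. i \<in> I \<Longrightarrow> mp_deriv w (f i) = 0) \<Longrightarrow> mp_deriv w (\<Prod>i\<in>I. f i) = 0"
  by (induction I rule: infinite_finite_induct) (simp_all add: mp_deriv_1 mp_deriv_mult)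

lemma derivation_mult: "derivation_of V e (f * g) = derivation_of V e f * g + f * derivation_of V e g"
  unfolding derivation_of_def
  by (simp add: mp_deriv_mult distrib_left sum.distrib sum_distrib_left sum_distrib_right mult_ac)

lemma derivation_Const: "derivation_of V e (Const c) = 0"
  by (simp add: derivation_of_def mp_deriv_Const)

lemma derivation_0: "derivation_of V e 0 = 0"
  by (simp add: derivation_of_def mp_deriv_0)

lemma derivation_power: "derivation_of V e (f ^ n) = of_nat n * f ^ (n - 1) * derivation_of V e f"
  unfolding derivation_of_def by (simp add: mp_deriv_power sum_distrib_left mult_ac)

lemma derivation_Var: "finite V \<Longrightarrow> derivation_of V e (Var w) = (if w \<in> V then e w else 0)"
  by (simp add: derivation_of_def mp_deriv_Var if_distrib cong: if_cong)

lemma derivation_prod_zero: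
  "(\<And>i. i \<in> I \<Longrightarrow> derivation_of V e (f i) = 0) \<Longrightarrow> derivation_of V e (\<Prod>i\<in>I. f i) = 0"
proof (induction I rule: infinite_finite_induct)
  case empty
  then show ?case using derivation_Const[of V e 1] by (simp add: Const_1)
next
  case (infinite A)
  then show ?case using derivation_Const[of V e 1] by (simp add: Const_1)
qed (simp_all add: derivation_mult)

section \<open>Exponentials of locally nilpotent derivations\<close>

lemma exp_lnd_finite:
  assumes "\<And>k. (\<delta> ^^ k) f = t k" "\<And>k. n < k \<Longrightarrow> t k = 0"
  shows "exp_lnd s \<delta> f = (\<Sum>k\<le>n. Const (s ^ k / fact k) * t k)"
  unfolding exp_lnd_def assms(1)
  by (rule sum.mono_neutral_left) (use assms(2) in \<open>auto simp: not_less[symmetric]\<close>)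

lemma exp_lnd_zero:
  assumes "\<delta> f = 0" "\<delta> 0 = 0" shows "exp_lnd s \<delta> f = f"
proof -
  have "(\<delta> ^^ k) f = (if k = 0 then f else 0)" for k
    by (induction k) (use assms in auto)
  from exp_lnd_finite[OF this, of 0] show ?thesis by (simp add: Const_1)
qed

lemma exp_lnd_linear:
  assumes "\<delta> f = g" "\<delta> g = 0" "\<delta> 0 = 0" shows "exp_lnd s \<delta> f = f + Const s * g"
proof -
  have "(\<delta> ^^ k) f = (if k = 0 then f else if k = 1 then g else 0)" for k
  proof (induction k)
    case (Suc k)
    then show ?case using assms by (cases k) auto
  qed simp
  from exp_lnd_finite[OF this, of 1] show ?thesis by (simp add: Const_1)
qed

text \<open>With \<open>q\<close> and \<open>m\<close> in the kernel, \<delta> acts on powers of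
  \<open>T\<close> as \<open>q\<close> times the derivative. The k-th iterate carries the falling
  factorial of \<open>l\<close>, that is \<open>(l choose k) * fact k\<close>, and the exponential
  series cancels \<open>fact k\<close>. The power of \<open>q\<close> is one less than k because the
  first application produces \<open>m\<close> instead of \<open>q\<close>.\<close>

lemma exp_lnd_horizontal:
  fixes \<delta> :: "'k mpoly \<Rightarrow> 'k::field_char_0 mpoly"
  assumes \<delta>: "\<delta> = derivation_of V e"
    and T: "\<delta> T = q" "\<delta> q = 0" and m: "\<delta> m = 0"
    and f: "\<delta> f = Const b * of_nat l * T ^ (l - 1) * m"
  shows "exp_lnd s \<delta> f = f + (\<Sum>\<nu> = 1..l. Const (b * of_nat (l choose \<nu>) * s ^ \<nu>) * (T ^ (l - \<nu>) * q ^ (\<nu> - 1) * m))"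
proof -
  define t where "t k = (if k = 0 then f else
    Const b * of_nat ((l choose k) * fact k) * (T ^ (l - k) * q ^ (k - 1) * m))" for k
  have step: "\<delta> (t k) = t (Suc k)" for k
  proof (cases "k = 0")
    case True
    then show ?thesis using f by (simp add: t_def mult_ac)
  next
    case False
    have coeff: "(l choose k) * fact k * (l - k) = (l choose Suc k) * fact (Suc k)"
    proof (cases "k \<le> l")
      case True
      have "Suc k * (l choose Suc k) = (l - k) * (l choose k)"
        by (metis True Suc_times_binomial_eq add_diff_cancel_left' binomial_absorb_comp binomial_absorption diff_Suc_1)
      then have "fact k * ((l - k) * (l choose k)) = fact k * (Suc k * (l choose Suc k))" by simp
      then show ?thesis by (simp only: fact_Suc of_nat_id mult_ac)
    qed (simp add: binomial_eq_0)
    have d: "derivation_of V e (of_nat N) = 0" for N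
      by (simp add: derivation_Const flip: Const_of_nat)
    define N where "N = (l choose k) * fact k"
    have "t k = Const b * of_nat N * (T ^ (l - k) * q ^ (k - 1) * m)"
      using False by (simp add: t_def N_def)
    then have "\<delta> (t k) = Const b * of_nat N * (of_nat (l - k) * T ^ (l - k - 1) * q * q ^ (k - 1) * m)"
      using T m unfolding \<delta> by (simp add: derivation_mult d derivation_Const derivation_power)
    also have "\<dots> = Const b * of_nat (N * (l - k)) * (T ^ (l - Suc k) * (q * q ^ (k - 1)) * m)"
      by (simp add: mult_ac)
    also have "q * q ^ (k - 1) = q ^ k" using False by (cases k) auto
    finally show ?thesis unfolding N_def coeff by (simp add: t_def)
  qed
  have "(\<delta> ^^ k) f = t k" for k
    by (induction k) (simp_all add: step, simp add: t_def)
  moreover have "t k = 0" if "l < k" for k using that by (simp add: t_def binomial_eq_0)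
  ultimately have "exp_lnd s \<delta> f = (\<Sum>k\<le>l. Const (s ^ k / fact k) * t k)" by (rule exp_lnd_finite)
  also have "\<dots> = f + (\<Sum>k = 1..l. Const (s ^ k / fact k) * t k)"
    by (simp add: atMost_atLeast0 sum.atLeast_Suc_atMost t_def Const_1)
  also have "(\<Sum>k = 1..l. Const (s ^ k / fact k) * t k) =
      (\<Sum>\<nu> = 1..l. Const (b * of_nat (l choose \<nu>) * s ^ \<nu>) * (T ^ (l - \<nu>) * q ^ (\<nu> - 1) * m))"
  proof (rule sum.cong)
    fix k assume "k \<in> {1..l}"
    have "Const (s ^ k / fact k) * (Const b * of_nat ((l choose k) * fact k)) =
        Const ((s ^ k / fact k) * (b * of_nat ((l choose k) * fact k)))"
      unfolding Const_mult Const_of_nat ..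
    also have "(s ^ k / fact k) * (b * of_nat ((l choose k) * fact k)) = b * of_nat (l choose k) * s ^ k"
      by simp
    finally show "Const (s ^ k / fact k) * t k = Const (b * of_nat (l choose k) * s ^ k) * (T ^ (l - k) * q ^ (k - 1) * m)"
      using \<open>k \<in> {1..l}\<close> by (simp add: t_def flip: mult.assoc)
  qed simp
  finally show ?thesis .
qed

section \<open>Horizontal roots\<close>

lemma mp_eval_monomial: "mp_eval x (monomial D e) = (\<Prod>w\<in>vars D. x w ^ nat (e w))"
  by (simp add: monomial_def mp_eval_prod mp_eval_power mp_eval_Var)

lemma monomial_cong: "(\<And>w. w \<in> vars D \<Longrightarrow> e w = f w) \<Longrightarrow> monomial D e = monomial D f"
  by (simp add: monomial_def)

lemma monomial_add:
  assumes "\<And>w. w \<in> vars D \<Longrightarrow> 0 \<le> e w" "\<And>w. w \<in> vars D \<Longrightarrow> 0 \<le> f w"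
  shows "monomial D e * monomial D f = monomial D (\<lambda>w. e w + f w)"
  unfolding monomial_def prod.distrib[symmetric]
  by (intro prod.cong refl) (simp add: assms nat_add_distrib power_add)

lemma monomial_zero: "monomial D (\<lambda>w. 0) = 1"
  by (simp add: monomial_def)

lemma monomial_power:
  assumes "\<And>w. w \<in> vars D \<Longrightarrow> 0 \<le> e w"
  shows "monomial D e ^ n = monomial D (\<lambda>w. int n * e w)"
  unfolding monomial_def prod_power_distrib
  by (intro prod.cong refl) (simp add: assms nat_mult_distrib mult.commute flip: power_mult)

lemma Var_power_monomial:
  assumes "v \<in> vars D"
  shows "Var v ^ n = monomial D (\<lambda>w. if w = v then int n else 0)"
proof -
  have "monomial D (\<lambda>w. if w = v then int n else 0) = (\<Prod>w\<in>vars D. if w = v then Var v ^ n else 1)"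
    unfolding monomial_def by (intro prod.cong) auto
  then show ?thesis using assms by (simp add: prod.delta[OF finite_vars[of D]])
qed

lemma monomial_prod:
  assumes "\<And>i w. i \<in> I \<Longrightarrow> w \<in> vars D \<Longrightarrow> 0 \<le> e i w"
  shows "(\<Prod>i\<in>I. monomial D (e i)) = monomial D (\<lambda>w. \<Sum>i\<in>I. e i w)"
  using assms
proof (induction I rule: infinite_finite_induct)
  case (insert i I)
  then show ?case by (simp add: monomial_add sum_nonneg)
qed (simp_all add: monomial_zero)

lemma derivation_monomial_zero:
  assumes "\<And>w. w \<in> vars D \<Longrightarrow> f w = 0 \<or> e w = 0"
  shows "derivation_of (vars D) f (monomial D e) = 0"
  unfolding monomial_def
  by (rule derivation_prod_zero)
    (use assms in \<open>force simp: derivation_power derivation_Var finite_vars\<close>)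

lemma mp_deriv_monomial:
  assumes v: "v \<in> vars D" "0 < e v"
  shows "mp_deriv v (monomial D e) = of_nat (nat (e v)) * monomial D (\<lambda>w. e w - (if w = v then 1 else 0))"
proof -
  let ?R = "\<Prod>w\<in>vars D - {v}. Var w ^ nat (e w)"
  have R: "mp_deriv v ?R = 0"
    by (rule mp_deriv_prod_zero) (auto simp: mp_deriv_power mp_deriv_Var)
  have R': "(\<Prod>w\<in>vars D - {v}. Var w ^ nat (e w - (if w = v then 1 else 0))) = ?R"
    by (intro prod.cong) auto
  have "monomial D e = Var v ^ nat (e v) * ?R"
    unfolding monomial_def using finite_vars v(1) by (rule prod.remove)
  then have "mp_deriv v (monomial D e) = of_nat (nat (e v)) * (Var v ^ (nat (e v) - 1) * ?R)"
    by (simp add: mp_deriv_mult R mp_deriv_power mp_deriv_Var mult_ac)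
  also have "Var v ^ (nat (e v) - 1) * ?R = monomial D (\<lambda>w. e w - (if w = v then 1 else 0))"
  proof -
    have "nat (e v) - 1 = nat (e v - 1)" by linarith
    then show ?thesis unfolding monomial_def prod.remove[OF finite_vars v(1)] R' by simp
  qed
  finally show ?thesis .
qed

lemma Tmonom_monomial:
  assumes "i \<le> rr D"
  shows "Tmonom D i = monomial D (\<lambda>w. case w of Tv a j \<Rightarrow> if a = i then int (lexp D i j) else 0 | Sv k \<Rightarrow> 0)"
proof -
  let ?e = "\<lambda>w. case w of Tv a j \<Rightarrow> if a = i then int (lexp D i j) else 0 | Sv k \<Rightarrow> 0"
  have "monomial D ?e = (\<Prod>w\<in>Tv i ` {1..nn D i}. Var w ^ nat (?e w))"
    unfolding monomial_def
    by (rule prod.mono_neutral_right) (use assms finite_vars in \<open>auto simp: vars_def\<close>)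
  also have "\<dots> = Tmonom D i"
    unfolding Tmonom_def by (subst prod.reindex) (auto intro: inj_onI)
  finally show ?thesis ..
qed

context complete_AP
begin

section \<open>The derivations \<open>delta_u\<close>\<close>

lemma delta_u_root_var:
  assumes "v \<in> vars D"
  shows "delta_u D v u (Var v) = monomial D (\<lambda>w. (if w = v then 1 else 0) + pr u w)"
  using assms by (simp add: delta_u_def derivation_Var finite_vars)

lemma exp_delta_u:
  assumes u: "demazure_root v u"
  shows "exp_lnd s (delta_u D v u) (Var w) = (if w = v then
    Var v + Const s * monomial D (\<lambda>w. (if w = v then 1 else 0) + pr u w) else Var w)"
proof (cases "w = v")
  case True
  have v: "v \<in> vars D" "pr u v = -1" using u by (auto simp: demazure_root_def)
  have "exp_lnd s (delta_u D v u) (Var v) = Var v + Const s * monomial D (\<lambda>w. (if w = v then 1 else 0) + pr u w)"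
  proof (rule exp_lnd_linear)
    show "delta_u D v u (Var v) = monomial D (\<lambda>w. (if w = v then 1 else 0) + pr u w)"
      using v(1) by (rule delta_u_root_var)
    show "delta_u D v u (monomial D (\<lambda>w. (if w = v then 1 else 0) + pr u w)) = 0"
      unfolding delta_u_def by (rule derivation_monomial_zero) (use v in auto)
  qed (simp add: delta_u_def derivation_0)
  then show ?thesis using True by simp
next
  case False
  have "exp_lnd s (delta_u D v u) (Var w) = Var w"
    by (rule exp_lnd_zero) (use False in \<open>simp_all add: delta_u_def derivation_0 derivation_Var finite_vars\<close>)
  then show ?thesis using False by simp
qed

lemma mp_eval_root_monomial:
  assumes u: "demazure_root v u"
  shows "mp_eval x (monomial D (\<lambda>w. (if w = v then 1 else 0) + pr u w)) = root_monom v u x"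
proof -
  have v: "v \<in> vars D" "pr u v = -1" using u by (auto simp: demazure_root_def)
  have "(\<Prod>w\<in>vars D - {v}. x w ^ nat ((if w = v then 1 else 0) + pr u w)) = root_monom v u x"
    unfolding root_monom_def by (intro prod.cong) auto
  then show ?thesis
    unfolding mp_eval_monomial prod.remove[OF finite_vars v(1)] by (simp add: v(2))
qed

text \<open>Off \<open>vars D\<close> the map \<open>flow\<close> is zero while
  \<open>root_flow\<close> keeps the old value; both coincide on \<open>Zbar\<close>.\<close>

lemma flow_delta_u:
  assumes u: "demazure_root v u" and x: "x \<in> Zbar D"
  shows "flow D (delta_u D v u) s x = root_flow v u s x"
proof
  fix w
  have "v \<in> vars D" using u by (simp add: demazure_root_def)
  then show "flow D (delta_u D v u) s x w = root_flow v u s x w"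
    using x by (auto simp: flow_def root_flow_def exp_delta_u[OF u] mp_eval_add mp_eval_mult
        mp_eval_Var mp_eval_Const mp_eval_root_monomial[OF u] Zbar_def)
qed

lemma lambda_u_root_map:
  assumes "demazure_root v u"
  shows "lambda_u D \<Sigma> v u s = root_map v u s"
  unfolding lambda_u_def root_map_def
  by (rule descend_cong) (use flow_delta_u[OF assms] in \<open>auto simp: Zhat_iff\<close>)

section \<open>Pairing columns with the forms \<open>u_form\<close>\<close>

lemma pr_e':
  assumes "w \<in> vars D" "i \<le> rr D"
  shows "pr (e' i) w = (if 1 \<le> i then Pmat D i w else 0)"
proof -
  have "pr (e' i) w = (\<Sum>q = 1..d. if q = i then (if 1 \<le> i then col D w i else 0) else 0)"
    unfolding pair_def by (intro sum.cong) (auto simp: e'_def)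
  then show ?thesis using assms(2) by (auto simp: col_def dimN_def)
qed

text \<open>Every row of \<open>L\<close> contains the entries of - l_0, so they cancel in the
  difference of two rows. If one of the indices is 0, its form is zero and the other row supplies
  l_0 with the right sign.\<close>

lemma pr_e'_Tv:
  assumes "Tv a j \<in> vars D" "i \<le> rr D" "\<iota> \<le> rr D" "i \<noteq> \<iota>"
  shows "pr (e' i) (Tv a j) - pr (e' \<iota>) (Tv a j) =
    (if a = i then int (lexp D a j) else 0) - (if a = \<iota> then int (lexp D a j) else 0)"
proof -
  have a: "a \<le> rr D" "j \<in> {1..nn D a}" using assms(1) by (auto simp: vars_def)
  have P: "Pmat D q (Tv a j) = (if a = 0 then - int (lexp D 0 j) else if a = q then int (lexp D a j) else 0)"
    if "q \<in> {1..rr D}" for q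
    using valid a that unfolding AP_valid_def by blast
  show ?thesis
    unfolding pr_e'[OF assms(1,2)] pr_e'[OF assms(1,3)]
    using assms(2-4) P[of i] P[of \<iota>] by (cases "i = 0"; cases "\<iota> = 0"; cases "a = 0") auto
qed

lemma pr_e'_Sv:
  assumes "Sv k \<in> vars D" "i \<le> rr D"
  shows "pr (e' i) (Sv k) = 0"
proof -
  have k: "k \<in> {1..mm D}" using assms(1) by (auto simp: vars_def)
  have "Pmat D q (Sv k) = 0" if "q \<in> {1..rr D}" for q
    using valid k that unfolding AP_valid_def by blast
  then show ?thesis unfolding pr_e'[OF assms] using assms(2) by auto
qed

lemma pr_u_form: "pr (u_form u i \<nu> \<iota>) w = int \<nu> * pr u w + pr (e' i) w - pr (e' \<iota>) w"
  by (simp add: u_form_def pair_def algebra_simps sum.distrib sum_subtractf sum_distrib_left)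

lemma e'_lattice: "i \<le> rr D \<Longrightarrow> e' i \<in> lattice d"
  by (auto simp: e'_def lattice_def dimN_def)

end

locale horizontal_root = complete_AP D \<Sigma>
  for D :: "'k::{alg_closed_field, field_char_0} AP_data" and \<Sigma> +
  fixes u :: "nat \<Rightarrow> int" and i0 i1 :: nat and c :: "nat \<Rightarrow> nat" and \<beta> :: "nat \<Rightarrow> 'k"
  assumes root: "horizontal_P_root D u i0 i1 c"
    and row_space: "in_row_space D \<beta>" and \<beta>0: "\<beta> i0 = 0" and \<beta>1: "\<beta> i1 = 1"
begin

abbreviation I :: "nat set" where "I \<equiv> {0..rr D} - {i0, i1}"

abbreviation del_k :: "'k mpoly \<Rightarrow> 'k mpoly" where "del_k \<equiv> delta_kappa D \<beta> u i0 i1 c"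

abbreviation lam_k :: "'k \<Rightarrow> 'k tpoint \<Rightarrow> 'k tpoint" where "lam_k \<equiv> lambda_kappa D \<Sigma> \<beta> u i0 i1 c"

abbreviation phi :: "(nat \<times> nat) list \<Rightarrow> 'k \<Rightarrow> 'k tpoint \<Rightarrow> 'k tpoint" where
  "phi \<equiv> phi_u D \<Sigma> \<beta> u i1 c"

abbreviation alph :: "'k \<Rightarrow> nat \<Rightarrow> nat \<Rightarrow> 'k" where "alph \<equiv> alpha D \<beta> i1 c"

abbreviation mon :: "(var \<Rightarrow> int) \<Rightarrow> 'k mpoly" where "mon \<equiv> monomial D"

abbreviation uf :: "nat \<Rightarrow> nat \<Rightarrow> nat \<Rightarrow> int" where "uf \<nu> \<iota> \<equiv> u_form u i1 \<nu> \<iota>"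

abbreviation vc :: "nat \<Rightarrow> var" where "vc i \<equiv> Tv i (c i)"

abbreviation l :: nat where "l \<equiv> lexp D i1 (c i1)"

section \<open>Consequences of the root conditions\<close>

lemma indices: "i0 \<le> rr D" "i1 \<le> rr D" "i0 \<noteq> i1" "u \<in> lattice d"
  using root by (auto simp: horizontal_P_root_def Let_def)

lemma c_range: "i \<le> rr D \<Longrightarrow> c i \<in> {1..nn D i}"
  using root by (auto simp: horizontal_P_root_def Let_def)

lemma vc_vars: "i \<le> rr D \<Longrightarrow> vc i \<in> vars D"
  using c_range by (auto simp: vars_def)

lemma lexp_pos: "Tv i j \<in> vars D \<Longrightarrow> 1 \<le> lexp D i j"
  using valid by (auto simp: AP_valid_def vars_def)

lemma root_values:
  "pr u (vc i1) = -1"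
  "i \<in> I \<Longrightarrow> lexp D i (c i) = 1"
  "i \<in> I \<Longrightarrow> pr u (vc i) = 0"
  "i \<in> I \<Longrightarrow> Tv i j \<in> vars D \<Longrightarrow> j \<noteq> c i \<Longrightarrow> int (lexp D i j) \<le> pr u (Tv i j)"
  "Tv i1 j \<in> vars D \<Longrightarrow> j \<noteq> c i1 \<Longrightarrow> 0 \<le> pr u (Tv i1 j)"
  "Tv i0 j \<in> vars D \<Longrightarrow> 0 \<le> pr u (Tv i0 j)"
  "Sv k \<in> vars D \<Longrightarrow> 0 \<le> pr u (Sv k)"
  using root by (auto simp: horizontal_P_root_def Let_def vars_def)

lemma var_cases [consumes 1, case_names Sv i0 i1 I]:
  assumes "w \<in> vars D"
  obtains k where "w = Sv k"
    | j where "w = Tv i0 j"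
    | j where "w = Tv i1 j"
    | i j where "w = Tv i j" "i \<in> I"
  using assms by (cases w) (auto simp: vars_def)

lemma pr_nonneg:
  assumes "w \<in> vars D" "w \<noteq> vc i1" shows "0 \<le> pr u w"
  using assms(1)
proof (cases rule: var_cases)
  case (I i j)
  then show ?thesis using root_values(3,4)[of i] assms(1) by (cases "j = c i") force+
qed (use assms root_values in auto)

lemma demazure_root_u: "demazure_root (vc i1) u"
  using indices vc_vars root_values(1) pr_nonneg by (auto simp: demazure_root_def)

text \<open>At \<open>vc \<iota>\<close> the form \<open>u\<close> is 0 and the exponent is 1, which
  gives -1. At \<open>vc i1\<close> the value is l - \<nu>, whence the range of \<nu>. At the other
  columns of block \<iota> the value is nonnegative because there \<open>u\<close> is at least the
  exponent, as a horizontal root demands.\<close>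

lemma demazure_root_u_form:
  assumes \<nu>: "\<nu> \<in> {1..l}" and \<iota>: "\<iota> \<in> I"
  shows "demazure_root (vc \<iota>) (uf \<nu> \<iota>)"
  unfolding demazure_root_def
proof (intro conjI ballI)
  have \<iota>': "\<iota> \<le> rr D" "i1 \<noteq> \<iota>" using \<iota> by auto
  show "uf \<nu> \<iota> \<in> lattice d"
    using indices e'_lattice[OF \<iota>'(1)] e'_lattice[OF indices(2)] by (auto simp: u_form_def lattice_def)
  show "vc \<iota> \<in> vars D" using \<iota> vc_vars by auto
  have T: "pr (uf \<nu> \<iota>) (Tv a j) = int \<nu> * pr u (Tv a j) +
      (if a = i1 then int (lexp D a j) else 0) - (if a = \<iota> then int (lexp D a j) else 0)"
    if "Tv a j \<in> vars D" for a j
    using pr_e'_Tv[OF that indices(2) \<iota>'] by (simp add: pr_u_form)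
  show "pr (uf \<nu> \<iota>) (vc \<iota>) = -1"
    using T[OF vc_vars[OF \<iota>'(1)]] root_values(2,3)[OF \<iota>] \<iota>'(2) by simp
  fix w assume w: "w \<in> vars D - {vc \<iota>}"
  then have wv: "w \<in> vars D" by simp
  then show "0 \<le> pr (uf \<nu> \<iota>) w"
  proof (cases rule: var_cases)
    case (Sv k)
    then show ?thesis
      using wv indices(2) \<iota>'(1) root_values(7) by (simp add: pr_u_form pr_e'_Sv)
  next
    case (i0 j)
    then show ?thesis using T[of i0 j] wv indices(3) \<iota> root_values(6)[of j] by auto
  next
    case (i1 j)
    show ?thesis
    proof (cases "j = c i1")
      case True
      then show ?thesis using T[of i1 j] i1 wv \<iota>' root_values(1) \<nu> by auto
    next
      case False
      then show ?thesis using T[of i1 j] i1 wv \<iota>' root_values(5)[of j] by auto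
    qed
  next
    case (I i j)
    show ?thesis
    proof (cases "i = \<iota>")
      case True
      then have "j \<noteq> c \<iota>" using w I by auto
      then have "int (lexp D \<iota> j) \<le> pr u w" using root_values(4)[OF \<iota>, of j] wv I True by auto
      also have "\<dots> \<le> int \<nu> * pr u w"
      proof -
        have "0 \<le> pr u w" using pr_nonneg[OF wv] I(1) True \<iota>'(2) by auto
        then show ?thesis using \<nu> mult_right_mono[of 1 "int \<nu>" "pr u w"] by simp
      qed
      finally show ?thesis using T[of i j] I wv True \<iota>' by auto
    next
      case False
      then show ?thesis using T[of i j] I wv pr_nonneg[OF wv] by auto
    qed
  qed
qed

abbreviation qexp :: "var \<Rightarrow> int" where
  "qexp w \<equiv> (if w = vc i1 then 1 else 0) + pr u w"

text \<open>Exponent vector of the kernel element \<open>m\<close> in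
  \<open>exp_lnd_horizontal\<close>: the monomial of \<open>qexp\<close>, times T_i1 and divided by
  T_\<iota>, each taken without its variable of index \<open>(i, c i)\<close>.\<close>

definition mexp :: "nat \<Rightarrow> var \<Rightarrow> int" where
  "mexp \<iota> w = qexp w + (case w of Tv a j \<Rightarrow>
     (if a = i1 \<and> j \<noteq> c i1 then int (lexp D a j) else 0) - (if a = \<iota> \<and> j \<noteq> c \<iota> then int (lexp D a j) else 0)
   | Sv k \<Rightarrow> 0)"

lemma qexp_nonneg: "w \<in> vars D \<Longrightarrow> 0 \<le> qexp w"
  using pr_nonneg[of w] root_values(1) by auto

lemma mexp_nonneg:
  assumes "w \<in> vars D" "\<iota> \<in> I" shows "0 \<le> mexp \<iota> w"
proof (cases w)
  case (Tv a j)
  show ?thesis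
  proof (cases "a = \<iota> \<and> j \<noteq> c \<iota>")
    case True
    then have "int (lexp D \<iota> j) \<le> pr u w" using root_values(4)[OF assms(2), of j] assms(1) Tv by auto
    then show ?thesis using True Tv assms(2) by (auto simp: mexp_def)
  next
    case False
    then show ?thesis using qexp_nonneg[OF assms(1)] Tv by (auto simp: mexp_def)
  qed
next
  case (Sv k)
  then show ?thesis using qexp_nonneg[OF assms(1)] by (simp add: mexp_def)
qed

lemma qexp_zero: "i \<in> insert i1 I \<Longrightarrow> qexp (vc i) = 0"
  using root_values(1,3) by auto

lemma mexp_zero: "i \<in> insert i1 I \<Longrightarrow> mexp \<iota> (vc i) = 0"
  using qexp_zero[of i] by (auto simp: mexp_def)

text \<open>Such a monomial contains none of the variables moved by the derivation. The variable
  \<open>vc i0\<close> may occur in it, since it is fixed because of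
  \<open>\<beta> i0 = 0\<close>.\<close>

lemma delta_kappa_monomial_zero:
  assumes "\<And>i. i \<in> insert i1 I \<Longrightarrow> e (vc i) = 0"
  shows "del_k (mon e) = 0"
  unfolding delta_kappa_def
proof (rule derivation_monomial_zero)
  fix w assume w: "w \<in> vars D"
  show "delta_kappa_var D \<beta> u i0 i1 c w = 0 \<or> e w = 0"
  proof (cases "\<exists>i\<in>insert i1 I. w = vc i")
    case True
    then show ?thesis using assms by auto
  next
    case False
    then show ?thesis using w \<beta>0 by (cases w) (auto simp: vars_def Const_0)
  qed
qed

text \<open>\<open>bexp k\<close> is the exponent vector of the partial derivative of T_k by its
  variable \<open>vc k\<close>, and \<open>kexp K\<close> that of the product of these over
  \<open>K\<close>.\<close>

abbreviation kexp :: "nat set \<Rightarrow> var \<Rightarrow> int" where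
  "kexp K w \<equiv> (case w of Tv a j \<Rightarrow> if a \<in> K then int (lexp D a j) - (if j = c a then 1 else 0) else 0 | Sv k' \<Rightarrow> 0)"

abbreviation bexp :: "nat \<Rightarrow> var \<Rightarrow> int" where
  "bexp k w \<equiv> (case w of Tv a j \<Rightarrow> if a = k then int (lexp D k j) - (if j = c k then 1 else 0) else 0 | Sv k' \<Rightarrow> 0)"

section \<open>The derivation \<open>delta_kappa\<close> on the variables\<close>

lemma bexp_nonneg: "k \<le> rr D \<Longrightarrow> w \<in> vars D \<Longrightarrow> 0 \<le> bexp k w"
  using lexp_pos by (auto split: var.split)

lemma mp_deriv_Tmonom:
  assumes "k \<le> rr D"
  shows "mp_deriv (vc k) (Tmonom D k) = of_nat (lexp D k (c k)) * mon (bexp k)"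
  unfolding Tmonom_monomial[OF assms]
  using lexp_pos[OF vc_vars[OF assms]]
  by (subst mp_deriv_monomial[OF vc_vars[OF assms]])
    (auto intro!: arg_cong2[of _ _ _ _ "(*)"] monomial_cong split: var.split)

lemma prod_mp_deriv_Tmonom:
  assumes "K \<subseteq> {0..rr D}"
  shows "(\<Prod>k\<in>K. mp_deriv (vc k) (Tmonom D k)) =
    of_nat (\<Prod>k\<in>K. lexp D k (c k)) * mon (\<lambda>w. \<Sum>k\<in>K. bexp k w)"
proof -
  have "(\<Prod>k\<in>K. mp_deriv (vc k) (Tmonom D k)) = (\<Prod>k\<in>K. of_nat (lexp D k (c k)) * mon (bexp k))"
    by (intro prod.cong refl mp_deriv_Tmonom) (use assms in auto)
  also have "\<dots> = of_nat (\<Prod>k\<in>K. lexp D k (c k)) * (\<Prod>k\<in>K. mon (bexp k))"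
    by (simp add: prod.distrib of_nat_prod)
  also have "(\<Prod>k\<in>K. mon (bexp k)) = mon (\<lambda>w. \<Sum>k\<in>K. bexp k w)"
    by (rule monomial_prod) (use assms bexp_nonneg in auto)
  finally show ?thesis .
qed

lemma sum_bexp:
  assumes "finite K"
  shows "(\<Sum>k\<in>K. bexp k w) = kexp K w"
  using assms by (cases w) simp_all

lemma h_exp_nonneg:
  assumes "w \<in> vars D" shows "0 \<le> pr u w - zeta D i0 i1 c w"
  using assms
proof (cases rule: var_cases)
  case (I i j)
  then show ?thesis using root_values(3,4)[of i] assms by (cases "j = c i") auto
next
  case (i1 j)
  then show ?thesis using root_values(1) root_values(5)[of j] assms indices(3) by (cases "j = c i1") auto
qed (use root_values(6,7) assms indices(3) in auto)

lemma delta_kappa_var_eq: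
  assumes "i \<in> insert i1 I"
  shows "delta_kappa_var D \<beta> u i0 i1 c (vc i) =
    Const (\<beta> i) * of_nat (\<Prod>k\<in>{0..rr D} - {i, i0}. lexp D k (c k)) *
      mon (\<lambda>w. pr u w - zeta D i0 i1 c w +
        kexp ({0..rr D} - {i, i0}) w)"
proof -
  let ?K = "{0..rr D} - {i, i0}"
  have "h_quot D u i0 i1 c * mon (\<lambda>w. \<Sum>k\<in>?K. bexp k w) =
      mon (\<lambda>w. (pr u w - zeta D i0 i1 c w) + (\<Sum>k\<in>?K. bexp k w))"
    unfolding h_quot_def
    by (rule monomial_add) (use h_exp_nonneg bexp_nonneg in \<open>auto intro!: sum_nonneg\<close>)
  then have h: "h_quot D u i0 i1 c * mon (\<lambda>w. \<Sum>k\<in>?K. bexp k w) = \<dots>" .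
  have fin: "finite ?K" by simp
  have "delta_kappa_var D \<beta> u i0 i1 c (vc i) =
      Const (\<beta> i) * h_quot D u i0 i1 c * (\<Prod>k\<in>?K. mp_deriv (vc k) (Tmonom D k))" by simp
  also have "\<dots> = Const (\<beta> i) * of_nat (\<Prod>k\<in>?K. lexp D k (c k)) *
      (h_quot D u i0 i1 c * mon (\<lambda>w. \<Sum>k\<in>?K. bexp k w))"
    unfolding prod_mp_deriv_Tmonom[OF Diff_subset] by (simp only: mult_ac)
  finally show ?thesis unfolding h unfolding sum_bexp[OF fin] .
qed

text \<open>For indices in \<open>I\<close> the exponent at \<open>c i\<close> is 1, so each partial
  derivative is T_k without that variable. These are precisely the factors by which h^\<zeta>
  divides, and \<delta>_u of the variable remains.\<close>

lemma delta_kappa_i1: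
  "del_k (Var (vc i1)) = mon qexp"
proof -
  have 1: "(\<Prod>k\<in>{0..rr D} - {i1, i0}. lexp D k (c k)) = 1"
    using root_values(2) by (intro prod.neutral) auto
  have "del_k (Var (vc i1)) = delta_kappa_var D \<beta> u i0 i1 c (vc i1)"
    by (simp only: delta_kappa_def derivation_Var[OF finite_vars] vc_vars[OF indices(2)] if_True)
  also have "\<dots> = mon qexp"
    unfolding delta_kappa_var_eq[OF insertI1] 1 \<beta>1 Const_1 of_nat_1 mult_1
  proof (rule monomial_cong)
    fix w assume w: "w \<in> vars D"
    then show "pr u w - zeta D i0 i1 c w +
        kexp ({0..rr D} - {i1, i0}) w = qexp w"
    proof (cases rule: var_cases)
      case (I i j)
      then show ?thesis using root_values(2)[of i] by auto
    qed (use indices(3) in auto)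
  qed
  finally show ?thesis .
qed

text \<open>Compared with \<open>delta_kappa_i1\<close> the derivative of T_i1 appears in the
  product and that of T_\<iota> is missing. The former yields the coefficient \<open>l\<close>, the
  power \<open>l - 1\<close> and the numerator in \<open>mexp\<close>, the latter leaves the
  denominator there.\<close>

lemma delta_kappa_I:
  assumes \<iota>: "\<iota> \<in> I"
  shows "del_k (Var (vc \<iota>)) =
    Const (\<beta> \<iota>) * of_nat l * Var (vc i1) ^ (l - 1) * mon (mexp \<iota>)"
proof -
  have \<iota>': "\<iota> \<le> rr D" "\<iota> \<noteq> i1" "\<iota> \<noteq> i0" using \<iota> by auto
  have l1: "1 \<le> l" using lexp_pos vc_vars indices(2) by blast
  have "(\<Prod>k\<in>{0..rr D} - {\<iota>, i0}. lexp D k (c k)) = l * (\<Prod>k\<in>{0..rr D} - {\<iota>, i0} - {i1}. lexp D k (c k))"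
    by (rule prod.remove) (use indices \<iota>' in auto)
  also have "(\<Prod>k\<in>{0..rr D} - {\<iota>, i0} - {i1}. lexp D k (c k)) = 1"
    using root_values(2) by (intro prod.neutral) auto
  finally have 1: "(\<Prod>k\<in>{0..rr D} - {\<iota>, i0}. lexp D k (c k)) = l" by simp
  have "del_k (Var (vc \<iota>)) = delta_kappa_var D \<beta> u i0 i1 c (vc \<iota>)"
    by (simp only: delta_kappa_def derivation_Var[OF finite_vars] vc_vars[OF \<iota>'(1)] if_True)
  also have "\<dots> = Const (\<beta> \<iota>) * of_nat l * mon (\<lambda>w. (if w = vc i1 then int (l - 1) else 0) + mexp \<iota> w)"
    unfolding delta_kappa_var_eq[OF insertI2[OF \<iota>]] 1
  proof (intro arg_cong[of _ _ "\<lambda>t. Const (\<beta> \<iota>) * of_nat l * t"] monomial_cong)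
    fix w assume w: "w \<in> vars D"
    then show "pr u w - zeta D i0 i1 c w +
        kexp ({0..rr D} - {\<iota>, i0}) w
      = (if w = vc i1 then int (l - 1) else 0) + mexp \<iota> w"
    proof (cases rule: var_cases)
      case (I i j)
      then show ?thesis using root_values(2)[of i] \<iota>' by (auto simp: mexp_def)
    qed (use indices \<iota>' l1 root_values(1) in \<open>auto simp: mexp_def of_nat_diff\<close>)
  qed
  also have "mon (\<lambda>w. (if w = vc i1 then int (l - 1) else 0) + mexp \<iota> w) =
      Var (vc i1) ^ (l - 1) * mon (mexp \<iota>)"
    unfolding Var_power_monomial[OF vc_vars[OF indices(2)]]
    by (rule monomial_add[symmetric]) (use mexp_nonneg \<iota> in auto)
  finally show ?thesis by (simp only: mult.assoc)
qed

text \<open>Identifies the terms of the exponential with Demazure roots. Multiplying by \<chi>^u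
  replaces one factor \<open>Var (vc i1)\<close> by \<open>mon qexp\<close>, and the difference of
  the two basis forms multiplies by T_i1 and divides by T_\<iota>; one factor
  \<open>mon qexp\<close> is absorbed into \<open>mexp\<close>.\<close>

lemma delta_u_form:
  assumes \<nu>: "\<nu> \<in> {1..l}" and \<iota>: "\<iota> \<in> I"
  shows "mon (\<lambda>w. (if w = vc \<iota> then 1 else 0) + pr (uf \<nu> \<iota>) w) =
    Var (vc i1) ^ (l - \<nu>) * mon qexp ^ (\<nu> - 1) * mon (mexp \<iota>)"
proof -
  have \<iota>': "\<iota> \<le> rr D" "i1 \<noteq> \<iota>" "\<iota> \<noteq> i0" using \<iota> by auto
  have "Var (vc i1) ^ (l - \<nu>) * mon qexp ^ (\<nu> - 1) * mon (mexp \<iota>) =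
      mon (\<lambda>w. ((if w = vc i1 then int (l - \<nu>) else 0) + int (\<nu> - 1) * qexp w) + mexp \<iota> w)"
  proof -
    have q: "mon qexp ^ (\<nu> - 1) = mon (\<lambda>w. int (\<nu> - 1) * qexp w)"
      by (rule monomial_power) (rule qexp_nonneg)
    have n: "0 \<le> int (\<nu> - 1) * qexp w" if "w \<in> vars D" for w
      using qexp_nonneg[OF that] by (intro mult_nonneg_nonneg) auto
    have "mon (\<lambda>w. if w = vc i1 then int (l - \<nu>) else 0) * mon (\<lambda>w. int (\<nu> - 1) * qexp w) =
        mon (\<lambda>w. (if w = vc i1 then int (l - \<nu>) else 0) + int (\<nu> - 1) * qexp w)"
      by (rule monomial_add) (use n in auto)
    moreover have "\<dots> * mon (mexp \<iota>) =
        mon (\<lambda>w. ((if w = vc i1 then int (l - \<nu>) else 0) + int (\<nu> - 1) * qexp w) + mexp \<iota> w)"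
    proof (rule monomial_add)
      show "0 \<le> (if w = vc i1 then int (l - \<nu>) else 0) + int (\<nu> - 1) * qexp w" if "w \<in> vars D" for w
        by (intro add_nonneg_nonneg n[OF that]) simp
    qed (rule mexp_nonneg[OF _ \<iota>])
    ultimately show ?thesis
      unfolding Var_power_monomial[OF vc_vars[OF indices(2)]] q by (simp only:)
  qed
  also have "\<dots> = mon (\<lambda>w. (if w = vc \<iota> then 1 else 0) + pr (uf \<nu> \<iota>) w)"
  proof (rule monomial_cong)
    fix w assume w: "w \<in> vars D"
    have \<nu>': "int (\<nu> - 1) = int \<nu> - 1" "int (l - \<nu>) = int l - int \<nu>" using \<nu> by auto
    show "((if w = vc i1 then int (l - \<nu>) else 0) + int (\<nu> - 1) * qexp w) + mexp \<iota> w =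
        (if w = vc \<iota> then 1 else 0) + pr (uf \<nu> \<iota>) w"
    proof (cases w)
      case (Tv a j)
      have p: "pr (uf \<nu> \<iota>) w = int \<nu> * pr u w +
          (if a = i1 then int (lexp D a j) else 0) - (if a = \<iota> then int (lexp D a j) else 0)"
        using pr_e'_Tv[of a j, OF _ indices(2) \<iota>'(1,2)] w Tv by (simp add: pr_u_form)
      show ?thesis
      proof (cases "w = vc i1")
        case True
        then show ?thesis unfolding p \<nu>' using Tv \<iota>' root_values(1) by (auto simp: mexp_def)
      next
        case False
        then show ?thesis unfolding p \<nu>' using Tv \<iota>' root_values(2,3)[OF \<iota>]
          by (auto simp: mexp_def algebra_simps)
      qed
    next
      case (Sv k)
      then show ?thesis using w indices(2) \<iota>'(1) unfolding \<nu>'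
        by (simp add: mexp_def pr_u_form pr_e'_Sv algebra_simps)
    qed
  qed
  finally show ?thesis by simp
qed

lemma exp_kappa_i1:
  "exp_lnd s (del_k) (Var (vc i1)) = Var (vc i1) + Const s * mon qexp"
proof (rule exp_lnd_linear)
  show "del_k (Var (vc i1)) = mon qexp" by (rule delta_kappa_i1)
  show "del_k (mon qexp) = 0"
    by (rule delta_kappa_monomial_zero) (rule qexp_zero)
qed (simp add: delta_kappa_def derivation_0)

lemma exp_kappa_I:
  assumes \<iota>: "\<iota> \<in> I"
  shows "exp_lnd s (del_k) (Var (vc \<iota>)) = Var (vc \<iota>) +
    (\<Sum>\<nu> = 1..l. Const (alph s \<nu> \<iota>) *
      mon (\<lambda>w. (if w = vc \<iota> then 1 else 0) + pr (uf \<nu> \<iota>) w))"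
proof -
  have "exp_lnd s (del_k) (Var (vc \<iota>)) = Var (vc \<iota>) +
      (\<Sum>\<nu> = 1..l. Const (\<beta> \<iota> * of_nat (l choose \<nu>) * s ^ \<nu>) *
        (Var (vc i1) ^ (l - \<nu>) * mon qexp ^ (\<nu> - 1) * mon (mexp \<iota>)))"
  proof (rule exp_lnd_horizontal[OF delta_kappa_def])
    show "del_k (Var (vc i1)) = mon qexp" by (rule delta_kappa_i1)
    show "del_k (mon qexp) = 0"
      by (rule delta_kappa_monomial_zero) (rule qexp_zero)
    show "del_k (mon (mexp \<iota>)) = 0"
      by (rule delta_kappa_monomial_zero) (rule mexp_zero)
  qed (rule delta_kappa_I[OF \<iota>])
  also have "\<dots> = Var (vc \<iota>) + (\<Sum>\<nu> = 1..l. Const (alph s \<nu> \<iota>) *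
      mon (\<lambda>w. (if w = vc \<iota> then 1 else 0) + pr (uf \<nu> \<iota>) w))"
    by (intro arg_cong2[of _ _ _ _ "(+)"] refl sum.cong) (simp add: delta_u_form[OF _ \<iota>] alpha_def)
  finally show ?thesis .
qed

lemma exp_kappa_other:
  assumes "w \<notin> vc ` insert i1 I"
  shows "exp_lnd s (del_k) (Var w) = Var w"
proof (rule exp_lnd_zero)
  have "delta_kappa_var D \<beta> u i0 i1 c w = 0" if "w \<in> vars D"
    using assms that \<beta>0 by (cases w) (auto simp: vars_def Const_0)
  then show "del_k (Var w) = 0"
    by (simp add: delta_kappa_def derivation_Var[OF finite_vars])
qed (simp add: delta_kappa_def derivation_0)

section \<open>The flow of \<open>delta_kappa\<close> on points\<close>

abbreviation Q :: "(var \<Rightarrow> 'k) \<Rightarrow> 'k" where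
  "Q x \<equiv> root_monom (vc i1) u x"

abbreviation RM :: "nat \<Rightarrow> nat \<Rightarrow> (var \<Rightarrow> 'k) \<Rightarrow> 'k" where
  "RM \<nu> \<iota> x \<equiv> root_monom (vc \<iota>) (uf \<nu> \<iota>) x"

abbreviation kflow :: "'k \<Rightarrow> (var \<Rightarrow> 'k) \<Rightarrow> var \<Rightarrow> 'k" where
  "kflow s \<equiv> flow D (del_k) s"

definition m_eval :: "nat \<Rightarrow> (var \<Rightarrow> 'k) \<Rightarrow> 'k" where
  "m_eval \<iota> x = mp_eval x (mon (mexp \<iota>))"

lemma mp_eval_monomial_cong:
  assumes "\<And>i. i \<in> insert i1 I \<Longrightarrow> e (vc i) = 0" "\<And>w. w \<notin> vc ` insert i1 I \<Longrightarrow> x w = y w"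
  shows "mp_eval x (mon e) = mp_eval y (mon e)"
  unfolding mp_eval_monomial
proof (intro prod.cong refl)
  show "x w ^ nat (e w) = y w ^ nat (e w)" for w
    using assms by (cases "w \<in> vc ` insert i1 I") auto
qed

lemma Q_eval: "Q x = mp_eval x (mon qexp)"
  by (simp only: mp_eval_root_monomial[OF demazure_root_u])

lemma RM_eval:
  assumes "\<nu> \<in> {1..l}" "\<iota> \<in> I"
  shows "RM \<nu> \<iota> x = x (vc i1) ^ (l - \<nu>) * Q x ^ (\<nu> - 1) * m_eval \<iota> x"
  unfolding mp_eval_root_monomial[OF demazure_root_u_form[OF assms], symmetric] delta_u_form[OF assms]
  by (simp only: mp_eval_mult mp_eval_power mp_eval_Var m_eval_def Q_eval)

lemma kflow_i1: "kflow s x (vc i1) = x (vc i1) + s * Q x"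
  by (simp only: flow_def vc_vars[OF indices(2)] if_True exp_kappa_i1 mp_eval_add mp_eval_mult
      mp_eval_Var mp_eval_Const Q_eval)

lemma kflow_I:
  assumes \<iota>: "\<iota> \<in> I"
  shows "kflow s x (vc \<iota>) = x (vc \<iota>) + (\<Sum>\<nu> = 1..l. alph s \<nu> \<iota> * RM \<nu> \<iota> x)"
proof -
  have "vc \<iota> \<in> vars D" using \<iota> vc_vars by auto
  then have "kflow s x (vc \<iota>) = x (vc \<iota>) + (\<Sum>\<nu> = 1..l. alph s \<nu> \<iota> *
      mp_eval x (mon (\<lambda>w. (if w = vc \<iota> then 1 else 0) + pr (uf \<nu> \<iota>) w)))"
    by (simp only: flow_def if_True exp_kappa_I[OF \<iota>] mp_eval_add mp_eval_mult mp_eval_sum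
        mp_eval_Var mp_eval_Const)
  also have "\<dots> = x (vc \<iota>) + (\<Sum>\<nu> = 1..l. alph s \<nu> \<iota> * RM \<nu> \<iota> x)"
    by (intro arg_cong2[of _ _ _ _ "(+)"] refl sum.cong)
      (simp only: mp_eval_root_monomial[OF demazure_root_u_form[OF _ \<iota>]])
  finally show ?thesis .
qed

lemma kflow_other:
  assumes "x \<in> Zbar D" "w \<notin> vc ` insert i1 I"
  shows "kflow s x w = x w"
proof (cases "w \<in> vars D")
  case True
  then show ?thesis by (simp only: flow_def if_True exp_kappa_other[OF assms(2)] mp_eval_Var)
qed (use assms(1) in \<open>auto simp: flow_def Zbar_def\<close>)

lemma kflow_Zbar: "kflow s x \<in> Zbar D"
  by (auto simp: flow_def Zbar_def)

lemma Q_kflow: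
  assumes "x \<in> Zbar D" shows "Q (kflow s x) = Q x"
  unfolding Q_eval by (rule mp_eval_monomial_cong) (use qexp_zero kflow_other[OF assms] in auto)

lemma m_kflow:
  assumes "x \<in> Zbar D" shows "m_eval \<iota> (kflow s x) = m_eval \<iota> x"
  unfolding m_eval_def by (rule mp_eval_monomial_cong) (use mexp_zero kflow_other[OF assms] in auto)

text \<open>The quotient of (t + s q)^l - t^l by \<open>q\<close>, written as a polynomial so that
  it makes sense at q = 0.\<close>

definition binom_shift :: "'k \<Rightarrow> 'k \<Rightarrow> 'k \<Rightarrow> 'k" where
  "binom_shift s t q = (\<Sum>\<nu> = 1..l. of_nat (l choose \<nu>) * s ^ \<nu> * t ^ (l - \<nu>) * q ^ (\<nu> - 1))"

lemma binom_shift_mult: "binom_shift s t q * q = (t + s * q) ^ l - t ^ l"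
proof -
  have "(t + s * q) ^ l = (\<Sum>\<nu>\<le>l. of_nat (l choose \<nu>) * (s * q) ^ \<nu> * t ^ (l - \<nu>))"
    using binomial_ring[of "s * q" t l] by (simp only: add.commute)
  also have "\<dots> = t ^ l + (\<Sum>\<nu> = 1..l. of_nat (l choose \<nu>) * (s * q) ^ \<nu> * t ^ (l - \<nu>))"
    by (simp add: atMost_atLeast0 sum.atLeast_Suc_atMost)
  also have "(\<Sum>\<nu> = 1..l. of_nat (l choose \<nu>) * (s * q) ^ \<nu> * t ^ (l - \<nu>)) = binom_shift s t q * q"
    unfolding binom_shift_def sum_distrib_right
  proof (intro sum.cong refl)
    fix \<nu> assume "\<nu> \<in> {1..l}"
    then have "q ^ \<nu> = q ^ (\<nu> - 1) * q" by (cases \<nu>) auto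
    then show "of_nat (l choose \<nu>) * (s * q) ^ \<nu> * t ^ (l - \<nu>) =
        of_nat (l choose \<nu>) * s ^ \<nu> * t ^ (l - \<nu>) * q ^ (\<nu> - 1) * q"
      by (simp add: power_mult_distrib mult_ac)
  qed
  finally show ?thesis by simp
qed

text \<open>For nonzero \<open>q\<close> this is the telescoping of \<open>binom_shift_mult\<close>
  with \<open>q\<close> cancelled. At q = 0 only the term with \<nu> = 1 survives, and it is linear
  in \<open>s\<close>.\<close>

lemma binom_shift_inverse: "binom_shift s t q + binom_shift (- s) (t + s * q) q = 0"
proof (cases "q = 0")
  case True
  have l1: "1 \<in> {1..l}" using lexp_pos vc_vars indices(2) by simp
  have "binom_shift s t 0 = (\<Sum>\<nu>\<in>{1}. of_nat (l choose \<nu>) * s ^ \<nu> * t ^ (l - \<nu>) * 0 ^ (\<nu> - 1))" for s t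
    unfolding binom_shift_def by (rule sum.mono_neutral_right) (use l1 in auto)
  then show ?thesis using True by simp
next
  case False
  have "(binom_shift s t q + binom_shift (- s) (t + s * q) q) * q = 0"
    unfolding distrib_right binom_shift_mult by simp
  then show ?thesis using False by simp
qed

lemma kflow_I':
  assumes \<iota>: "\<iota> \<in> I"
  shows "kflow s x (vc \<iota>) = x (vc \<iota>) + \<beta> \<iota> * binom_shift s (x (vc i1)) (Q x) * m_eval \<iota> x"
  unfolding kflow_I[OF \<iota>] binom_shift_def sum_distrib_left sum_distrib_right
  by (intro arg_cong2[of _ _ _ _ "(+)"] refl sum.cong) (simp add: RM_eval[OF _ \<iota>] alpha_def mult_ac)

lemma kflow_inverse:
  assumes x: "x \<in> Zbar D"
  shows "kflow (- s) (kflow s x) = x"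
proof
  fix w
  note y = kflow_Zbar[of s x]
  show "kflow (- s) (kflow s x) w = x w"
  proof (cases "w \<in> vc ` insert i1 I")
    case False
    then show ?thesis using kflow_other[OF y] kflow_other[OF x] by simp
  next
    case True
    then consider "w = vc i1" | \<iota> where "\<iota> \<in> I" "w = vc \<iota>" by blast
    then show ?thesis
    proof cases
      case 1
      then show ?thesis by (simp only: kflow_i1 Q_kflow[OF x]) simp
    next
      case (2 \<iota>)
      have "kflow (- s) (kflow s x) (vc \<iota>) = x (vc \<iota>) +
          \<beta> \<iota> * (binom_shift s (x (vc i1)) (Q x) + binom_shift (- s) (x (vc i1) + s * Q x) (Q x)) * m_eval \<iota> x"
        by (simp only: kflow_I'[OF 2(1)] kflow_i1 Q_kflow[OF x] m_kflow[OF x])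
          (simp add: algebra_simps)
      then show ?thesis unfolding binom_shift_inverse using 2 by simp
    qed
  qed
qed

section \<open>Factorisation of the flow into root flows\<close>

definition phi_flow :: "(nat \<times> nat) list \<Rightarrow> 'k \<Rightarrow> (var \<Rightarrow> 'k) \<Rightarrow> var \<Rightarrow> 'k" where
  "phi_flow ps s = foldr (\<lambda>(\<nu>, \<iota>) F.
     root_flow (vc \<iota>) (uf \<nu> \<iota>) (alph s \<nu> \<iota>) \<circ> F) ps id"

text \<open>The monomials of the roots \<open>uf \<nu> \<iota>\<close> involve none of the variables
  that the root flows of this family move. This is why these flows commute.\<close>

lemma RM_cong:
  assumes "\<nu> \<in> {1..l}" "\<iota> \<in> I" "\<And>w. w \<notin> vc ` I \<Longrightarrow> x w = y w"
  shows "RM \<nu> \<iota> x = RM \<nu> \<iota> y"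
proof -
  have "x (vc i1) = y (vc i1)" by (rule assms(3)) auto
  moreover have "Q x = Q y" unfolding Q_eval
    by (rule mp_eval_monomial_cong, erule qexp_zero) (use assms(3) in auto)
  moreover have "m_eval \<iota> x = m_eval \<iota> y" unfolding m_eval_def
    by (rule mp_eval_monomial_cong, erule mexp_zero) (use assms(3) in auto)
  ultimately show ?thesis unfolding RM_eval[OF assms(1,2)] by (simp only:)
qed

text \<open>By \<open>RM_cong\<close> every factor adds a shift evaluated at the original point. The
  total depends only on the set of pairs, and distinctness ensures that none is counted
  twice.\<close>

lemma phi_flow_eq:
  assumes "distinct ps" "set ps \<subseteq> {1..l} \<times> I"
  shows "phi_flow ps s x w = x w +
    (\<Sum>(\<nu>, \<iota>)\<in>set ps. if w = vc \<iota> then alph s \<nu> \<iota> * RM \<nu> \<iota> x else 0)"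
  using assms
proof (induction ps arbitrary: w)
  case Nil
  then show ?case by (simp add: phi_flow_def)
next
  case (Cons p ps)
  obtain \<nu> \<iota> where p: "p = (\<nu>, \<iota>)" by (cases p)
  have \<nu>\<iota>: "\<nu> \<in> {1..l}" "\<iota> \<in> I" using Cons.prems(2) p by auto
  have IH: "phi_flow ps s x w = x w +
    (\<Sum>(\<nu>, \<iota>)\<in>set ps. if w = vc \<iota> then alph s \<nu> \<iota> * RM \<nu> \<iota> x else 0)" for w
    using Cons by simp
  have "RM \<nu> \<iota> (phi_flow ps s x) = RM \<nu> \<iota> x"
  proof (rule RM_cong[OF \<nu>\<iota>])
    show "phi_flow ps s x w = x w" if "w \<notin> vc ` I" for w
      using that
    proof -
      assume w: "w \<notin> vc ` I"
      have "(\<Sum>(\<nu>, \<iota>)\<in>set ps. if w = vc \<iota> then alph s \<nu> \<iota> * RM \<nu> \<iota> x else 0) = 0"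
      proof (intro sum.neutral ballI)
        fix p' assume "p' \<in> set ps"
        then have "snd p' \<in> I" using Cons.prems(2) by auto
        then have "w \<noteq> vc (snd p')" using w by blast
        then show "(case p' of (\<nu>, \<iota>) \<Rightarrow> if w = vc \<iota> then alph s \<nu> \<iota> * RM \<nu> \<iota> x else 0) = 0"
          by (simp add: case_prod_beta)
      qed
      then show "phi_flow ps s x w = x w" unfolding IH by simp
    qed
  qed
  moreover have "phi_flow (p # ps) s x =
      root_flow (vc \<iota>) (uf \<nu> \<iota>) (alph s \<nu> \<iota>) (phi_flow ps s x)"
    by (simp add: phi_flow_def p)
  ultimately have "phi_flow (p # ps) s x w = phi_flow ps s x w +
      (if w = vc \<iota> then alph s \<nu> \<iota> * RM \<nu> \<iota> x else 0)"
    by (simp add: root_flow_def)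
  moreover have "p \<notin> set ps" using Cons.prems(1) by simp
  ultimately show ?case by (simp add: IH p add_ac)
qed

context
  fixes ps :: "(nat \<times> nat) list"
  assumes ps: "distinct ps" "set ps = {1..l} \<times> I"
begin

text \<open>On points \<open>phi_flow\<close> has to act first, as its monomials contain the
  coordinate at \<open>vc i1\<close> before the shift. It leaves that coordinate and
  \<open>Q\<close> unchanged, so the final shift is the one prescribed at \<open>x\<close>.\<close>

lemma kflow_decomposition:
  assumes x: "x \<in> Zbar D"
  shows "kflow s x = root_flow (vc i1) u s (phi_flow ps s x)"
proof
  fix w
  have sub: "set ps \<subseteq> {1..l} \<times> I" using ps by simp
  have phi: "phi_flow ps s x w = x w + (\<Sum>\<iota>\<in>I. if w = vc \<iota> then (\<Sum>\<nu> = 1..l. alph s \<nu> \<iota> * RM \<nu> \<iota> x) else 0)" for w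
  proof -
    have "(\<Sum>(\<nu>, \<iota>)\<in>{1..l} \<times> I. if w = vc \<iota> then alph s \<nu> \<iota> * RM \<nu> \<iota> x else 0) =
        (\<Sum>\<iota>\<in>I. \<Sum>\<nu> = 1..l. if w = vc \<iota> then alph s \<nu> \<iota> * RM \<nu> \<iota> x else 0)"
      unfolding sum.cartesian_product[symmetric] by (rule sum.swap)
    also have "\<dots> = (\<Sum>\<iota>\<in>I. if w = vc \<iota> then (\<Sum>\<nu> = 1..l. alph s \<nu> \<iota> * RM \<nu> \<iota> x) else 0)"
      by (intro sum.cong refl) simp
    finally show ?thesis unfolding phi_flow_eq[OF ps(1) sub] ps(2) by (simp only:)
  qed
  have phi_off: "phi_flow ps s x w = x w" if "w \<notin> vc ` I" for w
  proof -
    have "(\<Sum>\<iota>\<in>I. if w = vc \<iota> then (\<Sum>\<nu> = 1..l. alph s \<nu> \<iota> * RM \<nu> \<iota> x) else 0) = 0"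
      by (intro sum.neutral ballI if_not_P) (use that in blast)
    then show ?thesis unfolding phi by simp
  qed
  have Qphi: "Q (phi_flow ps s x) = Q x"
    unfolding Q_eval by (rule mp_eval_monomial_cong, erule qexp_zero) (use phi_off in auto)
  have R: "root_flow (vc i1) u s (phi_flow ps s x) w =
      phi_flow ps s x w + (if w = vc i1 then s * Q x else 0)" for w
    by (simp add: root_flow_def Qphi)
  show "kflow s x w = root_flow (vc i1) u s (phi_flow ps s x) w"
  proof (cases "w \<in> vc ` insert i1 I")
    case False
    then have "w \<noteq> vc i1" "w \<notin> vc ` I" by auto
    then show ?thesis unfolding R using kflow_other[OF x False] phi_off[of w] by simp
  next
    case True
    then consider "w = vc i1" | \<iota> where "\<iota> \<in> I" "w = vc \<iota>" by blast
    then show ?thesis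
    proof cases
      case 1
      have "w \<notin> vc ` I" using 1 by auto
      then show ?thesis unfolding R using phi_off[of w] kflow_i1[of s x] 1 by simp
    next
      case (2 \<iota>)
      have "(\<Sum>\<iota>'\<in>I. if w = vc \<iota>' then (\<Sum>\<nu> = 1..l. alph s \<nu> \<iota>' * RM \<nu> \<iota>' x) else 0) =
          (\<Sum>\<iota>'\<in>I. if \<iota>' = \<iota> then (\<Sum>\<nu> = 1..l. alph s \<nu> \<iota>' * RM \<nu> \<iota>' x) else 0)"
        unfolding 2(2) by (intro sum.cong refl) auto
      also have "\<dots> = (\<Sum>\<nu> = 1..l. alph s \<nu> \<iota> * RM \<nu> \<iota> x)"
        using 2(1) by simp
      finally have "phi_flow ps s x w = kflow s x (vc \<iota>)"
        unfolding phi kflow_I[OF 2(1)] 2(2) by simp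
      moreover have "w \<noteq> vc i1" using 2 by auto
      ultimately show ?thesis unfolding R using 2(2) by simp
    qed
  qed
qed

end

section \<open>Descent of the factors to \<open>Z\<close>\<close>

lemma phi_flow_cox:
  assumes "set qs \<subseteq> {1..l} \<times> I" "x \<in> Zh"
  shows "phi_flow qs s x \<in> Zh \<and>
    phi qs s (cox x) = cox (phi_flow qs s x)"
  using assms(1)
proof (induction qs)
  case Nil
  then show ?case using assms(2) by (simp add: phi_flow_def phi_u_def)
next
  case (Cons p qs)
  obtain \<nu> \<iota> where p: "p = (\<nu>, \<iota>)" by (cases p)
  have r: "demazure_root (vc \<iota>) (uf \<nu> \<iota>)"
    using Cons.prems p by (intro demazure_root_u_form) auto
  have IH: "phi_flow qs s x \<in> Zh"
    "phi qs s (cox x) = cox (phi_flow qs s x)"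
    using Cons by auto
  have 1: "phi_flow (p # qs) s x =
      root_flow (vc \<iota>) (uf \<nu> \<iota>) (alph s \<nu> \<iota>) (phi_flow qs s x)"
    by (simp add: phi_flow_def p)
  have 2: "phi (p # qs) s z =
      root_map (vc \<iota>) (uf \<nu> \<iota>) (alph s \<nu> \<iota>) (phi qs s z)" for z
    by (simp add: phi_u_def p lambda_u_root_map[OF r])
  show ?case unfolding 1 2 IH(2)
    using root_flow_Zhat[OF r IH(1)] root_map_cox[OF r IH(1)] by simp
qed

lemma phi_u_rat_automorphism:
  assumes "set qs \<subseteq> {1..l} \<times> I"
  shows "rat_automorphism (ZV) (phi qs s)"
  using assms
proof (induction qs)
  case Nil
  then show ?case using rat_automorphism_id by (simp add: phi_u_def id_def)
next
  case (Cons p qs)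
  obtain \<nu> \<iota> where p: "p = (\<nu>, \<iota>)" by (cases p)
  have r: "demazure_root (vc \<iota>) (uf \<nu> \<iota>)"
    using Cons.prems p by (intro demazure_root_u_form) auto
  have eq: "phi (p # qs) s =
      root_map (vc \<iota>) (uf \<nu> \<iota>) (alph s \<nu> \<iota>) \<circ> phi qs s"
    by (simp add: phi_u_def p lambda_u_root_map[OF r])
  have IH: "rat_automorphism (ZV) (phi qs s)" using Cons by simp
  show ?case unfolding eq
    by (rule rat_automorphism_comp[OF mult_closed_Z_var IH root_map_rat_automorphism[OF r]])
qed

section \<open>Invariance of \<open>Xbar\<close>\<close>

lemma mp_eval_Tmonom:
  assumes "i \<le> rr D"
  shows "mp_eval x (Tmonom D i) = x (vc i) ^ lexp D i (c i) * (\<Prod>j\<in>{1..nn D i} - {c i}. x (Tv i j) ^ lexp D i j)"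
  unfolding Tmonom_def mp_eval_prod mp_eval_power mp_eval_Var
  by (rule prod.remove) (use c_range[OF assms] in auto)

definition cofactor :: "nat \<Rightarrow> (var \<Rightarrow> 'k) \<Rightarrow> 'k" where
  "cofactor i x = (\<Prod>j\<in>{1..nn D i} - {c i}. x (Tv i j) ^ lexp D i j)"

lemma cofactor_monomial:
  assumes "i \<le> rr D"
  shows "cofactor i x = mp_eval x (mon (\<lambda>w. case w of Tv a j \<Rightarrow> if a = i \<and> j \<noteq> c i then int (lexp D a j) else 0 | Sv k \<Rightarrow> 0))"
    (is "_ = mp_eval x (mon ?e)")
proof -
  have "mp_eval x (mon ?e) = (\<Prod>w\<in>Tv i ` ({1..nn D i} - {c i}). x w ^ nat (?e w))"
    unfolding mp_eval_monomial
    by (rule prod.mono_neutral_right) (use assms finite_vars in \<open>auto simp: vars_def\<close>)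
  also have "\<dots> = cofactor i x"
    unfolding cofactor_def by (subst prod.reindex) (auto intro: inj_onI)
  finally show ?thesis ..
qed

text \<open>Converts the shift of the coordinate at \<open>vc \<iota>\<close>, a multiple of
  m_\<iota>, into a shift of T_\<iota> by a multiple of a quantity that no longer depends on
  \<iota>.\<close>

lemma m_cofactor:
  assumes \<iota>: "\<iota> \<in> I"
  shows "m_eval \<iota> x * cofactor \<iota> x = Q x * cofactor i1 x"
proof -
  have \<iota>': "\<iota> \<le> rr D" "\<iota> \<noteq> i1" using \<iota> by auto
  let ?e = "\<lambda>i w. case w of Tv a j \<Rightarrow> if a = i \<and> j \<noteq> c i then int (lexp D a j) else 0 | Sv k \<Rightarrow> 0"
  have e: "0 \<le> ?e i w" for i w by (simp split: var.split)
  have "mon (mexp \<iota>) * mon (?e \<iota>) = mon (\<lambda>w. mexp \<iota> w + ?e \<iota> w)"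
    by (rule monomial_add) (use mexp_nonneg \<iota> e in auto)
  also have "\<dots> = mon (\<lambda>w. qexp w + ?e i1 w)"
    by (rule monomial_cong) (use \<iota>'(2) in \<open>auto simp: mexp_def split: var.split\<close>)
  also have "\<dots> = mon qexp * mon (?e i1)"
    by (rule monomial_add[symmetric]) (use qexp_nonneg e in auto)
  finally have "mp_eval x (mon (mexp \<iota>) * mon (?e \<iota>)) = mp_eval x (mon qexp * mon (?e i1))"
    by (rule arg_cong)
  then show ?thesis
    unfolding mp_eval_mult cofactor_monomial[OF \<iota>'(1)] cofactor_monomial[OF indices(2)] m_eval_def Q_eval .
qed

text \<open>The flow moves the vector of the monomials \<open>T\<^sub>i\<close> in the direction of \<open>\<beta>\<close>, which lies in the row
  space of \<open>A\<close>; therefore the determinants \<open>g\<^sub>I\<close> do not change.\<close>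

lemma Tmonom_kflow:
  assumes x: "x \<in> Zbar D" and i: "i \<le> rr D"
  shows "mp_eval (kflow s x) (Tmonom D i) = mp_eval x (Tmonom D i) +
    \<beta> i * (((x (vc i1) + s * Q x) ^ l - x (vc i1) ^ l) * cofactor i1 x)"
proof -
  note T = mp_eval_Tmonom[OF i, folded cofactor_def]
  have cof: "cofactor i (kflow s x) = cofactor i x"
    unfolding cofactor_def
  proof (intro prod.cong refl)
    fix j assume "j \<in> {1..nn D i} - {c i}"
    then have "Tv i j \<notin> vc ` insert i1 I" by auto
    then show "kflow s x (Tv i j) ^ lexp D i j = x (Tv i j) ^ lexp D i j"
      using kflow_other[OF x] by simp
  qed
  consider "i = i0" | "i = i1" | "i \<in> I" using i by auto
  then show ?thesis
  proof cases
    case 1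
    then have "kflow s x (vc i) = x (vc i)" using indices(3) by (intro kflow_other[OF x]) auto
    then show ?thesis unfolding T cof using 1 \<beta>0 by simp
  next
    case 2
    then show ?thesis unfolding T cof using kflow_i1[of s x] \<beta>1 by (simp add: algebra_simps)
  next
    case 3
    have "m_eval i x * cofactor i x = Q x * cofactor i1 x" using 3 by (rule m_cofactor)
    then have "binom_shift s (x (vc i1)) (Q x) * m_eval i x * cofactor i x =
        (binom_shift s (x (vc i1)) (Q x) * Q x) * cofactor i1 x" by (simp add: mult_ac)
    then have "\<beta> i * binom_shift s (x (vc i1)) (Q x) * m_eval i x * cofactor i x =
        \<beta> i * (((x (vc i1) + s * Q x) ^ l - x (vc i1) ^ l) * cofactor i1 x)"
      unfolding binom_shift_mult by (simp add: mult_ac)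
    then show ?thesis
      unfolding T cof kflow_I'[OF 3] using root_values(2)[OF 3] by (simp add: algebra_simps)
  qed
qed

lemma g_poly_eval:
  "mp_eval x (g_poly D a b e) =
    mp_eval x (Tmonom D a) * (Amat D 0 b * Amat D 1 e - Amat D 0 e * Amat D 1 b)
    - mp_eval x (Tmonom D b) * (Amat D 0 a * Amat D 1 e - Amat D 0 e * Amat D 1 a)
    + mp_eval x (Tmonom D e) * (Amat D 0 a * Amat D 1 b - Amat D 0 b * Amat D 1 a)"
  unfolding g_poly_def det_3 by (simp add: mp_eval_simps algebra_simps)

lemma kflow_Xbar:
  assumes x: "x \<in> Xbar D"
  shows "kflow s x \<in> Xbar D"
proof -
  have xZ: "x \<in> Zbar D" using x by (simp add: Xbar_def)
  obtain b b' where \<beta>: "\<And>i. i \<le> rr D \<Longrightarrow> \<beta> i = b * Amat D 0 i + b' * Amat D 1 i"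
    using row_space unfolding in_row_space_def by blast
  have "mp_eval (kflow s x) (g_poly D j1 j2 j3) = 0"
    if j: "j1 < j2" "j2 < j3" "j3 \<le> rr D" for j1 j2 j3
  proof -
    have r: "j1 \<le> rr D" "j2 \<le> rr D" "j3 \<le> rr D" using j by auto
    have "mp_eval (kflow s x) (g_poly D j1 j2 j3) = mp_eval x (g_poly D j1 j2 j3)"
      unfolding g_poly_eval Tmonom_kflow[OF xZ r(1)] Tmonom_kflow[OF xZ r(2)]
        Tmonom_kflow[OF xZ r(3)] \<beta>[OF r(1)] \<beta>[OF r(2)] \<beta>[OF r(3)]
      by (simp add: algebra_simps)
    also have "\<dots> = 0" using x j unfolding Xbar_def by blast
    finally show ?thesis .
  qed
  then show ?thesis using kflow_Zbar by (simp add: Xbar_def)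
qed

context
  fixes ps :: "(nat \<times> nat) list"
  assumes ps: "distinct ps" "set ps = {1..l} \<times> I"
begin

abbreviation ext :: "'k \<Rightarrow> 'k tpoint \<Rightarrow> 'k tpoint" where
  "ext s \<equiv> lambda_u D \<Sigma> (vc i1) u s \<circ> phi ps s"

section \<open>Descent of the flow to \<open>Z\<close> and \<open>X\<close>\<close>

lemma kflow_cox:
  assumes x: "x \<in> Zh"
  shows "kflow s x \<in> Zh"
    "ext s (cox x) = cox (kflow s x)"
proof -
  have phi: "phi_flow ps s x \<in> Zh"
    "phi ps s (cox x) = cox (phi_flow ps s x)"
    using phi_flow_cox[OF _ x, of ps s] ps(2) by auto
  have k: "kflow s x = root_flow (vc i1) u s (phi_flow ps s x)"
    using kflow_decomposition[OF ps] x by (simp add: Zhat_iff)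
  show "kflow s x \<in> Zh" unfolding k using demazure_root_u phi(1) by (rule root_flow_Zhat)
  show "ext s (cox x) = cox (kflow s x)"
    unfolding comp_apply phi(2) k lambda_u_root_map[OF demazure_root_u]
    using demazure_root_u phi(1) by (rule root_map_cox)
qed

text \<open>A fibre over \<open>X\<close> inside \<open>Xhat\<close> lies in a fibre over
  \<open>Z\<close> inside \<open>Zhat\<close>, so the flow is well defined on \<open>X\<close>
  because it already is on \<open>Z\<close>; what has to be added is that \<open>Xhat\<close> is
  preserved.\<close>

lemma lambda_kappa_cox:
  assumes x: "x \<in> Xhat D \<Sigma>"
  shows "kflow s x \<in> Xhat D \<Sigma>"
    "lam_k s (cox x) = ext s (cox x)"
    "lam_k s (cox x) = cox (kflow s x)"
proof -
  have X: "kflow s y \<in> Xhat D \<Sigma>" if "y \<in> Xhat D \<Sigma>" for y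
    using that kflow_Xbar kflow_cox(1) by (simp add: Xhat_def)
  then show "kflow s x \<in> Xhat D \<Sigma>" using x .
  show *: "lam_k s (cox x) = ext s (cox x)"
    unfolding lambda_kappa_def
  proof (rule descend_eq[OF x refl], rule conjI)
    fix x' assume x': "x' \<in> Xhat D \<Sigma>" "cox x' = cox x"
    show "kflow s x' \<in> Xhat D \<Sigma>" using x'(1) by (rule X)
    show "cox (kflow s x') = ext s (cox x)"
      using kflow_cox(2)[of x' s] x' by (simp add: Xhat_def)
  qed
  show "lam_k s (cox x) = cox (kflow s x)"
    unfolding * using x by (intro kflow_cox(2)) (simp add: Xhat_def)
qed

lemma ext_rat_automorphism: "rat_automorphism (ZV) (ext s)"
  unfolding lambda_u_root_map[OF demazure_root_u]
  by (rule rat_automorphism_comp[OF mult_closed_Z_var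
        phi_u_rat_automorphism[OF equalityD1[OF ps(2)]]
        root_map_rat_automorphism[OF demazure_root_u]])

lemma points_X_var: "points (X_var D \<Sigma>) = X_points D \<Sigma>"
proof -
  have "X_points D \<Sigma> \<subseteq> tpoints"
    using cox_in_toric_points by (auto simp: X_points_def Xhat_def)
  then show ?thesis unfolding X_var_def points_restrict points_Z_var by blast
qed

lemma lambda_kappa_X_points:
  assumes "z \<in> X_points D \<Sigma>"
  shows "lam_k s z = ext s z" "ext s z \<in> X_points D \<Sigma>"
    "lam_k (- s) (lam_k s z) = z"
proof -
  obtain x where x: "x \<in> Xhat D \<Sigma>" "z = cox x"
    using assms by (auto simp: X_points_def)
  show 1: "lam_k s z = ext s z"
    unfolding x(2) by (rule lambda_kappa_cox(2)[OF x(1)])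
  have "lam_k s z \<in> X_points D \<Sigma>"
    unfolding x(2) lambda_kappa_cox(3)[OF x(1)] X_points_def
    by (rule imageI) (rule lambda_kappa_cox(1)[OF x(1)])
  then show "ext s z \<in> X_points D \<Sigma>" by (simp only: 1)
  have "x \<in> Zbar D" using x(1) by (simp add: Xhat_def Zhat_def)
  then show "lam_k (- s) (lam_k s z) = z"
    unfolding x(2) lambda_kappa_cox(3)[OF x(1)] lambda_kappa_cox(3)[OF lambda_kappa_cox(1)[OF x(1)]]
    by (simp only: kflow_inverse)
qed

lemma lambda_kappa_loc_rational:
  "loc_rational (X_var D \<Sigma>) (X_var D \<Sigma>) (lam_k s)"
proof (rule loc_rational_cong)
  have "loc_rational (ZV) (ZV) (ext s)"
    using ext_rat_automorphism by (simp add: rat_automorphism_def)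
  then show "loc_rational (X_var D \<Sigma>) (X_var D \<Sigma>) (ext s)"
    unfolding X_var_def by (rule loc_rational_restrict) (use lambda_kappa_X_points(2) in blast)
  show "ext s z = lam_k s z" if "z \<in> points (X_var D \<Sigma>)" for z
    using lambda_kappa_X_points(1)[of z s] that by (simp only: points_X_var)
qed

lemma mult_closed_X_var: "e \<in> X_var D \<Sigma> \<Longrightarrow> mult_closed e"
  unfolding X_var_def using mult_closed_restrict mult_closed_Z_var by (elim imageE) blast

lemma lambda_kappa_rat_automorphism:
  "rat_automorphism (X_var D \<Sigma>) (lam_k s)"
  unfolding rat_automorphism_def points_X_var
proof (intro conjI exI[of _ "lam_k (- s)"] lambda_kappa_loc_rational ballI)
  fix z assume z: "z \<in> X_points D \<Sigma>"
  show "lam_k (- s) (lam_k s z) = z"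
    using z by (rule lambda_kappa_X_points(3))
  show "lam_k s (lam_k (- s) z) = z"
    using lambda_kappa_X_points(3)[OF z, of "- s"] by simp
qed

end

end

theorem theorem5p4:
  fixes D :: "'k::{alg_closed_field, field_char_0} AP_data"
    and \<Sigma> :: "(nat \<Rightarrow> rat) set set"
    and u :: "nat \<Rightarrow> int" and i0 i1 :: nat and c :: "nat \<Rightarrow> nat"
    and \<beta> :: "nat \<Rightarrow> 'k" and s :: 'k
    and ps :: "(nat \<times> nat) list"
  assumes "AP_valid D"
    and "complete_fan (dimN D) \<Sigma>"
    and "rays (dimN D) \<Sigma> = (\<lambda>w. cone_gen {rvec (col D w)}) ` vars D"
    and "horizontal_P_root D u i0 i1 c"
    and "in_row_space D \<beta>" and "\<beta> i0 = 0" and "\<beta> i1 = 1"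
    and "distinct ps"
    and "set ps = {1..lexp D i1 (c i1)} \<times> ({0..rr D} - {i0, i1})"
  shows
    "automorphism (X_var D \<Sigma>) (lambda_kappa D \<Sigma> \<beta> u i0 i1 c s) \<and>
     automorphism (Z_var D \<Sigma>) (phi_u D \<Sigma> \<beta> u i1 c ps s) \<and>
     automorphism (Z_var D \<Sigma>) (lambda_u D \<Sigma> (Tv i1 (c i1)) u s \<circ> phi_u D \<Sigma> \<beta> u i1 c ps s) \<and>
     (\<forall>z\<in>X_points D \<Sigma>.
        lambda_kappa D \<Sigma> \<beta> u i0 i1 c s z =
        (lambda_u D \<Sigma> (Tv i1 (c i1)) u s \<circ> phi_u D \<Sigma> \<beta> u i1 c ps s) z) \<and>
     (let L = exp_lnd s (delta_kappa D \<beta> u i0 i1 c) in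
        (\<forall>k\<in>{1..mm D}. L (Var (Sv k)) = Var (Sv k)) \<and>
        (\<forall>i\<le>rr D. \<forall>j\<in>{1..nn D i}. i = i0 \<or> j \<noteq> c i \<longrightarrow> L (Var (Tv i j)) = Var (Tv i j)) \<and>
        L (Var (Tv i1 (c i1))) = Var (Tv i1 (c i1)) +
          Const s * delta_u D (Tv i1 (c i1)) u (Var (Tv i1 (c i1))) \<and>
        (\<forall>\<iota>\<in>{0..rr D} - {i0, i1}.
           L (Var (Tv \<iota> (c \<iota>))) = Var (Tv \<iota> (c \<iota>)) +
             (\<Sum>\<nu> = 1..lexp D i1 (c i1).
                Const (alpha D \<beta> i1 c s \<nu> \<iota>) *
                delta_u D (Tv \<iota> (c \<iota>)) (u_form u i1 \<nu> \<iota>) (Var (Tv \<iota> (c \<iota>))))))"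
proof -
  interpret horizontal_root D \<Sigma> u i0 i1 c \<beta>
    using assms by unfold_locales
  note ps = assms(8,9)
  show ?thesis
    unfolding Let_def
  proof (intro conjI ballI allI impI)
    show "automorphism (X_var D \<Sigma>) (lambda_kappa D \<Sigma> \<beta> u i0 i1 c s)"
      by (rule rat_automorphism_automorphism[OF mult_closed_X_var[OF ps] lambda_kappa_rat_automorphism[OF ps]])
    show "automorphism (Z_var D \<Sigma>) (phi_u D \<Sigma> \<beta> u i1 c ps s)"
      by (rule rat_automorphism_automorphism[OF mult_closed_Z_var phi_u_rat_automorphism])
        (simp_all add: ps(2))
    show "automorphism (Z_var D \<Sigma>) (lambda_u D \<Sigma> (Tv i1 (c i1)) u s \<circ> phi_u D \<Sigma> \<beta> u i1 c ps s)"
      by (rule rat_automorphism_automorphism[OF mult_closed_Z_var ext_rat_automorphism[OF ps]])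
    show "lambda_kappa D \<Sigma> \<beta> u i0 i1 c s z =
        (lambda_u D \<Sigma> (Tv i1 (c i1)) u s \<circ> phi_u D \<Sigma> \<beta> u i1 c ps s) z" if "z \<in> X_points D \<Sigma>" for z
      by (rule lambda_kappa_X_points(1)[OF ps that])
    show "exp_lnd s (delta_kappa D \<beta> u i0 i1 c) (Var (Sv k)) = Var (Sv k)" for k
      by (rule exp_kappa_other) auto
    show "exp_lnd s (delta_kappa D \<beta> u i0 i1 c) (Var (Tv i j)) = Var (Tv i j)"
      if "i = i0 \<or> j \<noteq> c i" for i j
      by (rule exp_kappa_other) (use that indices(3) in auto)
    show "exp_lnd s (delta_kappa D \<beta> u i0 i1 c) (Var (Tv i1 (c i1))) = Var (Tv i1 (c i1)) +
        Const s * delta_u D (Tv i1 (c i1)) u (Var (Tv i1 (c i1)))"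
      unfolding exp_kappa_i1 delta_u_root_var[OF vc_vars[OF indices(2)]] ..
    fix \<iota> assume \<iota>: "\<iota> \<in> {0..rr D} - {i0, i1}"
    then have "\<iota> \<le> rr D" by simp
    show "exp_lnd s (delta_kappa D \<beta> u i0 i1 c) (Var (Tv \<iota> (c \<iota>))) = Var (Tv \<iota> (c \<iota>)) +
        (\<Sum>\<nu> = 1..lexp D i1 (c i1). Const (alpha D \<beta> i1 c s \<nu> \<iota>) *
          delta_u D (Tv \<iota> (c \<iota>)) (u_form u i1 \<nu> \<iota>) (Var (Tv \<iota> (c \<iota>))))"
      unfolding exp_kappa_I[OF \<iota>] delta_u_root_var[OF vc_vars[OF \<open>\<iota> \<le> rr D\<close>]] by (simp only:)
  qed
qed

end
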